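(* Let $F$ be a $4$-flipclass (of some $\mathfrak S_n$) with $t$-vector $t_F=(t_0,t_1,t_2,t_3,t_4)$. Then $c(F)$ depends only on $t_F$ and is given by $$c(F)=\begin{cases}3, & \text{if } t_F\in\{(1,5,10,5,1),(1,8,14,8,1)\},\\ 2, & \text{if } t_1+t_3\ge 12 \text{ and } t_F\neq(1,8,14,8,1),\\ 1, & \text{otherwise.}\end{cases}$$
   Context: $\mathfrak S_n$ is the symmetric group on $[n]$, $T$ its transpositions, $\ell$ the length w.r.t. simple transpositions. The Bruhat graph $B(\mathfrak S_n)$ has an edge $x\xrightarrow{t}y$ iff $yx^{-1}=t\in T$ and $\ell(x)<\ell(y)$. $P_h(u,v)$ is the set of paths $u=x_0\to\cdots\to x_h=v$ of length $h$. Between two fixed vertices there are $0$ or $2$ paths of length $2$; each is the flip of the other. The $i$-th flip operator $f_i$ ($i\in[h-1]$) on $P_h(u,v)$ replaces $x_{i-1}\to x_i\to x_{i+1}$ by its flip; the orbits of $\langle f_1,\dots,f_{h-1}\rangle$ on $P_h(u,v)$ are the $h$-flipclasses of paths from $u$ to $v$ (an $h$-flipclass of $\mathfrak S_n$ is one of these for some $u,v$). The $t$-vector of an $h$-flipclass $F$ is $(t_0,\dots,t_h)$ where $t_i$ is the number of distinct elements $x$ such that some path $(x_0,\dots,x_h)\in F$ has $x_i=x$. A reflection ordering is a total order $\preceq$ on $T$ such that for $a<b<c$ either $(a,b)\preceq(a,c)\preceq(b,c)$ or $(b,c)\preceq(a,c)\preceq(a,b)$; a path with labels $t_1,\dots,t_h$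 is increasing if $t_1\preceq\cdots\preceq t_h$; $c(F)$ denotes the number of increasing paths in $F$ (independent of the chosen reflection ordering). *)

theory Defs
  imports "HOL-Combinatorics.Permutations"
begin

definition Sn :: "nat \<Rightarrow> (nat \<Rightarrow> nat) set" where
  "Sn n = {x. x permutes {1..n}}"

definition len :: "nat \<Rightarrow> (nat \<Rightarrow> nat) \<Rightarrow> nat" where
  "len n x = card {(i, j). 1 \<le> i \<and> i < j \<and> j \<le> n \<and> x j < x i}"

text \<open>Transpositions of S_n, encoded as pairs (a,b) with a < b.\<close>
definition Tn :: "nat \<Rightarrow> (nat \<times> nat) set" where
  "Tn n = {(a, b). 1 \<le> a \<and> a < b \<and> b \<le> n}"

definition bedge :: "nat \<Rightarrow> (nat \<Rightarrow> nat) \<Rightarrow> (nat \<Rightarrow> nat) \<Rightarrow> bool" where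
  "bedge n x y \<longleftrightarrow> x \<in> Sn n \<and> y \<in> Sn n \<and>
     (\<exists>(a, b) \<in> Tn n. y = transpose a b \<circ> x) \<and> len n x < len n y"

definition label :: "nat \<Rightarrow> (nat \<Rightarrow> nat) \<Rightarrow> (nat \<Rightarrow> nat) \<Rightarrow> nat \<times> nat" where
  "label n x y = (THE t. t \<in> Tn n \<and> y = transpose (fst t) (snd t) \<circ> x)"

definition paths :: "nat \<Rightarrow> nat \<Rightarrow> (nat \<Rightarrow> nat) \<Rightarrow> (nat \<Rightarrow> nat) \<Rightarrow> (nat \<Rightarrow> nat) list set" where
  "paths n h u v = {p. length p = Suc h \<and> p ! 0 = u \<and> p ! h = v \<and>
      (\<forall>i < h. bedge n (p ! i) (p ! Suc i))}"

definition flip_mid :: "nat \<Rightarrow> (nat \<Rightarrow> nat) \<Rightarrow> (nat \<Rightarrow> nat) \<Rightarrow> (nat \<Rightarrow> nat) \<Rightarrow> (nat \<Rightarrow> nat)" where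
  "flip_mid n a b c = (THE b'. b' \<noteq> b \<and> bedge n a b' \<and> bedge n b' c)"

definition flip_op :: "nat \<Rightarrow> nat \<Rightarrow> (nat \<Rightarrow> nat) list \<Rightarrow> (nat \<Rightarrow> nat) list" where
  "flip_op n i p = p[i := flip_mid n (p ! (i - 1)) (p ! i) (p ! Suc i)]"

definition flip_rel :: "nat \<Rightarrow> nat \<Rightarrow> (nat \<Rightarrow> nat) \<Rightarrow> (nat \<Rightarrow> nat) \<Rightarrow>
    ((nat \<Rightarrow> nat) list \<times> (nat \<Rightarrow> nat) list) set" where
  "flip_rel n h u v = {(p, flip_op n i p) | p i. p \<in> paths n h u v \<and> 1 \<le> i \<and> i < h}"

text \<open>Orbits of the group generated by the f_i on P_h(u,v): classes of the
  reflexive-transitive-symmetric closure of the generator graphs.\<close>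
definition flipclasses :: "nat \<Rightarrow> nat \<Rightarrow> (nat \<Rightarrow> nat) \<Rightarrow> (nat \<Rightarrow> nat) \<Rightarrow>
    (nat \<Rightarrow> nat) list set set" where
  "flipclasses n h u v =
     (\<lambda>p. {q. (p, q) \<in> (flip_rel n h u v \<union> (flip_rel n h u v)\<inverse>)\<^sup>*}) ` paths n h u v"

definition tvec :: "nat \<Rightarrow> (nat \<Rightarrow> nat) list set \<Rightarrow> nat list" where
  "tvec h F = map (\<lambda>i. card ((\<lambda>p. p ! i) ` F)) [0..<Suc h]"

definition refl_order :: "nat \<Rightarrow> (nat \<times> nat) rel \<Rightarrow> bool" where
  "refl_order n R \<longleftrightarrow> R \<subseteq> Tn n \<times> Tn n \<and> linear_order_on (Tn n) R \<and>
     (\<forall>a b c. 1 \<le> a \<and> a < b \<and> b < c \<and> c \<le> n \<longrightarrow>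
        (((a,b),(a,c)) \<in> R \<and> ((a,c),(b,c)) \<in> R) \<or>
        (((b,c),(a,c)) \<in> R \<and> ((a,c),(a,b)) \<in> R))"

definition increasing :: "nat \<Rightarrow> (nat \<times> nat) rel \<Rightarrow> (nat \<Rightarrow> nat) list \<Rightarrow> bool" where
  "increasing n R p \<longleftrightarrow>
     (\<forall>i. i + 2 < length p \<longrightarrow>
        (label n (p ! i) (p ! Suc i), label n (p ! Suc i) (p ! Suc (Suc i))) \<in> R)"

definition cF :: "nat \<Rightarrow> (nat \<times> nat) rel \<Rightarrow> (nat \<Rightarrow> nat) list set \<Rightarrow> nat" where
  "cF n R F = card {p \<in> F. increasing n R p}"

end

theory Submission
  imports Defs
begin

text \<open>
  A path from \<open>u\<close> is encoded by its word of four labels. Which words occur, how they are flipped and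
  which vertices they share depends only on the relative order of the values of \<open>w = inv u\<close> within the
  connected components of the graph formed by the labels; as a flip does not change these components
  and their sizes \<open>k\<close> satisfy that the sum of \<open>k - 1\<close> is at most 4, only finitely many flipclasses
  remain up to relabelling. Every class has a representative that is increasing for the lexicographic
  order (flipping a descent makes the word smaller), so it suffices to explore the orbits of those.

  To treat all reflection orderings at once, note that an increasing path is determined by its set of
  labels, and that a set of labels comes from an increasing path iff some path of the class with these
  labels has all its pairs of non-commuting labels in order. This only involves the orientation of the
  triples \<open>a < b < c\<close>, and the orientations that are consistent on every quadruple form a small decision
  tree, along which the count is constant for each of the finitely many classes.
\<close>

section \<open>Transposition words and their flips\<close>

text \<open>The obstacle is the comparison of disjoint transpositions: no triple
  \<open>a < b < c\<close> controls it, so orientations alone do not tell which paths are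
  increasing. Commuting labels at adjacent places can be exchanged by a flip, however, so a set of
  labels can be tested on any word whose overlapping labels are in order; this is why label sets are
  counted instead of paths. Components survive a flip because \<open>(p q)(q r)\<close> is replaced
  by another product on the same three points, while commuting labels are only exchanged. Four
  labels give components of at most five elements. The condition on quadruples is used in one
  direction: every reflection ordering satisfies it, so branches violating it are cut off, and the
  count is verified on every branch that remains. The choice of increasing start words has a further
  advantage: they can be enumerated as subsequences of one sorted list of labels.\<close>

type_synonym lab = "nat \<times> nat"
type_synonym word = "lab \<times> lab \<times> lab \<times> lab"

definition tr :: "lab \<Rightarrow> nat \<Rightarrow> nat" where
  "tr t = transpose (fst t) (snd t)"

text \<open>Here \<open>w\<close> is the inverse of the current permutation: left multiplication by the transposition
  of the values \<open>a < b\<close> increases the length iff \<open>a\<close> stands to the left of \<open>b\<close>, and it replaces \<open>w\<close>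
  by \<open>w \<circ> transpose a b\<close>.\<close>

definition ok1 :: "(nat \<Rightarrow> nat) \<Rightarrow> lab \<Rightarrow> bool" where
  "ok1 w t \<longleftrightarrow> fst t < snd t \<and> w (fst t) < w (snd t)"

definition ok2 :: "(nat \<Rightarrow> nat) \<Rightarrow> lab \<Rightarrow> lab \<Rightarrow> bool" where
  "ok2 w s t \<longleftrightarrow> ok1 w s \<and> ok1 (w \<circ> tr s) t"

text \<open>An unordered pair as a label: pivots rearrange three points whose relative order is left
  open.\<close>

definition mk :: "nat \<Rightarrow> nat \<Rightarrow> lab" where
  "mk a b = (if a < b then (a, b) else (b, a))"

text \<open>A product \<open>(p q)(q r)\<close> is a 3-cycle, with the two further factorizations \<open>(p r)(p q)\<close> and
  \<open>(q r)(p r)\<close>. If the given one is admissible, then exactly one of the others is, and the condition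
  below says that it is the first one.\<close>

definition pivot :: "(nat \<Rightarrow> nat) \<Rightarrow> nat \<Rightarrow> nat \<Rightarrow> nat \<Rightarrow> lab \<times> lab" where
  "pivot w p q r = (if (p < r \<longleftrightarrow> w p < w r) \<and> (p < q \<longleftrightarrow> w r < w q) then (mk p r, mk p q) else (mk q r, mk p r))"

fun flip2 :: "(nat \<Rightarrow> nat) \<Rightarrow> lab \<Rightarrow> lab \<Rightarrow> lab \<times> lab" where
  "flip2 w (a,b) (c,d) =
    (if a = c then pivot w b a d else if a = d then pivot w b a c
     else if b = c then pivot w a b d else if b = d then pivot w a b c else ((c,d),(a,b)))"

definition disj :: "lab \<Rightarrow> lab \<Rightarrow> bool" where
  "disj s t \<longleftrightarrow> fst s \<noteq> fst t \<and> fst s \<noteq> snd t \<and> snd s \<noteq> fst t \<and> snd s \<noteq> snd t"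

text \<open>Distinct labels either commute or share exactly one point \<open>q\<close>. Naming the
  two other ends \<open>p\<close> and \<open>r\<close> without an order merges the four positions of
  the shared point into one case.\<close>

lemma flip2_cases:
  assumes "fst s < snd s" "fst t < snd t" "s \<noteq> t"
  obtains (disj) "disj s t" "\<And>w. flip2 w s t = (t, s)"
  | (pivot) p q r where "p \<noteq> q" "q \<noteq> r" "p \<noteq> r" "s = mk p q" "t = mk q r" "\<And>w. flip2 w s t = pivot w p q r"
proof -
  obtain a b c d where st: "s = (a,b)" "t = (c,d)" by (metis surj_pair)
  have l: "a < b" "c < d" using assms st by auto
  show thesis
  proof (cases "disj s t")
    case True
    with that(1) show ?thesis by (simp add: st disj_def)
  next
    case False
    then consider "a = c" | "a = d" | "b = c" | "b = d" unfolding disj_def st by auto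
    then show ?thesis
    proof cases
      case 1 then show ?thesis using l assms(3) by (intro that(2)[of b a d]) (auto simp: st mk_def)
    next
      case 2 then show ?thesis using l assms(3) by (intro that(2)[of b a c]) (auto simp: st mk_def)
    next
      case 3 then show ?thesis using l assms(3) by (intro that(2)[of a b d]) (auto simp: st mk_def)
    next
      case 4 then show ?thesis using l assms(3) by (intro that(2)[of a b c]) (auto simp: st mk_def)
    qed
  qed
qed

lemma tr_mk: "tr (mk a b) = transpose a b"
  by (auto simp: tr_def mk_def transpose_commute)

lemma ok1_mk: "a \<noteq> b \<Longrightarrow> inj w \<Longrightarrow> ok1 w (mk a b) \<longleftrightarrow> (a < b \<longleftrightarrow> w a < w b)"
  using inj_eq[of w a b] by (auto simp: ok1_def mk_def)

lemma inj_comp_tr: "inj w \<Longrightarrow> inj (w \<circ> tr s)"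
  by (simp add: tr_def inj_compose)

lemma transpose_cyc:
  assumes "p \<noteq> q" "q \<noteq> r" "p \<noteq> r"
  shows "transpose p r \<circ> transpose p q = transpose p q \<circ> transpose q r"
    "transpose q r \<circ> transpose p r = transpose p q \<circ> transpose q r"
  using assms by (auto simp: fun_eq_iff transpose_def)

lemma ok2_mk:
  assumes "inj w" "a \<noteq> b" "c \<noteq> d"
  shows "ok2 w (mk a b) (mk c d) \<longleftrightarrow> (a < b \<longleftrightarrow> w a < w b) \<and> (c < d \<longleftrightarrow> w (transpose a b c) < w (transpose a b d))"
  using assms by (simp add: ok2_def ok1_mk inj_comp_tr) (simp add: tr_mk)

lemma mk_eq_iff: "mk a b = mk c d \<longleftrightarrow> a = c \<and> b = d \<or> a = d \<and> b = c"
  by (auto simp: mk_def)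

lemma pivot_props:
  assumes "inj w" and d: "p \<noteq> q" "q \<noteq> r" "p \<noteq> r" and ok: "ok2 w (mk p q) (mk q r)"
    and e: "pivot w p q r = (s', t')"
  shows "ok2 w s' t'" "tr s' \<circ> tr t' = tr (mk p q) \<circ> tr (mk q r)" "(s', t') \<noteq> (mk p q, mk q r)"
    "\<And>s'' t''. ok2 w s'' t'' \<Longrightarrow> (s'', t'') \<in> {(mk p q, mk q r), (mk p r, mk p q), (mk q r, mk p r)} \<Longrightarrow> (s'', t'') = (mk p q, mk q r) \<or> (s'', t'') = (s', t')"
proof -
  have w: "w p \<noteq> w q" "w q \<noteq> w r" "w p \<noteq> w r" using assms by (auto dest: injD)
  have o: "(p < q \<longleftrightarrow> w p < w q) \<and> (q < r \<longleftrightarrow> w p < w r)"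
    using ok d by (simp add: ok2_mk assms(1) transpose_def)
  have o1: "ok2 w (mk p r) (mk p q) \<longleftrightarrow> (p < r \<longleftrightarrow> w p < w r) \<and> (p < q \<longleftrightarrow> w r < w q)"
    using d by (simp add: ok2_mk assms(1) transpose_def)
  have o2: "ok2 w (mk q r) (mk p r) \<longleftrightarrow> (q < r \<longleftrightarrow> w q < w r) \<and> (p < r \<longleftrightarrow> w p < w q)"
    using d by (simp add: ok2_mk assms(1) transpose_def)
  \<comment> \<open>This concerns two linear orders on three points, that of \<open>p\<close>,
    \<open>q\<close>, \<open>r\<close> and that of their values under \<open>w\<close>; with the
    admissibility \<open>o\<close> of the given factorization, arithmetic decides it.\<close>
  have x: "ok2 w (mk q r) (mk p r) \<longleftrightarrow> \<not> ok2 w (mk p r) (mk p q)"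
    unfolding o1 o2 using o w d by linarith
  show "ok2 w s' t'" using e x by (auto simp: pivot_def o1[symmetric] split: if_splits)
  show "tr s' \<circ> tr t' = tr (mk p q) \<circ> tr (mk q r)"
    using e transpose_cyc[OF d] by (auto simp: pivot_def tr_mk split: if_splits)
  show "(s', t') \<noteq> (mk p q, mk q r)" using e d by (auto simp: pivot_def mk_eq_iff split: if_splits)
  show "\<And>s'' t''. ok2 w s'' t'' \<Longrightarrow> (s'', t'') \<in> {(mk p q, mk q r), (mk p r, mk p q), (mk q r, mk p r)} \<Longrightarrow> (s'', t'') = (mk p q, mk q r) \<or> (s'', t'') = (s', t')"
    using e x by (auto simp: pivot_def o1[symmetric] split: if_splits)
qed

lemma tr_inject:
  assumes "fst s < snd s" "fst t < snd t" "tr s = tr t"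
  shows "s = t"
proof -
  obtain a b c d where st: "s = (a,b)" "t = (c,d)" by (metis surj_pair)
  have "b = (if a = c then d else if a = d then c else a)"
    using fun_cong[OF assms(3), of a] by (simp add: st tr_def transpose_def)
  then show ?thesis using assms(1,2) st by (auto split: if_splits)
qed

text \<open>The product sends \<open>p\<close> to \<open>q\<close> to \<open>r\<close> to
  \<open>p\<close>. Disjoint labels would give an involution, so \<open>s\<close> and
  \<open>t\<close> share a point and their product is a cycle on their own three points. The two
  cycles agree up to rotation, and the three rotations are the three pairs.\<close>

lemma product_cyc:
  assumes "p \<noteq> q" "q \<noteq> r" "p \<noteq> r" "fst s < snd s" "fst t < snd t"
    and e: "tr s \<circ> tr t = transpose p q \<circ> transpose q r"
  shows "(s, t) \<in> {(mk p q, mk q r), (mk p r, mk p q), (mk q r, mk p r)}"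
proof -
  define f where "f = tr s \<circ> tr t"
  have fp: "f p = q" "f q = r" "f r = p" and fo: "\<And>x. x \<noteq> p \<Longrightarrow> x \<noteq> q \<Longrightarrow> x \<noteq> r \<Longrightarrow> f x = x"
    using assms(1-3) unfolding f_def e by (auto simp: transpose_def)
  have "s \<noteq> t"
  proof
    assume "s = t"
    then have "f = id" by (simp add: f_def tr_def)
    then show False using fp assms by simp
  qed
  show ?thesis
  proof (cases rule: flip2_cases[OF assms(4,5) \<open>s \<noteq> t\<close>])
    case 1
    then have "f (f p) = p" unfolding f_def tr_def disj_def by (auto simp: transpose_def)
    then show ?thesis using fp assms by auto
  next
    case (2 p' q' r')
    then have f': "f p' = q'" "f q' = r'" "f r' = p'" by (auto simp: f_def tr_mk transpose_def)
    have "p' \<in> {p, q, r}" using fo[of p'] f' 2 by auto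
    then consider "p' = p" "q' = q" "r' = r" | "p' = q" "q' = r" "r' = p" | "p' = r" "q' = p" "r' = q"
      using f' fp by auto
    then show ?thesis using 2(4,5) by cases (simp_all add: mk_eq_iff)
  qed
qed

text \<open>The product is an involution and thus no 3-cycle, so \<open>s\<close> and
  \<open>t\<close> are disjoint as well, and their point sets must be the two orbits of size
  2.\<close>

lemma product_disj:
  assumes "disj s0 t0" "fst s0 < snd s0" "fst t0 < snd t0" "fst s < snd s" "fst t < snd t"
    and e: "tr s \<circ> tr t = tr s0 \<circ> tr t0"
  shows "(s, t) \<in> {(s0, t0), (t0, s0)}"
proof -
  obtain a b c d where st0: "s0 = (a,b)" "t0 = (c,d)" by (metis surj_pair)
  have di: "a \<noteq> c" "a \<noteq> d" "b \<noteq> c" "b \<noteq> d" "a < b" "c < d" using assms st0 by (auto simp: disj_def)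
  define f where "f = tr s \<circ> tr t"
  have f: "f a = b" "f b = a" "f c = d" "f d = c" "\<And>x. x \<notin> {a,b,c,d} \<Longrightarrow> f x = x"
    using di unfolding f_def e by (auto simp: transpose_def tr_def st0)
  have ff: "f (f x) = x" for x
  proof (cases "x \<in> {a,b,c,d}")
    case True then show ?thesis by (elim insertE emptyE) (simp_all only: f(1-4))
  next
    case False then show ?thesis using f(5)[OF False] by simp
  qed
  have "s \<noteq> t"
  proof
    assume "s = t"
    then have "f = id" by (simp add: f_def tr_def)
    then show False using f(1) di(5) by simp
  qed
  show ?thesis
  proof (cases rule: flip2_cases[OF assms(4,5) \<open>s \<noteq> t\<close>])
    case 1
    obtain a' b' c' d' where st: "s = (a',b')" "t = (c',d')" by (metis surj_pair)
    have di': "a' \<noteq> c'" "a' \<noteq> d'" "b' \<noteq> c'" "b' \<noteq> d'" "a' < b'" "c' < d'" using assms st 1 by (auto simp: disj_def)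
    have f': "f a' = b'" "f c' = d'" using di' unfolding f_def by (auto simp: transpose_def tr_def st)
    have 1: "a' \<in> {a,b,c,d}" by (rule ccontr) (drule f(5), use f' di' in linarith)
    have 2: "c' \<in> {a,b,c,d}" by (rule ccontr) (drule f(5), use f' di' in linarith)
    have a: "a' = a \<and> b' = b \<or> a' = c \<and> b' = d"
      using 1 f'(1) f(1-4) di(5,6) di'(5) by (metis insertE empty_iff less_asym)
    have c: "c' = a \<and> d' = b \<or> c' = c \<and> d' = d"
      using 2 f'(2) f(1-4) di(5,6) di'(6) by (metis insertE empty_iff less_asym)
    show ?thesis using a c di'(1) unfolding st st0 by blast
  next
    case (2 p' q' r')
    then have f': "f p' = q'" "f q' = r'" by (auto simp: f_def tr_mk transpose_def)
    have "r' = p'" using ff[of p'] unfolding f' .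
    then show ?thesis using 2(3) by blast
  qed
qed

lemma ok2D: "ok2 w s t \<Longrightarrow> fst s < snd s \<and> fst t < snd t \<and> s \<noteq> t"
  by (auto simp: ok2_def ok1_def tr_def)

lemma flip2_ok:
  assumes "inj w" "ok2 w s t" "flip2 w s t = (s', t')"
  shows "ok2 w s' t'" "tr s' \<circ> tr t' = tr s \<circ> tr t" "(s', t') \<noteq> (s, t)"
proof -
  note d = ok2D[OF assms(2)]
  have dd: "fst s < snd s" "fst t < snd t" "s \<noteq> t" using d by auto
  have "ok2 w s' t' \<and> tr s' \<circ> tr t' = tr s \<circ> tr t \<and> (s', t') \<noteq> (s, t)"
  proof (cases rule: flip2_cases[OF dd])
    case 1
    then have [simp]: "s' = t" "t' = s" using assms by auto
    show ?thesis using assms(2) 1 d by (auto simp: ok2_def ok1_def tr_def disj_def transpose_def fun_eq_iff)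
  next
    case (2 p q r)
    then show ?thesis using pivot_props(1-3)[OF assms(1), of p q r s' t'] assms by auto
  qed
  then show "ok2 w s' t'" "tr s' \<circ> tr t' = tr s \<circ> tr t" "(s', t') \<noteq> (s, t)" by auto
qed

text \<open>With \<open>flip2_ok\<close> this shows that an admissible pair has exactly one other
  admissible factorization, which makes the \<open>THE\<close> in \<open>flip_mid\<close> well
  defined.\<close>

lemma flip2_unique:
  assumes "inj w" "ok2 w s t" "ok2 w s' t'" "tr s' \<circ> tr t' = tr s \<circ> tr t"
  shows "(s', t') = (s, t) \<or> (s', t') = flip2 w s t"
proof -
  note d = ok2D[OF assms(2)] and d' = ok2D[OF assms(3)]
  have dd: "fst s < snd s" "fst t < snd t" "s \<noteq> t" using d by auto
  show ?thesis
  proof (cases rule: flip2_cases[OF dd])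
    case 1
    then show ?thesis using product_disj[of s t s' t'] d d' assms by auto
  next
    case (2 p q r)
    obtain s1 t1 where e: "pivot w p q r = (s1, t1)" by (metis surj_pair)
    have "(s', t') \<in> {(mk p q, mk q r), (mk p r, mk p q), (mk q r, mk p r)}"
      using product_cyc[of p q r s' t'] 2 d' assms by (simp add: tr_mk)
    from pivot_props(4)[OF assms(1) 2(1-3) _ e assms(3) this]
    show ?thesis using 2 assms e by auto
  qed
qed

text \<open>Flipping twice gives an admissible pair with the original product that differs from
  \<open>(s', t')\<close>; by uniqueness only \<open>(s, t)\<close> is left.\<close>

lemma flip2_flip2:
  assumes "inj w" "ok2 w s t" "flip2 w s t = (s', t')"
  shows "flip2 w s' t' = (s, t)"
proof -
  obtain s2 t2 where e: "flip2 w s' t' = (s2, t2)" by (metis surj_pair)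
  note 1 = flip2_ok[OF assms] and 2 = flip2_ok[OF assms(1) flip2_ok(1)[OF assms] e]
  show ?thesis using flip2_unique[OF assms(1,2) 2(1)] 1 2 assms e by auto
qed

text \<open>Keeps labels inside \<open>Tn n\<close> and preserves the set of points met by a word,
  on which the test \<open>spans\<close> relies.\<close>

lemma flip2_supp:
  assumes "inj w" "ok2 w s t" "flip2 w s t = (s', t')"
  shows "{fst s', snd s'} \<union> {fst t', snd t'} = {fst s, snd s} \<union> {fst t, snd t}"
proof -
  note d = ok2D[OF assms(2)]
  have dd: "fst s < snd s" "fst t < snd t" "s \<noteq> t" using d by auto
  show ?thesis
    by (cases rule: flip2_cases[OF dd]) (use d assms(3) in \<open>auto simp: pivot_def mk_def split: if_splits\<close>)
qed

section \<open>Paths as words of transpositions\<close>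

text \<open>The map \<open>g\<close> injects the inversions of \<open>u\<close> into those of
  \<open>y\<close> other than \<open>(i, j)\<close>. A pair whose order survives the transposition
  is moved along with its values. Any other inversion has one end in \<open>i\<close> or
  \<open>j\<close> and the other end strictly between, and it remains an inversion of
  \<open>y\<close> because \<open>u i < u j\<close>.\<close>

lemma len_comp_transpose_less:
  assumes u: "u permutes {1..n}" and i: "1 \<le> i" "i < j" "j \<le> n" and lt: "u i < u j"
  shows "len n u < len n (u \<circ> transpose i j)"
proof -
  define y where "y = u \<circ> transpose i j"
  define Inv where "Inv x = {(k, l). 1 \<le> k \<and> k < l \<and> l \<le> n \<and> x l < x k}" for x :: "nat \<Rightarrow> nat"
  define g where "g = (\<lambda>(k, l). if transpose i j k < transpose i j l then (transpose i j k, transpose i j l) else (k, l))"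
  have fin: "finite (Inv x)" for x
    by (rule finite_subset[of _ "{1..n} \<times> {1..n}"]) (auto simp: Inv_def)
  have "inj_on g (Inv u)"
    by (auto simp: inj_on_def g_def Inv_def split: if_splits) (auto simp: transpose_eq_iff)
  moreover have "g ` Inv u \<subseteq> Inv y - {(i, j)}"
  proof
    fix z assume "z \<in> g ` Inv u"
    then obtain k l where z: "z = g (k, l)" and kl: "1 \<le> k" "k < l" "l \<le> n" "u l < u k" by (auto simp: Inv_def)
    have b: "1 \<le> transpose i j x \<and> transpose i j x \<le> n" if "1 \<le> x" "x \<le> n" for x
      using that i by (auto simp: transpose_def)
    show "z \<in> Inv y - {(i, j)}"
    proof (cases "transpose i j k < transpose i j l")
      case True
      then have "z = (transpose i j k, transpose i j l)" by (simp add: z g_def)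
      moreover have "z \<noteq> (i, j)" using calculation kl i by (auto simp: transpose_def split: if_splits)
      ultimately show ?thesis using True kl b[of k] b[of l] by (simp add: Inv_def y_def)
    next
      case False
      then have "z = (k, l)" by (simp add: z g_def)
      then show ?thesis using False kl i lt by (auto simp: Inv_def y_def transpose_def split: if_splits)
    qed
  qed
  ultimately have "card (Inv u) \<le> card (Inv y - {(i, j)})"
    by (metis card_image card_mono fin finite_Diff)
  moreover have "(i, j) \<in> Inv y" using i lt by (simp add: Inv_def y_def)
  ultimately have "card (Inv u) < card (Inv y)"
    using fin by (meson card_Diff1_less le_less_trans)
  then show ?thesis by (simp add: len_def Inv_def y_def)
qed

lemma tr_tr [simp]: "tr t \<circ> tr t = id" "tr t (tr t x) = x"
  by (simp_all add: tr_def)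

lemma bij_tr: "bij (tr t)"
  by (simp add: tr_def)

lemma inv_tr [simp]: "inv (tr t) = tr t"
  by (simp add: tr_def)

lemma Sn_bij: "u \<in> Sn n \<Longrightarrow> bij u"
  by (simp add: Sn_def permutes_bij)

lemma inv_tr_comp: "u \<in> Sn n \<Longrightarrow> inv (tr t \<circ> u) = inv u \<circ> tr t"
  by (simp add: o_inv_distrib Sn_bij bij_tr)

lemma tr_comp_Sn: "u \<in> Sn n \<Longrightarrow> t \<in> Tn n \<Longrightarrow> tr t \<circ> u \<in> Sn n"
  by (auto simp: Sn_def Tn_def tr_def intro!: permutes_compose permutes_swap_id)

lemma inj_inv_Sn: "u \<in> Sn n \<Longrightarrow> inj (inv u)"
  using Sn_bij bij_imp_bij_inv bij_is_inj by blast

lemma len_tr_less: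
  assumes u: "u \<in> Sn n" and t: "t \<in> Tn n" and lt: "inv u (fst t) < inv u (snd t)"
  shows "len n u < len n (tr t \<circ> u)"
proof -
  obtain a b where ab: "t = (a, b)" by (cases t)
  have p: "u permutes {1..n}" using u by (simp add: Sn_def)
  have ab': "1 \<le> a" "a < b" "b \<le> n" using t by (auto simp: Tn_def ab)
  have ui: "u (inv u x) = x" for x using p by (simp add: permutes_inverses)
  have r: "inv u x \<in> {1..n}" if "x \<in> {1..n}" for x
    using permutes_in_image[OF permutes_inv[OF p]] that by blast
  have e: "tr t \<circ> u = u \<circ> transpose (inv u a) (inv u b)"
    using p by (auto simp: ab tr_def fun_eq_iff transpose_def permutes_inverses)
  show ?thesis unfolding e
    by (rule len_comp_transpose_less[OF p]) (use lt ab' r[of a] r[of b] in \<open>auto simp: ab ui\<close>)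
qed

lemma bedge_tr_iff:
  assumes u: "u \<in> Sn n" and t: "t \<in> Tn n"
  shows "bedge n u (tr t \<circ> u) \<longleftrightarrow> ok1 (inv u) t"
proof -
  obtain a b where ab: "t = (a, b)" by (cases t)
  have ab': "a < b" using t by (simp add: Tn_def ab)
  have y: "tr t \<circ> u \<in> Sn n" by (rule tr_comp_Sn[OF u t])
  have ex: "\<exists>(a, b) \<in> Tn n. tr t \<circ> u = transpose a b \<circ> u"
    using t by (intro bexI[of _ t]) (auto simp: tr_def)
  have "len n u < len n (tr t \<circ> u) \<longleftrightarrow> inv u a < inv u b"
  proof
    assume l: "len n u < len n (tr t \<circ> u)"
    show "inv u a < inv u b"
    proof (rule ccontr)
      assume "\<not> ?thesis"
      moreover have "inv u a \<noteq> inv u b" using inj_inv_Sn[OF u] ab' by (auto dest: injD)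
      ultimately have "inv u b < inv u a" by simp
      \<comment> \<open>In this case the edge runs backwards: multiplying by \<open>t\<close> once
        more leads from \<open>tr t \<circ> u\<close> up to \<open>u\<close>.\<close>
      then have "inv (tr t \<circ> u) (fst t) < inv (tr t \<circ> u) (snd t)"
        unfolding inv_tr_comp[OF u] by (simp add: ab tr_def)
      from len_tr_less[OF y t this] have "len n (tr t \<circ> u) < len n u"
        by (simp add: o_assoc)
      then show False using l by simp
    qed
  next
    assume "inv u a < inv u b"
    then show "len n u < len n (tr t \<circ> u)" using len_tr_less[OF u t] by (simp add: ab)
  qed
  then show ?thesis using u y ex ab' by (simp add: bedge_def ok1_def ab)
qed

lemma bedgeE:
  assumes "bedge n x y"
  obtains t where "t \<in> Tn n" "y = tr t \<circ> x" "ok1 (inv x) t" "x \<in> Sn n" "y \<in> Sn n"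
proof -
  from assms obtain a b where ab: "(a, b) \<in> Tn n" "y = transpose a b \<circ> x" and x: "x \<in> Sn n" "y \<in> Sn n"
    by (auto simp: bedge_def)
  have y: "y = tr (a, b) \<circ> x" using ab by (simp add: tr_def)
  show thesis using that[OF ab(1) y _ x] bedge_tr_iff[OF x(1) ab(1)] assms y by blast
qed

lemma Tn_less: "t \<in> Tn n \<Longrightarrow> fst t < snd t"
  by (auto simp: Tn_def)

lemma label_tr:
  assumes "t \<in> Tn n" "x \<in> Sn n"
  shows "label n x (tr t \<circ> x) = t"
proof -
  have *: "s = t" if "s \<in> Tn n" "tr t \<circ> x = transpose (fst s) (snd s) \<circ> x" for s
  proof -
    have "tr t = tr s"
      using that(2) Sn_bij[OF assms(2)] by (metis bij_is_surj surj_fun_eq tr_def)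
    then show ?thesis using tr_inject[of t s] assms that Tn_less by auto
  qed
  have "t \<in> Tn n \<and> tr t \<circ> x = transpose (fst t) (snd t) \<circ> x" using assms by (simp add: tr_def)
  then show ?thesis unfolding label_def by (rule the_equality) (use * in blast)
qed

lemma flip2_Tn:
  assumes "inj w" "ok2 w s t" "flip2 w s t = (s', t')" "s \<in> Tn n" "t \<in> Tn n"
  shows "s' \<in> Tn n" "t' \<in> Tn n"
proof -
  have Tn: "t \<in> Tn n \<longleftrightarrow> fst t < snd t \<and> {fst t, snd t} \<subseteq> {1..n}" for t
    by (auto simp: Tn_def)
  have "{fst s', snd s'} \<union> {fst t', snd t'} \<subseteq> {1..n}"
    using flip2_supp[OF assms(1-3)] assms(4,5) unfolding Tn by auto
  then show "s' \<in> Tn n" "t' \<in> Tn n"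
    using ok2D[OF flip2_ok(1)[OF assms(1-3)]] unfolding Tn by auto
qed

text \<open>Words multiply on the right of \<open>inv u\<close>, the vertices of a path on the left
  of \<open>u\<close>; taking inverses translates between the two readings.\<close>

lemma comp_tr_swap:
  assumes "tr s \<circ> tr t = tr s' \<circ> tr t'"
  shows "tr t \<circ> tr s = tr t' \<circ> tr s'"
proof -
  have "inv (tr s \<circ> tr t) = inv (tr s' \<circ> tr t')" using assms by simp
  then show ?thesis by (simp add: o_inv_distrib bij_tr)
qed

lemma flip_mid_tr:
  assumes u: "u \<in> Sn n" and s: "s \<in> Tn n" and t: "t \<in> Tn n" and ok: "ok2 (inv u) s t"
    and e: "flip2 (inv u) s t = (s', t')"
  shows "flip_mid n u (tr s \<circ> u) (tr t \<circ> (tr s \<circ> u)) = tr s' \<circ> u"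
    and "tr t' \<circ> (tr s' \<circ> u) = tr t \<circ> (tr s \<circ> u)"
proof -
  note inj = inj_inv_Sn[OF u]
  note f = flip2_ok[OF inj ok e] and T' = flip2_Tn[OF inj ok e s t]
  show c: "tr t' \<circ> (tr s' \<circ> u) = tr t \<circ> (tr s \<circ> u)"
    using comp_tr_swap[OF f(2)] by (simp add: o_assoc)
  have surj: "surj u" using Sn_bij[OF u] by (rule bij_is_surj)
  have u': "tr s' \<circ> u \<in> Sn n" using tr_comp_Sn u T' by blast
  have s'ne: "tr s' \<circ> u \<noteq> tr s \<circ> u"
  proof
    assume "tr s' \<circ> u = tr s \<circ> u"
    then have "tr s' = tr s" using surj by (metis surj_fun_eq)
    moreover from this have "tr t' = tr t" using f(2)
      by (metis comp_assoc tr_tr(1) id_comp)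
    ultimately show False using f(3) tr_inject T' s t Tn_less by (metis prod.inject)
  qed
  have "bedge n u (tr s' \<circ> u)" "bedge n (tr s' \<circ> u) (tr t \<circ> (tr s \<circ> u))"
    using f(1) bedge_tr_iff[OF u T'(1)] bedge_tr_iff[OF u' T'(2)] c inv_tr_comp[OF u, of s']
    by (simp_all add: ok2_def)
  moreover have "b = tr s' \<circ> u"
    if b: "b \<noteq> tr s \<circ> u" "bedge n u b" "bedge n b (tr t \<circ> (tr s \<circ> u))" for b
  proof -
    from b(2) obtain s2 where s2: "s2 \<in> Tn n" "b = tr s2 \<circ> u" "ok1 (inv u) s2" by (rule bedgeE)
    from b(3) obtain t2 where t2: "t2 \<in> Tn n" "tr t \<circ> (tr s \<circ> u) = tr t2 \<circ> b" "ok1 (inv b) t2" by (rule bedgeE)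
    have "ok2 (inv u) s2 t2" using s2 t2 inv_tr_comp[OF u] by (simp add: ok2_def)
    moreover have "tr t \<circ> tr s = tr t2 \<circ> tr s2"
      using t2(2) surj unfolding s2(2) o_assoc by (metis surj_fun_eq)
    then have "tr s2 \<circ> tr t2 = tr s \<circ> tr t" using comp_tr_swap by metis
    ultimately have "(s2, t2) = (s, t) \<or> (s2, t2) = (s', t')"
      using flip2_unique[OF inj ok] e by metis
    then show ?thesis using b(1) s2(2) by auto
  qed
  ultimately show "flip_mid n u (tr s \<circ> u) (tr t \<circ> (tr s \<circ> u)) = tr s' \<circ> u"
    unfolding flip_mid_def using s'ne by (intro the_equality) blast+
qed

section \<open>Words of four labels and the paths they encode\<close>

fun pathof :: "(nat \<Rightarrow> nat) \<Rightarrow> word \<Rightarrow> (nat \<Rightarrow> nat) list" where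
  "pathof u (t1, t2, t3, t4) = [u, tr t1 \<circ> u, tr t2 \<circ> (tr t1 \<circ> u), tr t3 \<circ> (tr t2 \<circ> (tr t1 \<circ> u)),
     tr t4 \<circ> (tr t3 \<circ> (tr t2 \<circ> (tr t1 \<circ> u)))]"

fun ok4 :: "(nat \<Rightarrow> nat) \<Rightarrow> word \<Rightarrow> bool" where
  "ok4 w (t1, t2, t3, t4) \<longleftrightarrow> ok1 w t1 \<and> ok1 (w \<circ> tr t1) t2 \<and> ok1 (w \<circ> tr t1 \<circ> tr t2) t3
     \<and> ok1 (w \<circ> tr t1 \<circ> tr t2 \<circ> tr t3) t4"

fun labs :: "word \<Rightarrow> lab set" where
  "labs (t1, t2, t3, t4) = {t1, t2, t3, t4}"

text \<open>Every index other than 1 and 2 acts as 3, so \<open>wflip_props\<close> holds for all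
  \<open>i\<close>.\<close>

fun wflip :: "(nat \<Rightarrow> nat) \<Rightarrow> nat \<Rightarrow> word \<Rightarrow> word" where
  "wflip w i (t1, t2, t3, t4) =
    (if i = 1 then (case flip2 w t1 t2 of (s1, s2) \<Rightarrow> (s1, s2, t3, t4))
     else if i = 2 then (case flip2 (w \<circ> tr t1) t2 t3 of (s2, s3) \<Rightarrow> (t1, s2, s3, t4))
     else (case flip2 (w \<circ> tr t1 \<circ> tr t2) t3 t4 of (s3, s4) \<Rightarrow> (t1, t2, s3, s4)))"

fun prod4 :: "word \<Rightarrow> nat \<Rightarrow> nat" where
  "prod4 (t1, t2, t3, t4) = tr t1 \<circ> tr t2 \<circ> tr t3 \<circ> tr t4"

text \<open>Stands for the middle vertex of the path from \<open>u\<close>, which is the inverse of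
  this product times \<open>u\<close>.\<close>

fun prod2 :: "word \<Rightarrow> nat \<Rightarrow> nat" where
  "prod2 (t1, t2, t3, t4) = tr t1 \<circ> tr t2"

lemma inj_comp_tr2: "inj w \<Longrightarrow> inj (w \<circ> tr s \<circ> tr t)"
  by (simp add: inj_comp_tr)

lemma comp_tr2_eq: "tr s' \<circ> tr t' = tr s \<circ> tr t \<Longrightarrow> w \<circ> tr s' \<circ> tr t' = w \<circ> tr s \<circ> tr t"
  by (metis comp_assoc)

lemma wflip_props:
  assumes w: "inj w" and ok: "ok4 w x"
  shows "ok4 w (wflip w i x)" "prod4 (wflip w i x) = prod4 x" "wflip w i (wflip w i x) = x"
    "(\<Union>t\<in>labs (wflip w i x). {fst t, snd t}) = (\<Union>t\<in>labs x. {fst t, snd t})"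
    "i \<noteq> 2 \<Longrightarrow> prod2 (wflip w i x) = prod2 x"
proof -
  obtain t1 t2 t3 t4 where x: "x = (t1, t2, t3, t4)" by (cases x) auto
  obtain s1 s2 where e1: "flip2 w t1 t2 = (s1, s2)" by (metis surj_pair)
  obtain r2 r3 where e2: "flip2 (w \<circ> tr t1) t2 t3 = (r2, r3)" by (metis surj_pair)
  obtain q3 q4 where e3: "flip2 (w \<circ> tr t1 \<circ> tr t2) t3 t4 = (q3, q4)" by (metis surj_pair)
  have o: "ok2 w t1 t2" "ok2 (w \<circ> tr t1) t2 t3" "ok2 (w \<circ> tr t1 \<circ> tr t2) t3 t4"
    using ok by (auto simp: x ok2_def)
  note w1 = inj_comp_tr[OF w, of t1] and w2 = inj_comp_tr2[OF w, of t1 t2]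
  note f1 = flip2_ok[OF w o(1) e1] flip2_flip2[OF w o(1) e1] flip2_supp[OF w o(1) e1]
  note f2 = flip2_ok[OF w1 o(2) e2] flip2_flip2[OF w1 o(2) e2] flip2_supp[OF w1 o(2) e2]
  note f3 = flip2_ok[OF w2 o(3) e3] flip2_flip2[OF w2 o(3) e3] flip2_supp[OF w2 o(3) e3]
  note c1 = comp_tr2_eq[OF f1(2), of w] and c2 = comp_tr2_eq[OF f2(2), of "w \<circ> tr t1"]
  show "ok4 w (wflip w i x)"
    using ok f1(1) f2(1) f3(1) c1 c2 by (auto simp: x e1 e2 e3 ok2_def)
  show "prod4 (wflip w i x) = prod4 x"
    using f1(2) f2(2) f3(2) by (auto simp: x e1 e2 e3) (metis comp_assoc)+
  show "wflip w i (wflip w i x) = x"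
    using f1(4) f2(4) f3(4) by (auto simp: x e1 e2 e3)
  show "(\<Union>t\<in>labs (wflip w i x). {fst t, snd t}) = (\<Union>t\<in>labs x. {fst t, snd t})"
    using f1(5) f2(5) f3(5) by (auto simp: x e1 e2 e3)
  show "i \<noteq> 2 \<Longrightarrow> prod2 (wflip w i x) = prod2 x"
    using f1(2) by (auto simp: x e1 e2 e3)
qed

lemma ok4_less: "ok4 w x \<Longrightarrow> t \<in> labs x \<Longrightarrow> fst t < snd t"
  by (cases x) (auto simp: ok1_def)

lemma wflip_Tn:
  assumes "inj w" "ok4 w x" "labs x \<subseteq> Tn n"
  shows "labs (wflip w i x) \<subseteq> Tn n"
proof
  fix t assume t: "t \<in> labs (wflip w i x)"
  have "(\<Union>t\<in>labs x. {fst t, snd t}) \<subseteq> {1..n}" using assms(3) by (force simp: Tn_def)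
  then have "{fst t, snd t} \<subseteq> {1..n}" using t wflip_props(4)[OF assms(1,2), of i] by blast
  moreover have "fst t < snd t" using ok4_less[OF wflip_props(1)[OF assms(1,2)] t] .
  ultimately show "t \<in> Tn n" by (auto simp: Tn_def)
qed

lemma flip_op_pathof:
  assumes u: "u \<in> Sn n" and x: "labs x \<subseteq> Tn n" "ok4 (inv u) x" and i: "i \<in> {1, 2, 3}"
  shows "flip_op n i (pathof u x) = pathof u (wflip (inv u) i x)"
proof -
  obtain t1 t2 t3 t4 where xx: "x = (t1, t2, t3, t4)" by (cases x) auto
  obtain s1 s2 where e1: "flip2 (inv u) t1 t2 = (s1, s2)" by (metis surj_pair)
  obtain r2 r3 where e2: "flip2 (inv u \<circ> tr t1) t2 t3 = (r2, r3)" by (metis surj_pair)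
  obtain q3 q4 where e3: "flip2 (inv u \<circ> tr t1 \<circ> tr t2) t3 t4 = (q3, q4)" by (metis surj_pair)
  have T: "t1 \<in> Tn n" "t2 \<in> Tn n" "t3 \<in> Tn n" "t4 \<in> Tn n" using x xx by auto
  have u1: "tr t1 \<circ> u \<in> Sn n" using tr_comp_Sn[OF u T(1)] .
  have u2: "tr t2 \<circ> (tr t1 \<circ> u) \<in> Sn n" using tr_comp_Sn[OF u1 T(2)] .
  have i1: "inv (tr t1 \<circ> u) = inv u \<circ> tr t1" using inv_tr_comp[OF u] .
  have i2: "inv (tr t2 \<circ> (tr t1 \<circ> u)) = inv u \<circ> tr t1 \<circ> tr t2" using inv_tr_comp[OF u1] i1 by simp
  have o: "ok2 (inv u) t1 t2" "ok2 (inv u \<circ> tr t1) t2 t3" "ok2 (inv u \<circ> tr t1 \<circ> tr t2) t3 t4"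
    using x by (auto simp: xx ok2_def)
  note m1 = flip_mid_tr[OF u T(1,2) o(1) e1]
  note m2 = flip_mid_tr[OF u1 T(2,3), unfolded i1, OF o(2) e2]
  note m3 = flip_mid_tr[OF u2 T(3,4), unfolded i2, OF o(3) e3]
  show ?thesis using i
    by (auto simp: flip_op_def xx e1 e2 e3 m1 m2 m3 numeral_2_eq_2 numeral_3_eq_3)
qed

lemma less4: "(\<forall>i < 4. P i) \<longleftrightarrow> P 0 \<and> P 1 \<and> P 2 \<and> P (3::nat)"
  by (simp add: numeral_eq_Suc All_less_Suc conj_ac)

lemma pathof_in_paths:
  assumes u: "u \<in> Sn n" and x: "labs x \<subseteq> Tn n" "ok4 (inv u) x"
  shows "pathof u x \<in> paths n 4 u (pathof u x ! 4)"
proof -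
  obtain t1 t2 t3 t4 where xx: "x = (t1, t2, t3, t4)" by (cases x) auto
  have T: "t1 \<in> Tn n" "t2 \<in> Tn n" "t3 \<in> Tn n" "t4 \<in> Tn n" using x xx by auto
  have u1: "tr t1 \<circ> u \<in> Sn n" using tr_comp_Sn[OF u T(1)] .
  have u2: "tr t2 \<circ> (tr t1 \<circ> u) \<in> Sn n" using tr_comp_Sn[OF u1 T(2)] .
  have u3: "tr t3 \<circ> (tr t2 \<circ> (tr t1 \<circ> u)) \<in> Sn n" using tr_comp_Sn[OF u2 T(3)] .
  have i1: "inv (tr t1 \<circ> u) = inv u \<circ> tr t1" using inv_tr_comp[OF u] .
  have i2: "inv (tr t2 \<circ> (tr t1 \<circ> u)) = inv u \<circ> tr t1 \<circ> tr t2" using inv_tr_comp[OF u1] i1 by simp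
  have i3: "inv (tr t3 \<circ> (tr t2 \<circ> (tr t1 \<circ> u))) = inv u \<circ> tr t1 \<circ> tr t2 \<circ> tr t3" using inv_tr_comp[OF u2] i2 by simp
  show ?thesis
    using bedge_tr_iff[OF u T(1)] bedge_tr_iff[OF u1 T(2)] bedge_tr_iff[OF u2 T(3)] bedge_tr_iff[OF u3 T(4)] x(2)
    by (simp add: paths_def less4 xx i1 i2 i3 numeral_2_eq_2 numeral_3_eq_3)
qed

lemma paths_word:
  assumes "p \<in> paths n 4 u v"
  obtains x where "u \<in> Sn n" "labs x \<subseteq> Tn n" "ok4 (inv u) x" "p = pathof u x" "v = pathof u x ! 4"
proof -
  have p: "length p = 5" "p ! 0 = u" "p ! 4 = v" and b: "bedge n (p ! 0) (p ! 1)" "bedge n (p ! 1) (p ! 2)"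
    "bedge n (p ! 2) (p ! 3)" "bedge n (p ! 3) (p ! 4)"
    using assms by (auto simp: paths_def less4 numeral_eq_Suc)
  obtain t1 where t1: "t1 \<in> Tn n" "p ! 1 = tr t1 \<circ> u" "ok1 (inv u) t1" and u: "u \<in> Sn n" "p ! 1 \<in> Sn n"
    using bedgeE[OF b(1)] p by metis
  obtain t2 where t2: "t2 \<in> Tn n" "p ! 2 = tr t2 \<circ> (tr t1 \<circ> u)" "ok1 (inv (p ! 1)) t2" and u2: "p ! 2 \<in> Sn n"
    using bedgeE[OF b(2)] t1(2) by metis
  obtain t3 where t3: "t3 \<in> Tn n" "p ! 3 = tr t3 \<circ> (p ! 2)" "ok1 (inv (p ! 2)) t3" and u3: "p ! 3 \<in> Sn n"
    using bedgeE[OF b(3)] by metis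
  obtain t4 where t4: "t4 \<in> Tn n" "p ! 4 = tr t4 \<circ> (p ! 3)" "ok1 (inv (p ! 3)) t4"
    using bedgeE[OF b(4)] by metis
  have i1: "inv (p ! 1) = inv u \<circ> tr t1" using inv_tr_comp[OF u(1)] t1 by simp
  have i2: "inv (p ! 2) = inv u \<circ> tr t1 \<circ> tr t2" using inv_tr_comp[OF u(2)] t2 t1 i1 by simp
  have i3: "inv (p ! 3) = inv u \<circ> tr t1 \<circ> tr t2 \<circ> tr t3" using inv_tr_comp[OF u2] t3 i2 by simp
  have "p = [p ! 0, p ! 1, p ! 2, p ! 3, p ! 4]"
    using p(1) by (intro nth_equalityI) (auto simp: less_Suc_eq numeral_eq_Suc)
  then have pe: "p = pathof u (t1, t2, t3, t4)" using p t1 t2 t3 t4 by simp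
  show thesis
    by (rule that[of "(t1, t2, t3, t4)"]) (use t1 t2 t3 t4 u i1 i2 i3 pe p in auto)
qed

section \<open>Orbits of words and their agreement with flipclasses\<close>

definition step :: "(nat \<Rightarrow> nat) \<Rightarrow> (word \<times> word) set" where
  "step w = {(x, wflip w i x) | x i. ok4 w x \<and> i \<in> {1, 2, 3}}"

text \<open>Forward steps are enough: flips are involutions, so the orbit relation is symmetric
  (\<open>orb_sym\<close>) and matches the symmetric closure in \<open>flipclasses\<close>.\<close>

definition orb :: "(nat \<Rightarrow> nat) \<Rightarrow> word \<Rightarrow> word set" where
  "orb w x = {y. (x, y) \<in> (step w)\<^sup>*}"

lemma orb_induct [consumes 1, case_names base step]:
  assumes "y \<in> orb w x" "P x" "\<And>y i. y \<in> orb w x \<Longrightarrow> P y \<Longrightarrow> ok4 w y \<Longrightarrow> i \<in> {1, 2, 3} \<Longrightarrow> P (wflip w i y)"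
  shows "P y"
proof -
  have "(x, y) \<in> (step w)\<^sup>*" using assms(1) by (simp add: orb_def)
  then show ?thesis
  proof (induction rule: rtrancl_induct)
    case base then show ?case by (rule assms(2))
  next
    case (step y z)
    then obtain i where "z = wflip w i y" "ok4 w y" "i \<in> {1, 2, 3}" unfolding step_def by blast
    then show ?case using assms(3)[of y i] step by (simp add: orb_def)
  qed
qed

lemma orb_refl: "x \<in> orb w x"
  by (simp add: orb_def)

lemma orb_wflip: "y \<in> orb w x \<Longrightarrow> ok4 w y \<Longrightarrow> i \<in> {1, 2, 3} \<Longrightarrow> wflip w i y \<in> orb w x"
  unfolding orb_def mem_Collect_eq by (rule rtrancl.rtrancl_into_rtrancl) (unfold step_def, blast+)

lemma orb_ok4:
  assumes "inj w" "ok4 w x" "y \<in> orb w x"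
  shows "ok4 w y"
  using assms(3) by (induction rule: orb_induct) (simp_all add: assms wflip_props)

lemma orb_Tn:
  assumes "inj w" "ok4 w x" "labs x \<subseteq> Tn n" "y \<in> orb w x"
  shows "labs y \<subseteq> Tn n"
  using assms(4) by (induction rule: orb_induct) (use assms wflip_Tn in blast)+

lemma orb_prod4:
  assumes "inj w" "ok4 w x" "y \<in> orb w x"
  shows "prod4 y = prod4 x"
  using assms(3) by (induction rule: orb_induct) (simp_all add: assms wflip_props)

lemma orb_trans: "y \<in> orb w x \<Longrightarrow> z \<in> orb w y \<Longrightarrow> z \<in> orb w x"
  by (auto simp: orb_def)

lemma orb_sym:
  assumes "inj w" "ok4 w x" "y \<in> orb w x"
  shows "x \<in> orb w y"
  using assms(3)
proof (induction rule: orb_induct)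
  case base then show ?case by (rule orb_refl)
next
  case (step y i)
  have "wflip w i (wflip w i y) \<in> orb w (wflip w i y)"
    by (rule orb_wflip[OF orb_refl wflip_props(1)[OF assms(1) step.hyps(2)] step.hyps(3)])
  then have "y \<in> orb w (wflip w i y)" by (simp add: wflip_props(3)[OF assms(1) step.hyps(2)])
  then show ?case using step.IH orb_trans by blast
qed

lemma orb_eq: "inj w \<Longrightarrow> ok4 w x \<Longrightarrow> y \<in> orb w x \<Longrightarrow> orb w y = orb w x"
  using orb_sym orb_trans by blast

lemma flipclass_word:
  assumes "F \<in> flipclasses n 4 u v"
  obtains x where "u \<in> Sn n" "labs x \<subseteq> Tn n" "ok4 (inv u) x" "F = pathof u ` orb (inv u) x"
proof -
  define rel where "rel = flip_rel n 4 u v \<union> (flip_rel n 4 u v)\<inverse>"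
  from assms obtain p where p: "p \<in> paths n 4 u v" and F: "F = {q. (p, q) \<in> rel\<^sup>*}"
    by (auto simp: flipclasses_def rel_def)
  from p obtain x where u: "u \<in> Sn n" and x: "labs x \<subseteq> Tn n" "ok4 (inv u) x" and px: "p = pathof u x"
    and v: "v = pathof u x ! 4"
    by (rule paths_word)
  have i4: "i \<in> {1, 2, 3} \<longleftrightarrow> 1 \<le> i \<and> i < 4" for i :: nat by auto
  have fr: "(p, q) \<in> flip_rel n 4 u v \<longleftrightarrow> p \<in> paths n 4 u v \<and> (\<exists>i \<in> {1, 2, 3}. q = flip_op n i p)" for p q
    unfolding flip_rel_def using i4 by blast
  note inj = inj_inv_Sn[OF u]
  have vy: "pathof u y ! 4 = v" if "y \<in> orb (inv u) x" for y
  proof -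
    have "prod4 y = prod4 x" using orb_prod4[OF inj x(2) that] .
    moreover have e: "pathof u y ! 4 = inv (prod4 y) \<circ> u" for y
      by (cases y) (simp add: o_inv_distrib bij_tr bij_comp comp_assoc inv_unique_comp numeral_eq_Suc)
    ultimately show ?thesis unfolding v e by simp
  qed
  have "(p, q) \<in> rel\<^sup>* \<Longrightarrow> q \<in> pathof u ` orb (inv u) x" for q
  proof (induction rule: rtrancl_induct)
    case base then show ?case using px orb_refl by auto
  next
    case (step q r)
    then obtain y where y: "y \<in> orb (inv u) x" "q = pathof u y" by auto
    note yy = orb_Tn[OF inj x(2,1) y(1)] orb_ok4[OF inj x(2) y(1)]
    have q: "q \<in> paths n 4 u v" using pathof_in_paths[OF u yy] vy[OF y(1)] y(2) by simp
    from step(2) consider "(q, r) \<in> flip_rel n 4 u v" | "(r, q) \<in> flip_rel n 4 u v" by (auto simp: rel_def)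
    then show ?case
    proof cases
      case 1
      then obtain i where i: "i \<in> {1,2,3}" "r = flip_op n i q" unfolding fr by auto
      then show ?thesis using flip_op_pathof[OF u yy i(1)] orb_wflip[OF y(1) yy(2) i(1)] y by auto
    next
      case 2
      then obtain i where i: "i \<in> {1,2,3}" "q = flip_op n i r" and r: "r \<in> paths n 4 u v" unfolding fr by auto
      from r obtain z where z: "labs z \<subseteq> Tn n" "ok4 (inv u) z" "r = pathof u z" by (rule paths_word)
      have qz: "q = pathof u (wflip (inv u) i z)" using i flip_op_pathof[OF u z(1,2) i(1)] z by simp
      \<comment> \<open>A backward step is itself a forward flip, since flipping twice at the same
        place gives back \<open>z\<close>.\<close>
      have "flip_op n i q = r"
        unfolding qz z(3) using flip_op_pathof[OF u wflip_Tn[OF inj z(2,1)] wflip_props(1)[OF inj z(2)] i(1)]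
        by (simp add: wflip_props(3)[OF inj z(2)])
      then have "r = pathof u (wflip (inv u) i y)" using flip_op_pathof[OF u yy i(1)] y by simp
      then show ?thesis using orb_wflip[OF y(1) yy(2) i(1)] by auto
    qed
  qed
  moreover have "y \<in> orb (inv u) x \<Longrightarrow> (p, pathof u y) \<in> rel\<^sup>*" for y
  proof (induction rule: orb_induct)
    case base then show ?case by (simp add: px)
  next
    case (step y i)
    note yy = orb_Tn[OF inj x(2,1) step.hyps(1)]
    have "pathof u y \<in> paths n 4 u v" using pathof_in_paths[OF u yy step.hyps(2)] vy[OF step.hyps(1)] by simp
    then have "(pathof u y, pathof u (wflip (inv u) i y)) \<in> flip_rel n 4 u v"
      unfolding fr
      by (intro conjI bexI[of _ i])
        (simp_all only: flip_op_pathof[OF u yy step.hyps(2,3)] step.hyps(3))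
    then have "(pathof u y, pathof u (wflip (inv u) i y)) \<in> rel" by (simp add: rel_def)
    then show ?case by (rule rtrancl.rtrancl_into_rtrancl[OF step.IH])
  qed
  ultimately have "F = pathof u ` orb (inv u) x" unfolding F by blast
  then show thesis using that u x by blast
qed

section \<open>Increasing paths and t-vectors of orbits\<close>

text \<open>For a fixed end vertex the last label determines the third inner vertex, just as the
  first label determines the first one. So \<open>t_1\<close> and \<open>t_3\<close> are counted
  through labels in \<open>tvec_orb\<close>.\<close>

fun last4 :: "word \<Rightarrow> lab" where
  "last4 (t1, t2, t3, t4) = t4"

fun inc :: "(lab \<Rightarrow> nat) \<Rightarrow> word \<Rightarrow> bool" where
  "inc f (t1, t2, t3, t4) \<longleftrightarrow> f t1 < f t2 \<and> f t2 < f t3 \<and> f t3 < f t4"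

definition weak2 :: "(lab \<Rightarrow> nat) \<Rightarrow> lab \<Rightarrow> lab \<Rightarrow> bool" where
  "weak2 f s t \<longleftrightarrow> disj s t \<or> f s < f t"

text \<open>No label is \<open>weak2\<close>-related to itself, so a weak word has four different
  labels.\<close>

fun weak :: "(lab \<Rightarrow> nat) \<Rightarrow> word \<Rightarrow> bool" where
  "weak f (t1, t2, t3, t4) \<longleftrightarrow> weak2 f t1 t2 \<and> weak2 f t2 t3 \<and> weak2 f t3 t4
     \<and> weak2 f t1 t3 \<and> weak2 f t2 t4 \<and> weak2 f t1 t4"

fun inversions :: "(lab \<Rightarrow> nat) \<Rightarrow> word \<Rightarrow> nat" where
  "inversions f (t1, t2, t3, t4) = of_bool (f t2 < f t1) + of_bool (f t3 < f t2) + of_bool (f t4 < f t3)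
     + of_bool (f t3 < f t1) + of_bool (f t4 < f t2) + of_bool (f t4 < f t1)"

lemma flip2_disj: "disj s t \<Longrightarrow> flip2 w s t = (t, s)"
  by (cases s; cases t) (simp add: disj_def)

lemma disj_sym: "disj s t \<longleftrightarrow> disj t s"
  by (auto simp: disj_def)

lemma ok4_neq: "ok4 w (t1, t2, t3, t4) \<Longrightarrow> t1 \<noteq> t2 \<and> t2 \<noteq> t3 \<and> t3 \<noteq> t4"
  by (auto simp: ok1_def tr_def)

text \<open>Exchanging adjacent commuting labels is a flip, so a word whose non-commuting labels are all in
  order can be sorted within its orbit.\<close>

lemma weak_sort:
  assumes "inj w" "ok4 w x" "inj_on f L" "\<And>y. y \<in> orb w x \<Longrightarrow> labs y \<subseteq> L" "y \<in> orb w x" "weak f y"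
  shows "\<exists>z \<in> orb w x. inc f z \<and> labs z = labs y"
  using assms(5,6)
proof (induction "inversions f y" arbitrary: y rule: less_induct)
  case less
  obtain t1 t2 t3 t4 where y: "y = (t1, t2, t3, t4)" by (cases y) auto
  have ok: "ok4 w y" using orb_ok4[OF assms(1,2) less.prems(1)] .
  have L: "t1 \<in> L" "t2 \<in> L" "t3 \<in> L" "t4 \<in> L" using assms(4)[OF less.prems(1)] y by auto
  have ne: "f t1 \<noteq> f t2" "f t2 \<noteq> f t3" "f t3 \<noteq> f t4"
    using ok4_neq[of w t1 t2 t3 t4] ok y L assms(3) by (auto dest: inj_onD)
  have w: "weak2 f t1 t2" "weak2 f t2 t3" "weak2 f t3 t4" "weak2 f t1 t3" "weak2 f t2 t4" "weak2 f t1 t4"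
    using less.prems(2) y by auto
  consider "f t2 < f t1" | "f t3 < f t2" | "f t4 < f t3" | "inc f y" using ne y by fastforce
  then show ?case
  proof cases
    case 1
    then have d: "disj t1 t2" using w by (auto simp: weak2_def)
    then have e: "wflip w 1 y = (t2, t1, t3, t4)" by (simp add: y flip2_disj)
    have "inversions f (t2, t1, t3, t4) < inversions f y" using 1 unfolding y by simp
    moreover have "weak f (t2, t1, t3, t4)" using w d disj_sym by (simp add: weak2_def)
    moreover have "labs (t2, t1, t3, t4) = labs y" by (auto simp: y)
    moreover have "(t2, t1, t3, t4) \<in> orb w x" using orb_wflip[OF less.prems(1) ok, of 1] e by simp
    ultimately show ?thesis using less.hyps[of "(t2, t1, t3, t4)"] by simp
  next
    case 2
    then have d: "disj t2 t3" using w by (auto simp: weak2_def)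
    then have e: "wflip w 2 y = (t1, t3, t2, t4)" by (simp add: y flip2_disj)
    have "inversions f (t1, t3, t2, t4) < inversions f y" using 2 unfolding y by simp
    moreover have "weak f (t1, t3, t2, t4)" using w d disj_sym by (simp add: weak2_def)
    moreover have "labs (t1, t3, t2, t4) = labs y" by (auto simp: y)
    moreover have "(t1, t3, t2, t4) \<in> orb w x" using orb_wflip[OF less.prems(1) ok, of 2] e by simp
    ultimately show ?thesis using less.hyps[of "(t1, t3, t2, t4)"] by simp
  next
    case 3
    then have d: "disj t3 t4" using w by (auto simp: weak2_def)
    then have e: "wflip w 3 y = (t1, t2, t4, t3)" by (simp add: y flip2_disj)
    have "inversions f (t1, t2, t4, t3) < inversions f y" using 3 unfolding y by simp
    moreover have "weak f (t1, t2, t4, t3)" using w d disj_sym by (simp add: weak2_def)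
    moreover have "labs (t1, t2, t4, t3) = labs y" by (auto simp: y)
    moreover have "(t1, t2, t4, t3) \<in> orb w x" using orb_wflip[OF less.prems(1) ok, of 3] e by simp
    ultimately show ?thesis using less.hyps[of "(t1, t2, t4, t3)"] by simp
  next
    case 4
    then show ?thesis using less.prems by blast
  qed
qed

lemma inc_weak: "inc f x \<Longrightarrow> weak f x"
  by (cases x) (auto simp: weak2_def)

lemma inc_labs_inj:
  assumes "inj_on f L" "inc f x" "inc f y" "labs x \<subseteq> L" "labs y \<subseteq> L" "labs x = labs y"
  shows "x = y"
proof -
  obtain t1 t2 t3 t4 s1 s2 s3 s4 where xy: "x = (t1, t2, t3, t4)" "y = (s1, s2, s3, s4)"
    by (cases x; cases y) auto
  have "[f t1, f t2, f t3, f t4] = [f s1, f s2, f s3, f s4]"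
  proof (rule sorted_distinct_set_unique)
    have "f ` labs x = f ` labs y" using assms(6) by simp
    then show "set [f t1, f t2, f t3, f t4] = set [f s1, f s2, f s3, f s4]" by (simp add: xy)
  qed (use assms(2,3) xy in auto)
  then show ?thesis using assms(1,4,5) xy by (auto dest: inj_onD)
qed

lemma card_inc_weak:
  assumes "inj w" "ok4 w x" "inj_on f L" "\<And>y. y \<in> orb w x \<Longrightarrow> labs y \<subseteq> L"
  shows "card {y \<in> orb w x. inc f y} = card (labs ` {y \<in> orb w x. weak f y})"
proof -
  have "labs ` {y \<in> orb w x. weak f y} = labs ` {y \<in> orb w x. inc f y}"
  proof (intro equalityI subsetI)
    fix l assume "l \<in> labs ` {y \<in> orb w x. weak f y}"
    then obtain y where "y \<in> orb w x" "weak f y" "l = labs y" by auto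
    with weak_sort[OF assms, of y] show "l \<in> labs ` {y \<in> orb w x. inc f y}" by auto
  qed (auto intro: inc_weak)
  moreover have "inj_on labs {y \<in> orb w x. inc f y}"
    using inc_labs_inj[OF assms(3)] assms(4) by (intro inj_onI) auto
  ultimately show ?thesis by (simp add: card_image)
qed

text \<open>Commuting labels are exchanged. Otherwise let min, mid, max be the three labels on the
  triple in the order of \<open>g\<close>. The factorizations of one 3-cycle are (min,mid),
  (mid,max), (max,min), those of the other (min,max), (mid,min), (max,mid). A descent could lose
  ground only by passing from (mid,min) to (max,mid), and these two are never admissible
  together.\<close>

lemma flip2_descent:
  assumes "inj w" "ok2 w s t" "flip2 w s t = (s', t')" "g t < g s"
    and g: "\<And>x y z. x < y \<Longrightarrow> y < z \<Longrightarrow> {x, y, z} = {fst s, snd s} \<union> {fst t, snd t}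
      \<Longrightarrow> g (x, y) < g (x, z) \<and> g (x, z) < g (y, z)"
  shows "g s' < (g s :: nat)"
proof -
  note d = ok2D[OF assms(2)]
  have dd: "fst s < snd s" "fst t < snd t" "s \<noteq> t" using d by auto
  show ?thesis
  proof (cases rule: flip2_cases[OF dd])
    case 1
    then show ?thesis using assms(3,4) by simp
  next
    case (2 p q r)
    note pq = 2(4,5)
    have w: "w p \<noteq> w q" "w q \<noteq> w r" "w p \<noteq> w r" using assms 2 by (auto dest: injD)
    have o: "(p < q \<longleftrightarrow> w p < w q) \<and> (q < r \<longleftrightarrow> w p < w r)"
      using assms(2) 2 by (simp add: ok2_mk assms(1) transpose_def)
    have s: "{fst s, snd s} \<union> {fst t, snd t} = {p, q, r}" using 2 by (auto simp: mk_def)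
    have e: "pivot w p q r = (s', t')" using assms(3) 2 by simp
    consider "p < q" "q < r" | "p < r" "r < q" | "q < p" "p < r" | "q < r" "r < p" | "r < p" "p < q" | "r < q" "q < p"
      using 2 by linarith
    then show ?thesis
    proof cases
      case 1 then show ?thesis using g[of p q r] s o w e assms(4) pq by (auto simp: mk_def pivot_def split: if_splits)
    next
      case 2 then show ?thesis using g[of p r q] s o w e assms(4) pq by (auto simp: mk_def pivot_def insert_commute split: if_splits)
    next
      case 3 then show ?thesis using g[of q p r] s o w e assms(4) pq by (auto simp: mk_def pivot_def insert_commute split: if_splits)
    next
      case 4 then show ?thesis using g[of q r p] s o w e assms(4) pq by (auto simp: mk_def pivot_def insert_commute split: if_splits)
    next
      case 5 then show ?thesis using g[of r p q] s o w e assms(4) pq by (auto simp: mk_def pivot_def insert_commute split: if_splits)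
    next
      case 6 then show ?thesis using g[of r q p] s o w e assms(4) pq by (auto simp: mk_def pivot_def insert_commute split: if_splits)
    qed
  qed
qed

text \<open>A flip at a descent keeps the earlier labels and lowers the next one, so the
  lexicographic order terminates. The condition on \<open>g\<close> is limited to triples spanned by
  two labels in \<open>L\<close>, because \<open>g\<close> will be pulled back from positions in
  blocks and is meaningful only there.\<close>

lemma orb_increasing:
  assumes "inj w" "ok4 w x" "inj_on g L" "\<And>y. y \<in> orb w x \<Longrightarrow> labs y \<subseteq> L"
    and g: "\<And>s t x y z. s \<in> L \<Longrightarrow> t \<in> L \<Longrightarrow> x < y \<Longrightarrow> y < z \<Longrightarrow> {x, y, z} = {fst s, snd s} \<union> {fst t, snd t}
      \<Longrightarrow> g (x, y) < g (x, z) \<and> g (x, z) < g (y, z)"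
  obtains z where "z \<in> orb w x" "inc g z"
proof -
  define m where "m = (\<lambda>(t1, t2, t3, t4). (g t1, g t2, g t3, g t4))"
  let ?r = "inv_image (less_than <*lex*> less_than <*lex*> less_than <*lex*> less_than) m"
  have wf: "wf ?r" by (intro wf_inv_image wf_lex_prod wf_less_than)
  have "y \<in> orb w x \<Longrightarrow> \<exists>z \<in> orb w x. inc g z" for y
  proof (induction y rule: wf_induct_rule[OF wf])
    case (1 y)
    obtain t1 t2 t3 t4 where y: "y = (t1, t2, t3, t4)" by (cases y) auto
    have ok: "ok4 w y" using orb_ok4[OF assms(1,2) 1(2)] .
    have L: "t1 \<in> L" "t2 \<in> L" "t3 \<in> L" "t4 \<in> L" using assms(4)[OF 1(2)] y by auto
    have ne: "g t1 \<noteq> g t2" "g t2 \<noteq> g t3" "g t3 \<noteq> g t4"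
      using ok4_neq[of w t1 t2 t3 t4] ok y L assms(3) by (auto dest: inj_onD)
    have o: "ok2 w t1 t2" "ok2 (w \<circ> tr t1) t2 t3" "ok2 (w \<circ> tr t1 \<circ> tr t2) t3 t4"
      using ok by (auto simp: y ok2_def)
    consider "g t2 < g t1" | "g t3 < g t2" | "g t4 < g t3" | "inc g y" using ne y by fastforce
    then show ?case
    proof cases
      case c: 1
      obtain s1 s2 where e: "flip2 w t1 t2 = (s1, s2)" by (metis surj_pair)
      have "g s1 < g t1" by (rule flip2_descent[OF assms(1) o(1) e c]) (use g L in blast)
      then have "(wflip w 1 y, y) \<in> ?r" by (simp add: m_def y e)
      then show ?thesis using 1(1) orb_wflip[OF 1(2) ok, of 1] by simp
    next
      case c: 2
      obtain s1 s2 where e: "flip2 (w \<circ> tr t1) t2 t3 = (s1, s2)" by (metis surj_pair)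
      have "g s1 < g t2" by (rule flip2_descent[OF inj_comp_tr[OF assms(1)] o(2) e c]) (use g L in blast)
      then have "(wflip w 2 y, y) \<in> ?r" by (simp add: m_def y e)
      then show ?thesis using 1(1) orb_wflip[OF 1(2) ok, of 2] by simp
    next
      case c: 3
      obtain s1 s2 where e: "flip2 (w \<circ> tr t1 \<circ> tr t2) t3 t4 = (s1, s2)" by (metis surj_pair)
      have "g s1 < g t3" by (rule flip2_descent[OF inj_comp_tr2[OF assms(1)] o(3) e c]) (use g L in blast)
      then have "(wflip w 3 y, y) \<in> ?r" by (simp add: m_def y e)
      then show ?thesis using 1(1) orb_wflip[OF 1(2) ok, of 3] by simp
    next
      case 4
      then show ?thesis using 1(2) by blast
    qed
  qed
  then show thesis using that orb_refl by blast
qed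

lemma pathof_nth:
  "pathof u x ! 0 = u" "pathof u x ! 1 = tr (fst x) \<circ> u" "pathof u x ! 2 = inv (prod2 x) \<circ> u"
  "pathof u x ! 3 = tr (last4 x) \<circ> (inv (prod4 x) \<circ> u)" "pathof u x ! 4 = inv (prod4 x) \<circ> u"
  by (cases x; simp add: numeral_eq_Suc o_inv_distrib bij_tr bij_comp comp_assoc fun_eq_iff)+

lemma bij_prod: "bij (prod2 x)" "bij (prod4 x)"
  by (cases x; simp add: bij_tr bij_comp)+

lemma pathof_inject:
  assumes u: "u \<in> Sn n" and x: "labs x \<subseteq> Tn n" and y: "labs y \<subseteq> Tn n" and e: "pathof u x = pathof u y"
  shows "x = y"
proof -
  obtain t1 t2 t3 t4 s1 s2 s3 s4 where xy: "x = (t1, t2, t3, t4)" "y = (s1, s2, s3, s4)"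
    by (cases x; cases y) auto
  have c: "s = t" if "tr s \<circ> z = tr t \<circ> z" "s \<in> Tn n" "t \<in> Tn n" "z \<in> Sn n" for s t z
    using label_tr[OF that(2,4)] label_tr[OF that(3,4)] unfolding that(1) by simp
  have T: "t1 \<in> Tn n" "t2 \<in> Tn n" "t3 \<in> Tn n" "t4 \<in> Tn n" "s1 \<in> Tn n" "s2 \<in> Tn n" "s3 \<in> Tn n" "s4 \<in> Tn n"
    using x y xy by auto
  have 1: "t1 = s1" using e T u by (intro c[of _ u]) (simp_all add: xy)
  have u1: "tr s1 \<circ> u \<in> Sn n" using tr_comp_Sn u T by blast
  have 2: "t2 = s2" using e T u1 1 by (intro c[of _ "tr s1 \<circ> u"]) (simp_all add: xy)
  have u2: "tr s2 \<circ> (tr s1 \<circ> u) \<in> Sn n" using tr_comp_Sn u1 T by blast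
  have 3: "t3 = s3" using e T u2 1 2 by (intro c[of _ "tr s2 \<circ> (tr s1 \<circ> u)"]) (simp_all add: xy)
  have u3: "tr s3 \<circ> (tr s2 \<circ> (tr s1 \<circ> u)) \<in> Sn n" using tr_comp_Sn u2 T by blast
  have 4: "t4 = s4" using e T u3 1 2 3 by (intro c[of _ "tr s3 \<circ> (tr s2 \<circ> (tr s1 \<circ> u))"]) (simp_all add: xy)
  show ?thesis using 1 2 3 4 by (simp add: xy)
qed

lemma increasing_pathof:
  assumes u: "u \<in> Sn n" and x: "labs (t1, t2, t3, t4) \<subseteq> Tn n"
  shows "increasing n R (pathof u (t1, t2, t3, t4)) \<longleftrightarrow> (t1, t2) \<in> R \<and> (t2, t3) \<in> R \<and> (t3, t4) \<in> R"
proof -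
  have T: "t1 \<in> Tn n" "t2 \<in> Tn n" "t3 \<in> Tn n" "t4 \<in> Tn n" using x by auto
  note u1 = tr_comp_Sn[OF u T(1)]
  note u2 = tr_comp_Sn[OF u1 T(2)]
  note u3 = tr_comp_Sn[OF u2 T(3)]
  show ?thesis
    using label_tr[OF T(1) u] label_tr[OF T(2) u1] label_tr[OF T(3) u2] label_tr[OF T(4) u3]
    by (simp add: increasing_def numeral_eq_Suc All_less_Suc conj_ac)
qed

section \<open>Reflection orderings as numeric ranks, and counting on orbits\<close>

definition rank :: "nat \<Rightarrow> (nat \<times> nat) rel \<Rightarrow> lab \<Rightarrow> nat" where
  "rank n R t = card {s \<in> Tn n. (s, t) \<in> R}"

lemma finite_Tn: "finite (Tn n)"
  by (rule finite_subset[of _ "{1..n} \<times> {1..n}"]) (auto simp: Tn_def)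

text \<open>Numeric ranks let arithmetic decide comparisons. \<open>R\<close> is reflexive, hence
  the distinctness of \<open>s\<close> and \<open>t\<close>; consecutive labels of a path differ by
  \<open>ok4_neq\<close>, so \<open>increasing\<close> becomes strict.\<close>

lemma rank_less:
  assumes R: "refl_order n R" and st: "s \<in> Tn n" "t \<in> Tn n" "s \<noteq> t"
  shows "(s, t) \<in> R \<longleftrightarrow> rank n R s < rank n R t"
proof -
  have lo: "linear_order_on (Tn n) R" using R by (simp add: refl_order_def)
  then have tot: "total_on (Tn n) R" and tra: "trans R" and anti: "antisym R" and re: "refl_on (Tn n) R"
    by (auto simp: linear_order_on_def partial_order_on_def preorder_on_def)
  have *: "rank n R s < rank n R t" if "s \<in> Tn n" "t \<in> Tn n" "s \<noteq> t" "(s, t) \<in> R" for s t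
    unfolding rank_def
  proof (rule psubset_card_mono)
    show "finite {r \<in> Tn n. (r, t) \<in> R}" using finite_Tn by auto
    have "(t, s) \<notin> R" using that anti by (auto dest: antisymD)
    moreover have "(t, t) \<in> R" using re that by (auto dest: refl_onD)
    ultimately show "{r \<in> Tn n. (r, s) \<in> R} \<subset> {r \<in> Tn n. (r, t) \<in> R}"
      using that tra by (auto dest: transD)
  qed
  show ?thesis using *[of s t] *[of t s] tot st unfolding total_on_def by (metis less_asym)
qed

lemma rank_inj: "refl_order n R \<Longrightarrow> inj_on (rank n R) (Tn n)"
proof (rule inj_onI, rule ccontr)
  fix s t assume R: "refl_order n R" and st: "s \<in> Tn n" "t \<in> Tn n" "rank n R s = rank n R t" "s \<noteq> t"
  have "total_on (Tn n) R" using R by (simp add: refl_order_def linear_order_on_def)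
  then show False using rank_less[OF R st(1,2,4)] rank_less[OF R st(2,1) st(4)[symmetric]] st
    unfolding total_on_def by (metis less_irrefl)
qed

lemma rank_triple:
  assumes R: "refl_order n R" and "x < y" "y < z" "1 \<le> x" "z \<le> n"
  defines "f \<equiv> rank n R"
  shows "f (x, y) < f (x, z) \<and> f (x, z) < f (y, z) \<or> f (y, z) < f (x, z) \<and> f (x, z) < f (x, y)"
proof -
  have T: "(x, y) \<in> Tn n" "(x, z) \<in> Tn n" "(y, z) \<in> Tn n" using assms by (auto simp: Tn_def)
  have "((x,y),(x,z)) \<in> R \<and> ((x,z),(y,z)) \<in> R \<or> ((y,z),(x,z)) \<in> R \<and> ((x,z),(x,y)) \<in> R"
    using R assms unfolding refl_order_def by blast
  then show ?thesis
    using rank_less[OF R T(1,2)] rank_less[OF R T(2,3)] rank_less[OF R T(3,2)] rank_less[OF R T(2,1)] assms(2,3)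
    by (auto simp: f_def)
qed

lemma cF_orb:
  assumes R: "refl_order n R" and u: "u \<in> Sn n" and x: "labs x \<subseteq> Tn n" "ok4 (inv u) x"
  shows "cF n R (pathof u ` orb (inv u) x) = card (labs ` {y \<in> orb (inv u) x. weak (rank n R) y})"
proof -
  let ?O = "orb (inv u) x"
  note inj = inj_inv_Sn[OF u]
  have L: "labs y \<subseteq> Tn n" if "y \<in> ?O" for y using orb_Tn[OF inj x(2,1) that] .
  have i: "increasing n R (pathof u y) \<longleftrightarrow> inc (rank n R) y" if "y \<in> ?O" for y
  proof -
    obtain t1 t2 t3 t4 where y: "y = (t1, t2, t3, t4)" by (cases y) auto
    have T: "t1 \<in> Tn n" "t2 \<in> Tn n" "t3 \<in> Tn n" "t4 \<in> Tn n" using L[OF that] y by auto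
    have "t1 \<noteq> t2 \<and> t2 \<noteq> t3 \<and> t3 \<noteq> t4" using ok4_neq orb_ok4[OF inj x(2) that] y by blast
    then show ?thesis
      using increasing_pathof[OF u, of t1 t2 t3 t4 R] L[OF that] rank_less[OF R] T by (simp add: y)
  qed
  have "{p \<in> pathof u ` ?O. increasing n R p} = pathof u ` {y \<in> ?O. inc (rank n R) y}" using i by auto
  moreover have "inj_on (pathof u) {y \<in> ?O. inc (rank n R) y}"
    using pathof_inject[OF u] L by (intro inj_onI) auto
  ultimately have "cF n R (pathof u ` ?O) = card {y \<in> ?O. inc (rank n R) y}"
    by (simp add: cF_def card_image)
  also have "\<dots> = card (labs ` {y \<in> ?O. weak (rank n R) y})"
    by (rule card_inc_weak[OF inj x(2) rank_inj[OF R] L])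
  finally show ?thesis .
qed

lemma tvec_orb:
  assumes u: "u \<in> Sn n" and x: "labs x \<subseteq> Tn n" "ok4 (inv u) x"
  defines "O' \<equiv> orb (inv u) x"
  shows "tvec 4 (pathof u ` O') = [1, card (fst ` O'), card (prod2 ` O'), card (last4 ` O'), 1]"
proof -
  note inj = inj_inv_Sn[OF u]
  have L: "labs y \<subseteq> Tn n" if "y \<in> O'" for y using orb_Tn[OF inj x(2,1)] that by (simp add: O'_def)
  have P: "prod4 y = prod4 x" if "y \<in> O'" for y using orb_prod4[OF inj x(2)] that by (simp add: O'_def)
  have ne: "O' \<noteq> {}" using orb_refl[of x] by (metis O'_def empty_iff)
  have surj: "surj u" using Sn_bij[OF u] by (rule bij_is_surj)
  let ?v = "inv (prod4 x) \<circ> u"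
  have sv: "surj ?v" using surj bij_prod(2)[of x] by (metis bij_imp_bij_inv bij_is_surj comp_surj)
  have trc: "s = t" if "s \<in> Tn n" "t \<in> Tn n" "tr s \<circ> z = tr t \<circ> z" "surj z" for s t z
    using tr_inject[of s t] that Tn_less by (metis surj_fun_eq)
  have a0: "(\<lambda>p. p ! 0) ` pathof u ` O' = {u}"
    using ne by (auto simp: image_image pathof_nth)
  have a1: "(\<lambda>p. p ! 1) ` pathof u ` O' = (\<lambda>t. tr t \<circ> u) ` fst ` O'"
    by (simp add: image_image pathof_nth(2)[unfolded One_nat_def])
  have a2: "(\<lambda>p. p ! 2) ` pathof u ` O' = (\<lambda>f. inv f \<circ> u) ` prod2 ` O'"
    by (simp add: image_image pathof_nth)
  have a3: "(\<lambda>p. p ! 3) ` pathof u ` O' = (\<lambda>t. tr t \<circ> ?v) ` last4 ` O'"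
    using P by (auto simp: image_image pathof_nth)
  have a4: "(\<lambda>p. p ! 4) ` pathof u ` O' = {?v}"
    using ne P by (auto simp: image_image pathof_nth)
  have f: "fst ` O' \<subseteq> Tn n" "last4 ` O' \<subseteq> Tn n" using L by (force intro: subsetD[OF L])+
  have i1: "inj_on (\<lambda>t. tr t \<circ> u) (fst ` O')" using trc[OF _ _ _ surj] f by (intro inj_onI) blast
  have i3: "inj_on (\<lambda>t. tr t \<circ> ?v) (last4 ` O')" using trc[OF _ _ _ sv] f by (intro inj_onI) blast
  have i2: "inj_on (\<lambda>f. inv f \<circ> u) (prod2 ` O')"
  proof (rule inj_onI)
    fix f g assume fg: "f \<in> prod2 ` O'" "g \<in> prod2 ` O'" "inv f \<circ> u = inv g \<circ> u"
    then have "inv f = inv g" using surj by (metis surj_fun_eq)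
    moreover have "bij f" "bij g" using fg bij_prod by auto
    ultimately show "f = g" by (metis inv_inv_eq)
  qed
  show ?thesis
    unfolding tvec_def
    using a0 a1 a2 a3 a4 card_image[OF i1] card_image[OF i2] card_image[OF i3]
    by (simp add: numeral_eq_Suc)
qed

section \<open>Searching the orbit of a word\<close>

type_synonym trip = "nat \<times> nat \<times> nat"
type_synonym node = "nat list \<times> word"

text \<open>Between fixed end points a path is determined up to \<open>f\<^sub>1\<close> and \<open>f\<^sub>3\<close> by its middle vertex, so the
  search runs over middle vertices. A node is such a vertex, stored as the list of values of \<open>w\<close> after
  two steps, together with one of the (up to) four paths through it.\<close>

fun swp :: "lab \<Rightarrow> nat list \<Rightarrow> nat list" where
  "swp (a, b) k = k[a := k ! b, b := k ! a]"

fun keyof :: "nat list \<Rightarrow> word \<Rightarrow> nat list" where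
  "keyof r (t1, t2, t3, t4) = swp t2 (swp t1 r)"

fun sqw :: "lab \<times> lab \<Rightarrow> lab \<times> lab \<Rightarrow> lab \<times> lab \<Rightarrow> lab \<times> lab \<Rightarrow> word list" where
  "sqw (t1, t2) (s1, s2) (t3, t4) (s3, s4) = [(t1, t2, t3, t4), (t1, t2, s3, s4), (s1, s2, t3, t4), (s1, s2, s3, s4)]"

fun square :: "nat list \<Rightarrow> node \<Rightarrow> word list" where
  "square r (k, (t1, t2, t3, t4)) = sqw (t1, t2) (flip2 (nth r) t1 t2) (t3, t4) (flip2 (nth k) t3 t4)"

fun mid :: "nat list \<Rightarrow> lab \<Rightarrow> lab \<Rightarrow> lab \<times> lab \<Rightarrow> node" where
  "mid k a d (b, c) = (swp b k, (a, b, c, d))"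

definition mid2 :: "nat list \<Rightarrow> lab \<Rightarrow> lab \<Rightarrow> lab \<Rightarrow> lab \<Rightarrow> node" where
  "mid2 k a b c d = mid k a d (flip2 (nth k) b c)"

fun nodeof :: "nat list \<Rightarrow> word \<Rightarrow> node" where
  "nodeof r (a, b, c, d) = mid2 (swp a r) a b c d"

text \<open>\<open>td\<close> collects the nodes still to be expanded, \<open>sn\<close> all nodes
  found. Membership is decided by the vertex alone, so the first path found through a vertex is the
  one that is kept.\<close>

fun add :: "node list \<Rightarrow> node list \<Rightarrow> node list \<Rightarrow> node list \<times> node list" where
  "add [] td sn = (td, sn)"
| "add (z # zs) td sn = (if list_ex (\<lambda>y. fst y = fst z) sn then add zs td sn else add zs (z # td) (z # sn))"

fun bstep :: "nat list \<Rightarrow> node list \<times> node list \<Rightarrow> node list \<times> node list" where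
  "bstep r ([], sn) = ([], sn)"
| "bstep r (x # xs, sn) = add (map (nodeof r) (square r x)) xs sn"

primrec bfs :: "nat \<Rightarrow> nat list \<Rightarrow> node list \<times> node list \<Rightarrow> node list \<times> node list" where
  "bfs 0 r p = p"
| "bfs (Suc n) r p = bfs n r (bstep r p)"

definition Lb :: "nat list \<Rightarrow> lab set" where
  "Lb bl = {(i, j). i < j \<and> j < length bl \<and> bl ! i = bl ! j}"

definition elab :: "(nat \<Rightarrow> nat) \<Rightarrow> lab \<Rightarrow> lab" where
  "elab e t = (e (fst t), e (snd t))"

fun emb :: "(nat \<Rightarrow> nat) \<Rightarrow> word \<Rightarrow> word" where
  "emb e (t1, t2, t3, t4) = (elab e t1, elab e t2, elab e t3, elab e t4)"

text \<open>The entries of \<open>bl\<close> name the block to which a position belongs. Labels never join different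
  blocks, so only comparisons within a block have to agree.\<close>

definition rel :: "nat list \<Rightarrow> (nat \<Rightarrow> nat) \<Rightarrow> nat list \<Rightarrow> (nat \<Rightarrow> nat) \<Rightarrow> bool" where
  "rel bl e k w \<longleftrightarrow> length k = length bl \<and> (\<forall>i < length bl. \<forall>j < length bl. bl ! i = bl ! j \<longrightarrow>
     (w (e i) < w (e j) \<longleftrightarrow> k ! i < k ! j))"

section \<open>Transport of flips along an embedding of blocks\<close>

lemma nth_swp:
  assumes "t \<in> Lb bl" "length k = length bl" "i < length bl"
  shows "swp t k ! i = k ! tr t i" "length (swp t k) = length bl" "tr t i < length bl" "bl ! tr t i = bl ! i"
proof -
  obtain a b where t: "t = (a, b)" by (cases t)
  show "swp t k ! i = k ! tr t i" "length (swp t k) = length bl" "tr t i < length bl" "bl ! tr t i = bl ! i"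
    using assms by (auto simp: t Lb_def tr_def transpose_def nth_list_update)
qed

text \<open>\<open>e\<close> sends positions to actual values in \<open>[n]\<close>. Blocks may
  interleave there, so \<open>e\<close> is increasing on each block but only injective
  overall.\<close>

locale block_embedding =
  fixes bl :: "nat list" and e :: "nat \<Rightarrow> nat"
  assumes e_mono: "\<And>i j. i < j \<Longrightarrow> j < length bl \<Longrightarrow> bl ! i = bl ! j \<Longrightarrow> e i < e j"
    and e_inj: "\<And>i j. i < length bl \<Longrightarrow> j < length bl \<Longrightarrow> e i = e j \<Longrightarrow> i = j"
begin

abbreviation "E \<equiv> elab e"

lemma e_eq_iff: "i < length bl \<Longrightarrow> j < length bl \<Longrightarrow> e i = e j \<longleftrightarrow> i = j"
  using e_inj by blast

lemma e_less_iff: "i < length bl \<Longrightarrow> j < length bl \<Longrightarrow> bl ! i = bl ! j \<Longrightarrow> e i < e j \<longleftrightarrow> i < j"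
  using e_mono[of i j] e_mono[of j i] by (metis less_asym less_irrefl linorder_neqE_nat)

lemma E_inj: "inj_on E (Lb bl)"
  by (auto simp: inj_on_def Lb_def elab_def e_eq_iff)

lemma mk_e:
  assumes "i < length bl" "j < length bl" "bl ! i = bl ! j"
  shows "mk (e i) (e j) = E (mk i j)"
  using assms by (auto simp: mk_def elab_def e_less_iff)

lemma mk_Lb:
  assumes "i < length bl" "j < length bl" "bl ! i = bl ! j" "i \<noteq> j"
  shows "mk i j \<in> Lb bl"
  using assms by (auto simp: mk_def Lb_def)

lemma tr_E:
  assumes "t \<in> Lb bl" "i < length bl"
  shows "tr (E t) (e i) = e (tr t i)"
  using assms by (cases t) (auto simp: tr_def elab_def transpose_def Lb_def e_eq_iff)

lemma rel_swp:
  assumes "rel bl e k w" "t \<in> Lb bl"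
  shows "rel bl e (swp t k) (w \<circ> tr (E t))"
proof -
  have l: "length k = length bl" using assms(1) by (simp add: rel_def)
  show ?thesis
    unfolding rel_def
  proof (intro conjI allI impI)
    show "length (swp t k) = length bl" using l by (cases t) simp
    fix i j assume ij: "i < length bl" "j < length bl" "bl ! i = bl ! j"
    show "(w \<circ> tr (E t)) (e i) < (w \<circ> tr (E t)) (e j) \<longleftrightarrow> swp t k ! i < swp t k ! j"
      using assms(1) ij nth_swp[OF assms(2) l ij(1)] nth_swp[OF assms(2) l ij(2)]
      by (simp add: tr_E[OF assms(2)] rel_def)
  qed
qed

lemma pivot_e:
  assumes r: "rel bl e k w" and b: "p < length bl" "q < length bl" "r < length bl" "bl ! p = bl ! q" "bl ! q = bl ! r"
    and d: "p \<noteq> q" "q \<noteq> r" "p \<noteq> r" and f: "pivot (nth k) p q r = (s', t')"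
  shows "pivot w (e p) (e q) (e r) = (E s', E t') \<and> s' \<in> Lb bl \<and> t' \<in> Lb bl"
proof -
  have c: "w (e p) < w (e r) \<longleftrightarrow> k ! p < k ! r" "w (e r) < w (e q) \<longleftrightarrow> k ! r < k ! q"
    using r b unfolding rel_def by auto
  show ?thesis
    using f b d mk_e[of p r] mk_e[of p q] mk_e[of q r] mk_Lb[of p r] mk_Lb[of p q] mk_Lb[of q r]
    unfolding pivot_def c
    by (auto simp: e_less_iff split: if_splits)
qed

text \<open>Labels sharing a point lie in one block, and labels of different blocks commute. Hence
  comparisons within blocks, which \<open>rel\<close> preserves, decide every flip.\<close>

lemma flip2_e:
  assumes r: "rel bl e k w" and s: "s \<in> Lb bl" and t: "t \<in> Lb bl" and ne: "s \<noteq> t"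
    and f: "flip2 (nth k) s t = (s', t')"
  shows "flip2 w (E s) (E t) = (E s', E t')" "s' \<in> Lb bl" "t' \<in> Lb bl"
proof -
  obtain a b c d where st: "s = (a, b)" "t = (c, d)" by (metis surj_pair)
  have l: "a < b" "b < length bl" "bl ! a = bl ! b" "c < d" "d < length bl" "bl ! c = bl ! d"
    using s t by (auto simp: st Lb_def)
  have eqs: "e a = e c \<longleftrightarrow> a = c" "e a = e d \<longleftrightarrow> a = d" "e b = e c \<longleftrightarrow> b = c" "e b = e d \<longleftrightarrow> b = d"
    "e c \<noteq> e d" "e d \<noteq> e c" "e a \<noteq> e b"
    using l by (auto simp: e_eq_iff)
  have Est: "E s = (e a, e b)" "E t = (e c, e d)" by (simp_all add: st elab_def)
  consider "a = c" | "a = d" "a \<noteq> c" | "b = c" "a \<noteq> c" "a \<noteq> d" | "b = d" "a \<noteq> c" "a \<noteq> d" "b \<noteq> c"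
    | "a \<noteq> c" "a \<noteq> d" "b \<noteq> c" "b \<noteq> d" by blast
  then have "flip2 w (E s) (E t) = (E s', E t') \<and> s' \<in> Lb bl \<and> t' \<in> Lb bl"
  proof cases
    case 1
    have "pivot (nth k) b a d = (s', t')" using f 1 by (simp add: st)
    from pivot_e[OF r _ _ _ _ _ _ _ _ this] show ?thesis using l ne[unfolded st] 1 unfolding Est by (simp add: eqs)
  next
    case 2
    have "pivot (nth k) b a c = (s', t')" using f 2 by (simp add: st)
    from pivot_e[OF r _ _ _ _ _ _ _ _ this] show ?thesis using l ne[unfolded st] 2 unfolding Est by (simp add: eqs)
  next
    case 3
    have "pivot (nth k) a b d = (s', t')" using f 3 by (simp add: st)
    from pivot_e[OF r _ _ _ _ _ _ _ _ this] show ?thesis using l ne[unfolded st] 3 unfolding Est by (simp add: eqs)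
  next
    case 4
    have "pivot (nth k) a b c = (s', t')" using f 4 by (simp add: st)
    from pivot_e[OF r _ _ _ _ _ _ _ _ this] show ?thesis using l ne[unfolded st] 4 unfolding Est by (simp add: eqs)
  next
    case 5
    then show ?thesis using f s t unfolding Est by (auto simp: st eqs elab_def)
  qed
  then show "flip2 w (E s) (E t) = (E s', E t')" "s' \<in> Lb bl" "t' \<in> Lb bl" by auto
qed

end

section \<open>Soundness and completeness of the search over middle vertices\<close>

locale block_search = block_embedding +
  fixes w :: "nat \<Rightarrow> nat" and r :: "nat list"
  assumes w_inj: "inj w" and r_rel: "rel bl e r w"
begin

definition good :: "word \<Rightarrow> bool" where
  "good x \<longleftrightarrow> labs x \<subseteq> Lb bl \<and> ok4 w (emb e x)"

lemma good_wflip: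
  assumes "good x" and i: "i \<in> {1, 2, 3}"
  shows "\<exists>y. good y \<and> wflip w i (emb e x) = emb e y"
proof -
  obtain t1 t2 t3 t4 where x: "x = (t1, t2, t3, t4)" by (cases x) auto
  have L: "t1 \<in> Lb bl" "t2 \<in> Lb bl" "t3 \<in> Lb bl" "t4 \<in> Lb bl" and ok: "ok4 w (emb e x)"
    using assms(1) by (auto simp: good_def x)
  have "E t1 \<noteq> E t2 \<and> E t2 \<noteq> E t3 \<and> E t3 \<noteq> E t4" using ok4_neq ok unfolding x emb.simps by blast
  then have ne: "t1 \<noteq> t2" "t2 \<noteq> t3" "t3 \<noteq> t4" by auto
  note r1 = rel_swp[OF r_rel L(1)] note r2 = rel_swp[OF r1 L(2)]
  obtain a b where e1: "flip2 (nth r) t1 t2 = (a, b)" by (metis surj_pair)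
  obtain c d where e2: "flip2 (nth (swp t1 r)) t2 t3 = (c, d)" by (metis surj_pair)
  obtain f g where e3: "flip2 (nth (swp t2 (swp t1 r))) t3 t4 = (f, g)" by (metis surj_pair)
  note f1 = flip2_e[OF r_rel L(1,2) ne(1) e1]
  note f2 = flip2_e[OF r1 L(2,3) ne(2) e2]
  note f3 = flip2_e[OF r2 L(3,4) ne(3) e3]
  note ok' = wflip_props(1)[OF w_inj ok, of i]
  from i consider "i = 1" | "i = 2" | "i = 3" by blast
  then show ?thesis
  proof cases
    case 1
    show ?thesis by (rule exI[of _ "(a, b, t3, t4)"]) (use 1 f1 L ok' in \<open>simp add: x good_def\<close>)
  next
    case 2
    show ?thesis by (rule exI[of _ "(t1, c, d, t4)"]) (use 2 f2 L ok' in \<open>simp add: x good_def\<close>)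
  next
    case 3
    show ?thesis by (rule exI[of _ "(t1, t2, f, g)"]) (use 3 f3 L ok' in \<open>simp add: x good_def\<close>)
  qed
qed

lemma orb_good: "good x \<Longrightarrow> y \<in> orb w (emb e x) \<Longrightarrow> \<exists>z. good z \<and> y = emb e z"
proof -
  assume x: "good x" and y: "y \<in> orb w (emb e x)"
  from y show ?thesis
  proof (induction rule: orb_induct)
    case base then show ?case using x by blast
  next
    case (step y i)
    from step.IH obtain z where "good z" "y = emb e z" by blast
    with good_wflip[of z i] step.hyps show ?case by blast
  qed
qed

lemma nodeof_props:
  assumes "good y"
  shows "fst (nodeof r y) = keyof r (snd (nodeof r y))" "good (snd (nodeof r y))"
    "emb e (snd (nodeof r y)) = wflip w 2 (emb e y)"
proof -
  obtain t1 t2 t3 t4 where y: "y = (t1, t2, t3, t4)" by (cases y) auto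
  have L: "t1 \<in> Lb bl" "t2 \<in> Lb bl" "t3 \<in> Lb bl" "t4 \<in> Lb bl" and ok: "ok4 w (emb e y)"
    using assms(1) by (auto simp: good_def y)
  have "E t2 \<noteq> E t3" using ok4_neq ok unfolding y emb.simps by blast
  then have ne: "t2 \<noteq> t3" by auto
  note r1 = rel_swp[OF r_rel L(1)]
  obtain c d where e2: "flip2 (nth (swp t1 r)) t2 t3 = (c, d)" by (metis surj_pair)
  note f2 = flip2_e[OF r1 L(2,3) ne e2]
  show "fst (nodeof r y) = keyof r (snd (nodeof r y))" by (simp add: y mid2_def e2)
  show em: "emb e (snd (nodeof r y)) = wflip w 2 (emb e y)" by (simp add: y mid2_def e2 f2)
  show "good (snd (nodeof r y))"
    using wflip_props(1)[OF w_inj ok, of 2] em L f2 by (simp add: good_def y mid2_def e2)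
qed

lemma square_orb:
  assumes "good x" "y \<in> set (square r (keyof r x, x))"
  shows "good y" "emb e y \<in> orb w (emb e x)" "prod2 (emb e y) = prod2 (emb e x)"
proof -
  obtain t1 t2 t3 t4 where x: "x = (t1, t2, t3, t4)" by (cases x) auto
  have L: "t1 \<in> Lb bl" "t2 \<in> Lb bl" "t3 \<in> Lb bl" "t4 \<in> Lb bl" and ok: "ok4 w (emb e x)"
    using assms(1) by (auto simp: good_def x)
  have "E t1 \<noteq> E t2 \<and> E t2 \<noteq> E t3 \<and> E t3 \<noteq> E t4" using ok4_neq ok unfolding x emb.simps by blast
  then have ne: "t1 \<noteq> t2" "t3 \<noteq> t4" by auto
  note r2 = rel_swp[OF rel_swp[OF r_rel L(1)] L(2)]
  obtain a b where e1: "flip2 (nth r) t1 t2 = (a, b)" by (metis surj_pair)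
  obtain f g where e3: "flip2 (nth (swp t2 (swp t1 r))) t3 t4 = (f, g)" by (metis surj_pair)
  note f1 = flip2_e[OF r_rel L(1,2) ne(1) e1]
  note f3 = flip2_e[OF r2 L(3,4) ne(2) e3]
  define x1 where "x1 = wflip w 3 (emb e x)"
  define x2 where "x2 = wflip w 1 (emb e x)"
  define x3 where "x3 = wflip w 1 x1"
  have X1: "x1 = emb e (t1, t2, f, g)" by (simp add: x1_def x f3)
  have X2: "x2 = emb e (a, b, t3, t4)" by (simp add: x2_def x f1)
  have X3: "x3 = emb e (a, b, f, g)" unfolding x3_def X1 by (simp add: f1)
  have ok1: "ok4 w x1" "ok4 w x2" "ok4 w x3"
    unfolding x1_def x2_def x3_def by (intro wflip_props w_inj ok)+
  have or: "x1 \<in> orb w (emb e x)" "x2 \<in> orb w (emb e x)"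
    unfolding x1_def x2_def using orb_wflip[OF orb_refl ok] by auto
  have or3: "x3 \<in> orb w (emb e x)" unfolding x3_def using orb_wflip[OF or(1) ok1(1), of 1] by simp
  have p: "prod2 x1 = prod2 (emb e x)" "prod2 x2 = prod2 (emb e x)" "prod2 x3 = prod2 x1"
    unfolding x1_def[symmetric] x2_def x3_def
    using wflip_props(5)[OF w_inj ok] wflip_props(5)[OF w_inj ok1(1)] by (auto simp: x1_def)
  have y: "y \<in> {x, (t1, t2, f, g), (a, b, t3, t4), (a, b, f, g)}"
    using assms(2) by (simp add: x e1 e3)
  show "good y" using y ok1 ok L f1 f3 unfolding X1 X2 X3 by (auto simp: good_def x)
  show "emb e y \<in> orb w (emb e x)" using y or or3 orb_refl unfolding X1 X2 X3 by blast
  show "prod2 (emb e y) = prod2 (emb e x)" using y p unfolding X1 X2 X3 by (elim insertE emptyE) simp_all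
qed

text \<open>With both end points and the middle vertex fixed, each half of the word has only two
  admissible factorizations. This is why one stored path recovers all paths through its middle
  vertex.\<close>

lemma in_square:
  assumes x: "good x" and Y: "ok4 w Y" "prod2 Y = prod2 (emb e x)" "prod4 Y = prod4 (emb e x)"
  shows "\<exists>y \<in> set (square r (keyof r x, x)). Y = emb e y"
proof -
  obtain t1 t2 t3 t4 where xx: "x = (t1, t2, t3, t4)" by (cases x) auto
  obtain y1 y2 y3 y4 where YY: "Y = (y1, y2, y3, y4)" by (cases Y) auto
  have L: "t1 \<in> Lb bl" "t2 \<in> Lb bl" "t3 \<in> Lb bl" "t4 \<in> Lb bl" and ok: "ok4 w (emb e x)"
    using x by (auto simp: good_def xx)
  have "E t1 \<noteq> E t2 \<and> E t2 \<noteq> E t3 \<and> E t3 \<noteq> E t4" using ok4_neq ok unfolding xx emb.simps by blast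
  then have ne: "t1 \<noteq> t2" "t3 \<noteq> t4" by auto
  note r2 = rel_swp[OF rel_swp[OF r_rel L(1)] L(2)]
  obtain a b where e1: "flip2 (nth r) t1 t2 = (a, b)" by (metis surj_pair)
  obtain f g where e3: "flip2 (nth (swp t2 (swp t1 r))) t3 t4 = (f, g)" by (metis surj_pair)
  note f1 = flip2_e[OF r_rel L(1,2) ne(1) e1]
  note f3 = flip2_e[OF r2 L(3,4) ne(2) e3]
  have p2: "tr y1 \<circ> tr y2 = tr (E t1) \<circ> tr (E t2)" using Y(2) by (simp add: xx YY)
  have "(y1, y2) = (E t1, E t2) \<or> (y1, y2) = flip2 w (E t1) (E t2)"
    by (rule flip2_unique[OF w_inj _ _ p2]) (use ok Y(1) in \<open>simp_all add: xx YY ok2_def\<close>)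
  then have 1: "(y1, y2) \<in> {(E t1, E t2), (E a, E b)}" by (simp add: f1)
  have "tr y1 \<circ> tr y2 \<circ> (tr y3 \<circ> tr y4) = tr (E t1) \<circ> tr (E t2) \<circ> (tr (E t3) \<circ> tr (E t4))"
    using Y(3) by (simp add: xx YY comp_assoc)
  then have p3: "tr y3 \<circ> tr y4 = tr (E t3) \<circ> tr (E t4)"
    unfolding p2 by (metis comp_assoc id_comp tr_tr(1))
  have w2: "w \<circ> tr y1 \<circ> tr y2 = w \<circ> tr (E t1) \<circ> tr (E t2)" by (rule comp_tr2_eq[OF p2])
  have "(y3, y4) = (E t3, E t4) \<or> (y3, y4) = flip2 (w \<circ> tr (E t1) \<circ> tr (E t2)) (E t3) (E t4)"
    by (rule flip2_unique[OF inj_comp_tr2[OF w_inj] _ _ p3]) (use ok Y(1) w2 in \<open>simp_all add: xx YY ok2_def\<close>)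
  then have 2: "(y3, y4) \<in> {(E t3, E t4), (E f, E g)}" by (simp add: f3)
  show ?thesis using 1 2 by (auto simp: xx YY e1 e3)
qed

lemma tr_E_outside:
  assumes "t \<in> Lb bl" "y \<notin> e ` {..<length bl}"
  shows "tr (E t) y = y"
proof -
  have "fst t < length bl" "snd t < length bl" using assms(1) by (auto simp: Lb_def)
  then have "y \<noteq> e (fst t)" "y \<noteq> e (snd t)" using assms(2) by auto
  then show ?thesis by (simp add: tr_def elab_def transpose_def)
qed

text \<open>Entries of \<open>r\<close> may repeat in different blocks, but labels keep a position
  inside its block, where \<open>r\<close> is ordered like the injective \<open>w\<close> and has no
  repetition. So the list after two swaps determines the permutation of every block; off the image
  of \<open>e\<close> both products are the identity.\<close>

lemma keyof_eq_iff:
  assumes "good x" "good y"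
  shows "keyof r x = keyof r y \<longleftrightarrow> prod2 (emb e x) = prod2 (emb e y)"
proof -
  obtain t1 t2 t3 t4 where x: "x = (t1, t2, t3, t4)" by (cases x) auto
  obtain s1 s2 s3 s4 where y: "y = (s1, s2, s3, s4)" by (cases y) auto
  have L: "t1 \<in> Lb bl" "t2 \<in> Lb bl" "s1 \<in> Lb bl" "s2 \<in> Lb bl" using assms by (auto simp: good_def x y)
  have lr: "length r = length bl" using r_rel by (simp add: rel_def)
  have K: "length (swp b (swp a r)) = length bl \<and> (\<forall>i < length bl. swp b (swp a r) ! i = r ! tr a (tr b i)
      \<and> tr a (tr b i) < length bl \<and> bl ! tr a (tr b i) = bl ! i \<and> (tr (E a) \<circ> tr (E b)) (e i) = e (tr a (tr b i)))"
    if "a \<in> Lb bl" "b \<in> Lb bl" for a b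
  proof -
    have l1: "length (swp a r) = length bl" using lr by (cases a) simp
    have l2: "length (swp b (swp a r)) = length bl" using l1 by (cases b) simp
    show ?thesis
      using nth_swp[OF that(2) l1] nth_swp[OF that(1) lr] l2 tr_E that by auto
  qed
  note Kx = K[OF L(1,2)] and Ky = K[OF L(3,4)]
  show ?thesis
  proof
    assume k: "keyof r x = keyof r y"
    show "prod2 (emb e x) = prod2 (emb e y)"
    proof
      fix z
      show "prod2 (emb e x) z = prod2 (emb e y) z"
      proof (cases "z \<in> e ` {..<length bl}")
        case True
        then obtain i where i: "i < length bl" "z = e i" by auto
        define j j' where "j = tr t1 (tr t2 i)" and "j' = tr s1 (tr s2 i)"
        have jj: "j < length bl" "j' < length bl" "bl ! j = bl ! j'" using Kx Ky i by (auto simp: j_def j'_def)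
        have "r ! j = r ! j'" using k Kx Ky i by (simp add: x y j_def j'_def)
        then have "\<not> w (e j) < w (e j') \<and> \<not> w (e j') < w (e j)" using r_rel jj unfolding rel_def by auto
        then have "e j = e j'" using w_inj by (metis injD linorder_neqE_nat)
        then show ?thesis using Kx Ky i by (simp add: x y j_def j'_def)
      next
        case False
        then show ?thesis using L by (simp add: x y tr_E_outside)
      qed
    qed
  next
    assume p: "prod2 (emb e x) = prod2 (emb e y)"
    show "keyof r x = keyof r y"
    proof (rule nth_equalityI)
      show "length (keyof r x) = length (keyof r y)" using Kx Ky by (simp add: x y)
      fix i assume "i < length (keyof r x)"
      then have i: "i < length bl" using Kx by (simp add: x)
      have "e (tr t1 (tr t2 i)) = e (tr s1 (tr s2 i))"
        using fun_cong[OF p, of "e i"] Kx Ky i by (simp add: x y)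
      then have "tr t1 (tr t2 i) = tr s1 (tr s2 i)" using Kx Ky i e_eq_iff by simp
      then show "keyof r x ! i = keyof r y ! i" using Kx Ky i by (simp add: x y)
    qed
  qed
qed

text \<open>The last clause is closure under \<open>f_2\<close> for expanded nodes. It speaks of
  keys only, since a vertex reached again may be stored with a different path.\<close>

definition inv_bfs :: "word \<Rightarrow> node list \<times> node list \<Rightarrow> bool" where
  "inv_bfs x0 p \<longleftrightarrow> set (fst p) \<subseteq> set (snd p) \<and> (keyof r x0, x0) \<in> set (snd p) \<and> distinct (map fst (snd p))
    \<and> (\<forall>\<nu> \<in> set (snd p). good (snd \<nu>) \<and> fst \<nu> = keyof r (snd \<nu>) \<and> emb e (snd \<nu>) \<in> orb w (emb e x0))
    \<and> (\<forall>\<nu> \<in> set (snd p) - set (fst p). \<forall>y \<in> set (square r \<nu>). fst (nodeof r y) \<in> fst ` set (snd p))"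

lemma add_props:
  assumes "add zs td sn = (td', sn')"
  shows "set sn \<subseteq> set sn' \<and> set sn' \<subseteq> set sn \<union> set zs \<and> set td \<subseteq> set td' \<and> set td' \<subseteq> set td \<union> set sn'
    \<and> set sn' - set sn \<subseteq> set td' \<and> (distinct (map fst sn) \<longrightarrow> distinct (map fst sn'))
    \<and> fst ` set zs \<subseteq> fst ` set sn'"
  using assms
proof (induction zs td sn rule: add.induct)
  case (2 z zs td sn)
  show ?case
  proof (cases "list_ex (\<lambda>y. fst y = fst z) sn")
    case True
    then have "fst z \<in> fst ` set sn" by (auto simp: list_ex_iff intro: rev_image_eqI)
    moreover note "2.IH"(1)[OF True] "2.prems"
    ultimately show ?thesis using True by auto
  next
    case False
    then have "fst z \<notin> fst ` set sn" by (auto simp: list_ex_iff)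
    moreover have "add zs (z # td) (z # sn) = (td', sn')" using "2.prems" False by simp
    note "2.IH"(2)[OF False this]
    ultimately show ?thesis by auto
  qed
qed auto

lemma inv_bfs_bstep:
  assumes "inv_bfs x0 p" "good x0"
  shows "inv_bfs x0 (bstep r p)"
proof (cases p)
  case (Pair td sn)
  show ?thesis
  proof (cases td)
    case Nil
    then show ?thesis using assms by (simp add: Pair)
  next
    case (Cons x xs)
    obtain td' sn' where a: "add (map (nodeof r) (square r x)) xs sn = (td', sn')" by (metis surj_pair)
    have I: "set (x # xs) \<subseteq> set sn" "(keyof r x0, x0) \<in> set sn" "distinct (map fst sn)"
      and I1: "\<And>\<nu>. \<nu> \<in> set sn \<Longrightarrow> good (snd \<nu>) \<and> fst \<nu> = keyof r (snd \<nu>) \<and> emb e (snd \<nu>) \<in> orb w (emb e x0)"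
      and I2: "\<And>\<nu> y. \<nu> \<in> set sn \<Longrightarrow> \<nu> \<notin> set (x # xs) \<Longrightarrow> y \<in> set (square r \<nu>) \<Longrightarrow> fst (nodeof r y) \<in> fst ` set sn"
      using assms(1) unfolding inv_bfs_def Pair Cons fst_conv snd_conv by blast+
    have A: "set sn \<subseteq> set sn'" "set sn' \<subseteq> set sn \<union> nodeof r ` set (square r x)" "set xs \<subseteq> set td'"
      "set td' \<subseteq> set xs \<union> set sn'" "set sn' - set sn \<subseteq> set td'" "distinct (map fst sn')"
      "fst ` nodeof r ` set (square r x) \<subseteq> fst ` set sn'"
      using add_props[OF a] I(3) by auto
    have xg: "good (snd x)" "x = (keyof r (snd x), snd x)" "emb e (snd x) \<in> orb w (emb e x0)"
      using I1[of x] I(1) by (auto simp: prod_eq_iff)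
    have new: "good (snd \<nu>) \<and> fst \<nu> = keyof r (snd \<nu>) \<and> emb e (snd \<nu>) \<in> orb w (emb e x0)"
      if \<nu>: "\<nu> = nodeof r y" and y: "y \<in> set (square r x)" for \<nu> y
    proof -
      note sq = square_orb[OF xg(1), folded xg(2), OF y]
      have "emb e y \<in> orb w (emb e x0)" using orb_trans[OF xg(3) sq(2)] .
      then have "wflip w 2 (emb e y) \<in> orb w (emb e x0)"
        using sq(1) by (intro orb_wflip) (auto simp: good_def)
      then show ?thesis using nodeof_props[OF sq(1)] \<nu> by simp
    qed
    have "inv_bfs x0 (td', sn')"
      unfolding inv_bfs_def fst_conv snd_conv
    proof (intro conjI ballI)
      show "set td' \<subseteq> set sn'" using A I by auto
      show "(keyof r x0, x0) \<in> set sn'" using A I by auto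
      show "distinct (map fst sn')" by (rule A)
      fix \<nu> assume "\<nu> \<in> set sn'"
      then have "good (snd \<nu>) \<and> fst \<nu> = keyof r (snd \<nu>) \<and> emb e (snd \<nu>) \<in> orb w (emb e x0)"
        using A(2) I1 new by blast
      then show "good (snd \<nu>)" "fst \<nu> = keyof r (snd \<nu>)" "emb e (snd \<nu>) \<in> orb w (emb e x0)" by auto
    next
      fix \<nu> y assume \<nu>: "\<nu> \<in> set sn' - set td'" and y: "y \<in> set (square r \<nu>)"
      then have n: "\<nu> \<in> set sn" "\<nu> \<notin> set xs" using A by auto
      show "fst (nodeof r y) \<in> fst ` set sn'"
      proof (cases "\<nu> = x")
        case True then show ?thesis using A(7) y by auto
      next
        case False then show ?thesis using I2[of \<nu> y] n y A(1) by auto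
      qed
    qed
    then show ?thesis by (simp add: Pair Cons a)
  qed
qed

lemma inv_bfs_bfs: "inv_bfs x0 p \<Longrightarrow> good x0 \<Longrightarrow> inv_bfs x0 (bfs m r p)"
  by (induction m arbitrary: p) (simp_all add: inv_bfs_bstep)

lemma inv_bfs_start: "good x0 \<Longrightarrow> inv_bfs x0 ([(keyof r x0, x0)], [(keyof r x0, x0)])"
  by (simp add: inv_bfs_def orb_refl)

text \<open>\<open>m\<close> is fuel: once the list of nodes to expand is empty, the invariant says
  that the set of vertices found is closed, so the search has exhausted the orbit.\<close>

lemma orb_search:
  assumes x0: "good x0" and b: "bfs m r ([(keyof r x0, x0)], [(keyof r x0, x0)]) = ([], sn)"
  defines "L \<equiv> concat (map (square r) sn)"
  shows "\<And>x. x \<in> set L \<Longrightarrow> good x"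
    "orb w (emb e x0) = emb e ` set L"
    "card (prod2 ` orb w (emb e x0)) = length sn"
proof -
  let ?O = "orb w (emb e x0)"
  have I: "inv_bfs x0 ([], sn)" using inv_bfs_bfs[OF inv_bfs_start[OF x0] x0] b by metis
  have st: "(keyof r x0, x0) \<in> set sn" and di: "distinct (map fst sn)"
    and I1: "\<And>\<nu>. \<nu> \<in> set sn \<Longrightarrow> good (snd \<nu>) \<and> fst \<nu> = keyof r (snd \<nu>) \<and> emb e (snd \<nu>) \<in> ?O"
    and I2: "\<And>\<nu> y. \<nu> \<in> set sn \<Longrightarrow> y \<in> set (square r \<nu>) \<Longrightarrow> fst (nodeof r y) \<in> fst ` set sn"
    using I unfolding inv_bfs_def fst_conv snd_conv list.set(1) Diff_empty by blast+
  have pr: "\<nu> = (keyof r (snd \<nu>), snd \<nu>)" if "\<nu> \<in> set sn" for \<nu> using I1[OF that] by (simp add: prod_eq_iff)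
  have ok0: "ok4 w (emb e x0)" using x0 by (simp add: good_def)
  have sq: "good y \<and> emb e y \<in> ?O \<and> prod2 (emb e y) = prod2 (emb e (snd \<nu>))"
    if "\<nu> \<in> set sn" "y \<in> set (square r \<nu>)" for \<nu> y
  proof -
    have g: "good (snd \<nu>)" using I1[OF that(1)] by blast
    have y: "y \<in> set (square r (keyof r (snd \<nu>), snd \<nu>))" using that(2) pr[OF that(1)] by simp
    show ?thesis using square_orb[OF g y] I1[OF that(1)] orb_trans by blast
  qed
  then show "\<And>x. x \<in> set L \<Longrightarrow> good x" by (auto simp: L_def)
  have in_sq: "\<exists>y \<in> set (square r \<nu>). Y = emb e y"
    if "\<nu> \<in> set sn" "Y \<in> ?O" "prod2 Y = prod2 (emb e (snd \<nu>))" for Y \<nu>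
  proof -
    have g: "good (snd \<nu>)" using I1[OF that(1)] by blast
    have "prod4 Y = prod4 (emb e (snd \<nu>))"
      using orb_prod4[OF w_inj ok0 that(2)] orb_prod4[OF w_inj ok0] I1[OF that(1)] by simp
    from in_square[OF g orb_ok4[OF w_inj ok0 that(2)] that(3) this] pr[OF that(1)] show ?thesis by simp
  qed
  \<comment> \<open>It suffices to cover middle vertices: \<open>f_1\<close> and \<open>f_3\<close>
    leave the vertex in place, and \<open>f_2\<close> leads to a key that is present by the closure
    clause.\<close>
  have cov: "\<exists>\<nu> \<in> set sn. prod2 Y = prod2 (emb e (snd \<nu>))" if "Y \<in> ?O" for Y
    using that
  proof (induction rule: orb_induct)
    case base
    then show ?case using st by (auto intro: bexI[OF _ st])
  next
    case (step Y i)
    from step.IH obtain \<nu> where \<nu>: "\<nu> \<in> set sn" "prod2 Y = prod2 (emb e (snd \<nu>))" by blast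
    show ?case
    proof (cases "i = 2")
      case False
      then show ?thesis using wflip_props(5)[OF w_inj step.hyps(2) False] \<nu> by auto
    next
      case True
      obtain y where y: "y \<in> set (square r \<nu>)" "Y = emb e y" using in_sq[OF \<nu>(1) step.hyps(1) \<nu>(2)] by blast
      have gy: "good y" using sq[OF \<nu>(1) y(1)] by blast
      note n = nodeof_props[OF gy]
      obtain \<nu>' where \<nu>': "\<nu>' \<in> set sn" "fst \<nu>' = fst (nodeof r y)" 
        using I2[OF \<nu>(1) y(1)] by (elim imageE) simp
      have "keyof r (snd \<nu>') = keyof r (snd (nodeof r y))"
        using \<nu>'(2) n(1) I1[OF \<nu>'(1)] by simp
      then have "prod2 (emb e (snd \<nu>')) = prod2 (wflip w i Y)"
        using keyof_eq_iff[of "snd \<nu>'" "snd (nodeof r y)"] I1[OF \<nu>'(1)] n True y(2) by simp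
      then show ?thesis using \<nu>'(1) by (intro bexI[of _ \<nu>']) simp_all
    qed
  qed
  show "?O = emb e ` set L"
  proof
    show "?O \<subseteq> emb e ` set L"
    proof
      fix Y assume Y: "Y \<in> ?O"
      with cov obtain \<nu> where \<nu>: "\<nu> \<in> set sn" "prod2 Y = prod2 (emb e (snd \<nu>))" by blast
      from in_sq[OF \<nu>(1) Y \<nu>(2)] \<nu>(1) show "Y \<in> emb e ` set L" by (auto simp: L_def)
    qed
    show "emb e ` set L \<subseteq> ?O" using sq by (auto simp: L_def)
  qed
  have "prod2 ` ?O = (\<lambda>\<nu>. prod2 (emb e (snd \<nu>))) ` set sn"
  proof
    show "prod2 ` ?O \<subseteq> (\<lambda>\<nu>. prod2 (emb e (snd \<nu>))) ` set sn" using cov by blast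
    show "(\<lambda>\<nu>. prod2 (emb e (snd \<nu>))) ` set sn \<subseteq> prod2 ` ?O" using I1 by blast
  qed
  moreover have "inj_on (\<lambda>\<nu>. prod2 (emb e (snd \<nu>))) (set sn)"
  proof (rule inj_onI)
    fix \<nu> \<nu>' assume n: "\<nu> \<in> set sn" "\<nu>' \<in> set sn" "prod2 (emb e (snd \<nu>)) = prod2 (emb e (snd \<nu>'))"
    then have "fst \<nu> = fst \<nu>'"
      using keyof_eq_iff[of "snd \<nu>" "snd \<nu>'"] I1[OF n(1)] I1[OF n(2)] by simp
    then show "\<nu> = \<nu>'" using di n(1,2) by (auto simp: distinct_map dest: inj_onD)
  qed
  ultimately show "card (prod2 ` ?O) = length sn"
    using di by (simp add: card_image distinct_map distinct_card)
qed

end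

section \<open>Counting increasing words for every reflection ordering\<close>

text \<open>For \<open>a < b < c\<close> a reflection ordering is oriented either as \<open>(a,b), (a,c), (b,c)\<close> (\<open>True\<close>)
  or in reverse (\<open>False\<close>). Two labels with a common element are compared by the orientation of the
  triple that they span; \<open>lit\<close> is the orientation that puts them in the given order.
  A list of signs records which orientations a word requires, \<open>Xo\<close> standing for contradictory ones.
  The inner nodes of a \<open>tree\<close> branch on the orientations of successive triples, and \<open>Bad\<close> cuts off those
  that no reflection ordering has.\<close>

datatype tree = Leaf | Bad | Node tree tree
datatype sign = No | Po | Mo | Xo

fun lit :: "lab \<Rightarrow> lab \<Rightarrow> (trip \<times> bool) list" where
  "lit (a, b) (c, d) =
   (if a = c then (if b < d then [((a, b, d), True)] else [((a, d, b), False)])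
    else if b = c then [((a, b, d), True)]
    else if a = d then [((c, a, b), False)]
    else if b = d then (if a < c then [((a, c, b), True)] else [((c, a, b), False)])
    else [])"

fun lits :: "word \<Rightarrow> (trip \<times> bool) list" where
  "lits (t1, t2, t3, t4) = lit t1 t2 @ lit t2 t3 @ lit t3 t4 @ lit t1 t3 @ lit t2 t4 @ lit t1 t4"

fun pos :: "sign \<Rightarrow> sign" where
  "pos No = Po" | "pos Po = Po" | "pos Mo = Xo" | "pos Xo = Xo"

fun neg :: "sign \<Rightarrow> sign" where
  "neg No = Mo" | "neg Po = Xo" | "neg Mo = Mo" | "neg Xo = Xo"

fun upd :: "trip list \<Rightarrow> trip \<times> bool \<Rightarrow> sign list \<Rightarrow> sign list" where
  "upd ((x, y, z) # Ts) ((a, b, c), v) (e # es) =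
    (if (if x = a then if y = b then z = c else False else False)
     then (if v then pos e else neg e) # es else e # upd Ts ((a, b, c), v) es)"
| "upd _ _ es = es"

text \<open>This agrees with the lexicographic order on labels with entries below 8, which is enough as
  four labels involve at most 8 elements.\<close>

fun code :: "lab \<Rightarrow> nat" where
  "code (a, b) = 8 * a + b"

fun label_le :: "lab \<Rightarrow> lab \<Rightarrow> bool" where
  "label_le (a, b) (c, d) \<longleftrightarrow> a < c \<or> a = c \<and> b \<le> d"

fun insert_label :: "lab \<Rightarrow> lab list \<Rightarrow> lab list" where
  "insert_label x [] = [x]"
| "insert_label x (y # ys) = (if label_le x y then x # y # ys else y # insert_label x ys)"

fun skey :: "word \<Rightarrow> lab list" where
  "skey (t1, t2, t3, t4) = insert_label t1 (insert_label t2 (insert_label t3 (insert_label t4 [])))"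

type_synonym item = "lab list \<times> sign list"

text \<open>Adjacent labels of an admissible word differ anyway, so these inequalities make all four
  labels distinct.\<close>

fun apart :: "word \<Rightarrow> bool" where
  "apart (a, b, c, d) \<longleftrightarrow> a \<noteq> c \<and> b \<noteq> d \<and> a \<noteq> d"

text \<open>Label sets are to be counted, but words with the same label set may demand different
  orientations. A given ordering meets at most one of these demands, so the number of satisfied
  items is the number of label sets.\<close>

definition item :: "trip list \<Rightarrow> sign list \<Rightarrow> word \<Rightarrow> item" where
  "item Ts e0 x = (skey x, fold (upd Ts) (lits x) e0)"

text \<open>The nested conditionals avoid the evaluation of the remaining comparisons once two items differ.\<close>

fun sign_eq :: "sign list \<Rightarrow> sign list \<Rightarrow> bool" where
  "sign_eq [] [] = True"
| "sign_eq (No # c) (No # d) = sign_eq c d"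
| "sign_eq (Po # c) (Po # d) = sign_eq c d"
| "sign_eq (Mo # c) (Mo # d) = sign_eq c d"
| "sign_eq (Xo # c) (Xo # d) = sign_eq c d"
| "sign_eq _ _ = False"

primrec item_in :: "item \<Rightarrow> item list \<Rightarrow> bool" where
  "item_in i [] = False"
| "item_in i (j # js) = (if (if sign_eq (snd i) (snd j) then fst i = fst j else False) then True else item_in i js)"

definition insert_item :: "item \<Rightarrow> item list \<Rightarrow> item list" where
  "insert_item i js = (if item_in i js then js else i # js)"

primrec items :: "trip list \<Rightarrow> sign list \<Rightarrow> word list \<Rightarrow> item list \<Rightarrow> item list" where
  "items Ts e0 [] its = its"
| "items Ts e0 (x # xs) its = items Ts e0 xs (if apart x then insert_item (item Ts e0 x) its else its)"

fun restrT :: "sign list list \<Rightarrow> sign list list" where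
  "restrT [] = []" | "restrT ([] # xs) = restrT xs" | "restrT ((No # c) # xs) = c # restrT xs"
| "restrT ((Po # c) # xs) = c # restrT xs" | "restrT ((Mo # c) # xs) = restrT xs" | "restrT ((Xo # c) # xs) = restrT xs"

fun restrF :: "sign list list \<Rightarrow> sign list list" where
  "restrF [] = []" | "restrF ([] # xs) = restrF xs" | "restrF ((No # c) # xs) = c # restrF xs"
| "restrF ((Po # c) # xs) = restrF xs" | "restrF ((Mo # c) # xs) = c # restrF xs" | "restrF ((Xo # c) # xs) = restrF xs"

fun has_length :: "nat \<Rightarrow> 'a list \<Rightarrow> bool" where
  "has_length 0 [] = True" | "has_length (Suc n) (x # xs) = has_length n xs" | "has_length _ _ = False"

fun chk :: "tree \<Rightarrow> nat \<Rightarrow> sign list list \<Rightarrow> bool" where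
  "chk Bad k xs = True"
| "chk Leaf k xs = has_length k xs"
| "chk (Node t f) k xs = (chk t k (restrT xs) \<and> chk f k (restrF xs))"

text \<open>The claimed value in terms of \<open>t_1\<close>, \<open>t_2\<close>,
  \<open>t_3\<close>. As \<open>(8, 14, 8)\<close> is caught by the first case, the second one need
  not exclude it again.\<close>

definition val :: "nat \<Rightarrow> nat \<Rightarrow> nat \<Rightarrow> nat" where
  "val a b c = (if a = 5 \<and> b = 10 \<and> c = 5 \<or> a = 8 \<and> b = 14 \<and> c = 8 then 3 else if a + c \<ge> 12 then 2 else 1)"

definition verify :: "trip list \<Rightarrow> sign list \<Rightarrow> tree \<Rightarrow> nat \<Rightarrow> word list \<Rightarrow> bool" where
  "verify Ts e0 tt n ws = chk tt (val (length (remdups (map fst ws))) n (length (remdups (map last4 ws))))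
     (map snd (items Ts e0 ws []))"

fun verify_bfs :: "trip list \<Rightarrow> sign list \<Rightarrow> tree \<Rightarrow> nat list \<Rightarrow> node list \<times> node list \<Rightarrow> bool" where
  "verify_bfs Ts e0 tt r (td, sn) \<longleftrightarrow> td = [] \<and> verify Ts e0 tt (length sn) (concat (map (square r) sn))"

text \<open>An orbit has at most 14 middle vertices, so 15 steps exhaust the search.\<close>

definition run :: "trip list \<Rightarrow> sign list \<Rightarrow> tree \<Rightarrow> nat list \<Rightarrow> word \<Rightarrow> bool" where
  "run Ts e0 tt r x = verify_bfs Ts e0 tt r (bfs 15 r ([(keyof r x, x)], [(keyof r x, x)]))"

fun okv :: "bool \<Rightarrow> sign \<Rightarrow> bool" where
  "okv b No = True" | "okv b Po = b" | "okv b Mo = (\<not> b)" | "okv b Xo = False"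

fun satc :: "(trip \<Rightarrow> bool) \<Rightarrow> trip list \<Rightarrow> sign list \<Rightarrow> bool" where
  "satc \<beta> (T # Ts) (e # es) \<longleftrightarrow> okv (\<beta> T) e \<and> satc \<beta> Ts es"
| "satc \<beta> _ _ \<longleftrightarrow> True"

text \<open>The branch prescribed by the orientations \<open>\<beta>\<close> reaches a leaf, that
  is, it has not been cut off.\<close>

fun ends :: "(trip \<Rightarrow> bool) \<Rightarrow> trip list \<Rightarrow> tree \<Rightarrow> bool" where
  "ends \<beta> [] Leaf = True"
| "ends \<beta> (T # Ts) (Node t f) = ends \<beta> Ts (if \<beta> T then t else f)"
| "ends \<beta> _ _ = False"

section \<open>Correctness of the sign lists and of the count along a tree\<close>

lemma upd_Cons:
  "upd (T # Ts) p (e # es) =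
    (if T = fst p then (if snd p then pos e else neg e) # es else e # upd Ts p es)"
proof -
  obtain x y z a b c v where "T = (x, y, z)" "p = ((a, b, c), v)" by (metis surj_pair)
  then show ?thesis by (cases "x = a"; cases "y = b"; cases "z = c"; simp)
qed

declare upd.simps(1) [simp del]

lemma length_upd: "length (upd Ts p es) = length es"
proof (induction Ts arbitrary: es)
  case (Cons T Ts)
  then show ?case by (cases es) (simp_all add: upd_Cons)
qed simp

lemma okv_pos: "okv b (pos e) \<longleftrightarrow> okv b e \<and> b" and okv_neg: "okv b (neg e) \<longleftrightarrow> okv b e \<and> \<not> b"
  by (cases e; auto)+

lemma satc_upd:
  "length es = length Ts \<Longrightarrow> satc \<beta> Ts (upd Ts p es) \<longleftrightarrow> satc \<beta> Ts es \<and> (fst p \<in> set Ts \<longrightarrow> \<beta> (fst p) = snd p)"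
proof (induction Ts arbitrary: es)
  case (Cons T Ts)
  then obtain e es' where "es = e # es'" by (cases es) auto
  with Cons show ?case by (auto simp: upd_Cons okv_pos okv_neg)
qed simp

lemma satc_fold_upd:
  "length es = length Ts \<Longrightarrow> satc \<beta> Ts (fold (upd Ts) ps es) \<longleftrightarrow>
    satc \<beta> Ts es \<and> (\<forall>p \<in> set ps. fst p \<in> set Ts \<longrightarrow> \<beta> (fst p) = snd p)"
  by (induction ps arbitrary: es) (auto simp: satc_upd length_upd)

lemma satc_No: "satc \<beta> Ts (replicate m No)"
  by (induction m arbitrary: Ts) (simp, case_tac Ts, simp_all)

lemma length_fold_upd: "length (fold (upd Ts) ps es) = length es"
  by (induction ps arbitrary: es) (auto simp: length_upd)

lemma pos_neg: "pos (pos e) = pos e" "neg (neg e) = neg e" "pos (neg e) = neg (pos e)"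
  by (cases e; simp)+

lemma upd_commute: "upd Ts p (upd Ts q es) = upd Ts q (upd Ts p es)"
proof (induction Ts arbitrary: es)
  case (Cons T Ts)
  show ?case using Cons.IH by (cases es) (simp_all add: upd_Cons pos_neg)
qed simp

lemma upd_idem: "upd Ts p (upd Ts p es) = upd Ts p es"
proof (induction Ts arbitrary: es)
  case (Cons T Ts)
  show ?case using Cons.IH by (cases es) (simp_all add: upd_Cons pos_neg)
qed simp

text \<open>Updates of signs commute and are idempotent, so two words with the same set of demands
  get the same list of signs, whatever the order of their labels.\<close>

lemma fold_upd_cong: "set ps = set qs \<Longrightarrow> fold (upd Ts) ps es = fold (upd Ts) qs es"
proof -
  interpret comp_fun_idem "upd Ts"
    by unfold_locales (auto simp: fun_eq_iff upd_commute upd_idem)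
  show "set ps = set qs \<Longrightarrow> ?thesis" by (metis fold_set_fold)
qed

lemma has_length: "has_length k xs \<longleftrightarrow> length xs = k"
  by (induction k xs rule: has_length.induct) auto

lemma filter_restrT: "\<beta> T \<Longrightarrow> \<forall>c \<in> set xs. c \<noteq> [] \<Longrightarrow>
    length (filter (satc \<beta> (T # Ts)) xs) = length (filter (satc \<beta> Ts) (restrT xs))"
  by (induction xs rule: restrT.induct) auto

lemma filter_restrF: "\<not> \<beta> T \<Longrightarrow> \<forall>c \<in> set xs. c \<noteq> [] \<Longrightarrow>
    length (filter (satc \<beta> (T # Ts)) xs) = length (filter (satc \<beta> Ts) (restrF xs))"
  by (induction xs rule: restrF.induct) auto

lemma length_restrT: "\<forall>c \<in> set xs. length c = Suc m \<Longrightarrow> \<forall>c \<in> set (restrT xs). length c = m"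
  by (induction xs rule: restrT.induct) auto

lemma length_restrF: "\<forall>c \<in> set xs. length c = Suc m \<Longrightarrow> \<forall>c \<in> set (restrF xs). length c = m"
  by (induction xs rule: restrF.induct) auto

text \<open>Each branching discards the lists that contradict the chosen orientation. At a leaf no
  triple is left, so the surviving lists are exactly the satisfied ones.\<close>

lemma chk_ends:
  "ends \<beta> Ts tt \<Longrightarrow> chk tt k xs \<Longrightarrow> \<forall>c \<in> set xs. length c = length Ts \<Longrightarrow> length (filter (satc \<beta> Ts) xs) = k"
proof (induction \<beta> Ts tt arbitrary: xs rule: ends.induct)
  case (1 \<beta>)
  then show ?case by (simp add: has_length)
next
  case (2 \<beta> T Ts t f)
  have ne: "\<forall>c \<in> set xs. c \<noteq> []" using "2.prems"(3) by auto
  show ?case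
  proof (cases "\<beta> T")
    case True
    have "length (filter (satc \<beta> Ts) (restrT xs)) = k"
      using "2.IH"[of "restrT xs"] "2.prems" True length_restrT[of xs "length Ts"] by simp
    then show ?thesis using filter_restrT[where \<beta> = \<beta>, OF True ne] by simp
  next
    case False
    have "length (filter (satc \<beta> Ts) (restrF xs)) = k"
      using "2.IH"[of "restrF xs"] "2.prems" False length_restrF[of xs "length Ts"] by simp
    then show ?thesis using filter_restrF[where \<beta> = \<beta>, OF False ne] by simp
  qed
qed simp_all

lemma sign_eq: "sign_eq c d \<longleftrightarrow> c = d"
  by (induction c d rule: sign_eq.induct) auto

lemma item_in: "item_in i js \<longleftrightarrow> i \<in> set js"
  by (induction js) (auto simp: sign_eq prod_eq_iff)

lemma items_set:
  "set (items Ts e0 ws its) = set its \<union> item Ts e0 ` {x \<in> set ws. apart x}"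
  "distinct its \<Longrightarrow> distinct (items Ts e0 ws its)"
  by (induction ws arbitrary: its) (auto simp: insert_item_def item_in)

lemma label_le_code: "snd s < 8 \<Longrightarrow> snd t < 8 \<Longrightarrow> label_le s t \<longleftrightarrow> code s \<le> code t"
  by (cases s; cases t) auto

lemma set_insert_label: "set (insert_label x xs) = insert x (set xs)"
  by (induction x xs rule: insert_label.induct) auto

lemma set_skey: "set (skey x) = labs x"
  by (cases x) (auto simp: set_insert_label)

lemma map_code_insert_label:
  "\<forall>t \<in> set (x # xs). snd t < 8 \<Longrightarrow> map code (insert_label x xs) = insort (code x) (map code xs)"
  by (induction x xs rule: insert_label.induct) (auto simp: label_le_code)

lemma code_inj: "inj_on code {t. snd t < 8}"
  by (rule inj_on_inverseI[of _ "\<lambda>m. (m div 8, m mod 8)"]) auto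

lemma skey_unique:
  assumes "\<forall>t \<in> labs x. snd t < 8" "\<forall>t \<in> labs y. snd t < 8" "labs x = labs y"
    and "card (labs x) = 4"
  shows "skey x = skey y"
proof -
  have c: "map code (skey z) = sorted_list_of_set (code ` labs z)"
    if "\<forall>t \<in> labs z. snd t < 8" "card (labs z) = 4" for z
  proof -
    obtain t1 t2 t3 t4 where z: "z = (t1, t2, t3, t4)" by (cases z) auto
    have s: "map code (skey z) = insort (code t1) (insort (code t2) (insort (code t3) (insort (code t4) [])))"
      using that(1) by (simp add: z map_code_insert_label set_insert_label del: insert_label.simps)
    have "sorted (map code (skey z))" unfolding s by (simp add: sorted_insort)
    moreover have st: "set (map code (skey z)) = code ` labs z" by (simp add: set_skey)
    moreover have "inj_on code (labs z)" using code_inj by (rule inj_on_subset) (use that(1) in auto)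
    then have "card (set (map code (skey z))) = 4" unfolding st using that(2) by (simp add: card_image)
    then have "distinct (map code (skey z))" by (intro card_distinct) (simp add: s)
    ultimately show ?thesis by (metis sorted_list_of_set.idem_if_sorted_distinct)
  qed
  have "map code (skey x) = map code (skey y)" using c[OF assms(1,4)] c[OF assms(2)] assms(3,4) by simp
  moreover have "inj_on code (set (skey x) \<union> set (skey y))"
    using code_inj by (rule inj_on_subset) (use assms(1,2) set_skey in auto)
  ultimately show ?thesis by (metis map_inj_on)
qed

lemma lit_fst_sym: "fst ` set (lit s t) = fst ` set (lit t s)" if "fst s < snd s" "fst t < snd t" "s \<noteq> t"
  using that by (cases s; cases t) auto

text \<open>Which triples are mentioned depends on the label set only: reordering two labels may
  change the demanded orientation but not the triple they span.\<close>

lemma lits_fst: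
  assumes "\<forall>t \<in> labs x. fst t < snd t" "card (labs x) = 4"
  shows "fst ` set (lits x) = (\<Union>s\<in>labs x. \<Union>t\<in>labs x - {s}. fst ` set (lit s t))"
proof -
  obtain t1 t2 t3 t4 where x: "x = (t1, t2, t3, t4)" by (cases x) auto
  have d: "distinct [t1, t2, t3, t4]" using assms(2) by (intro card_distinct) (simp add: x)
  have D: "labs x - {t1} = {t2, t3, t4}" "labs x - {t2} = {t1, t3, t4}" "labs x - {t3} = {t1, t2, t4}" "labs x - {t4} = {t1, t2, t3}"
    using d by (auto simp: x)
  have sy: "fst ` set (lit s t) = fst ` set (lit t s)" if "s \<in> labs x" "t \<in> labs x - {s}" for s t
    using lit_fst_sym[of s t] assms(1) that by auto
  have "fst ` set (lits x) = fst ` set (lit t1 t2) \<union> fst ` set (lit t2 t3) \<union> fst ` set (lit t3 t4)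
      \<union> fst ` set (lit t1 t3) \<union> fst ` set (lit t2 t4) \<union> fst ` set (lit t1 t4)"
    by (simp add: x image_Un Un_assoc)
  moreover have "(\<Union>s\<in>labs x. \<Union>t\<in>labs x - {s}. fst ` set (lit s t)) =
     (\<Union>t\<in>labs x - {t1}. fst ` set (lit t1 t)) \<union> (\<Union>t\<in>labs x - {t2}. fst ` set (lit t2 t))
     \<union> (\<Union>t\<in>labs x - {t3}. fst ` set (lit t3 t)) \<union> (\<Union>t\<in>labs x - {t4}. fst ` set (lit t4 t))"
    by (simp add: x Un_assoc)
  moreover have "lit' (t2, t1) = lit' (t1, t2) \<and> lit' (t3, t2) = lit' (t2, t3) \<and> lit' (t4, t3) = lit' (t3, t4)
     \<and> lit' (t3, t1) = lit' (t1, t3) \<and> lit' (t4, t2) = lit' (t2, t4) \<and> lit' (t4, t1) = lit' (t1, t4)"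
    if "lit' = (\<lambda>(s, t). fst ` set (lit s t))" for lit'
    unfolding that prod.case using sy d by (simp add: x)
  note this[OF refl, unfolded prod.case]
  ultimately show ?thesis unfolding D by auto
qed

section \<open>Weak words counted through orientations of triples\<close>

context block_search
begin

text \<open>Two labels with a common point span a triple, and by \<open>tri\<close> the single
  comparison of \<open>(x, y)\<close> with \<open>(x, z)\<close> decides the order of all three
  labels on it.\<close>

lemma weak2_lit:
  assumes s: "s \<in> Lb bl" and t: "t \<in> Lb bl" and ne: "s \<noteq> t"
    and tri: "\<And>x y z. x < y \<Longrightarrow> y < z \<Longrightarrow> z < length bl \<Longrightarrow> bl ! x = bl ! y \<Longrightarrow> bl ! y = bl ! z \<Longrightarrow>
      f (E (x, y)) < f (E (x, z)) \<and> f (E (x, z)) < f (E (y, z)) \<or> f (E (y, z)) < f (E (x, z)) \<and> f (E (x, z)) < f (E (x, y))"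
  shows "weak2 f (E s) (E t) \<longleftrightarrow> (\<forall>p \<in> set (lit s t). (\<lambda>(x, y, z). f (E (x, y)) < f (E (x, z))) (fst p) = snd p)"
proof -
  obtain a b c d where st: "s = (a, b)" "t = (c, d)" by (metis surj_pair)
  have l: "a < b" "b < length bl" "bl ! a = bl ! b" "c < d" "d < length bl" "bl ! c = bl ! d"
    using s t by (auto simp: st Lb_def)
  have dj: "disj (E s) (E t) \<longleftrightarrow> a \<noteq> c \<and> a \<noteq> d \<and> b \<noteq> c \<and> b \<noteq> d"
    using l by (simp add: st disj_def elab_def e_eq_iff)
  consider "a = c" "b < d" | "a = c" "d < b" | "b = c" | "a = d" | "b = d" "a < c" | "b = d" "c < a"
    | "a \<noteq> c" "a \<noteq> d" "b \<noteq> c" "b \<noteq> d" using ne st by fastforce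
  then show ?thesis
  proof cases
    case 1 then show ?thesis using tri[of a b d] l unfolding weak2_def dj by (simp add: st)
  next
    case 2 then show ?thesis using tri[of a d b] l unfolding weak2_def dj by (auto simp add: st)
  next
    case 3 then show ?thesis using tri[of a b d] l unfolding weak2_def dj by (auto simp add: st)
  next
    case 4 then show ?thesis using tri[of c a b] l unfolding weak2_def dj by (auto simp add: st)
  next
    case 5 then show ?thesis using tri[of a c b] l unfolding weak2_def dj by (auto simp add: st)
  next
    case 6 then show ?thesis using tri[of c a b] l unfolding weak2_def dj by (auto simp add: st)
  next
    case 7 then show ?thesis unfolding weak2_def dj by (simp add: st)
  qed
qed

lemma weak_lits:
  assumes x: "good x"
    and tri: "\<And>x y z. x < y \<Longrightarrow> y < z \<Longrightarrow> z < length bl \<Longrightarrow> bl ! x = bl ! y \<Longrightarrow> bl ! y = bl ! z \<Longrightarrow>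
      f (E (x, y)) < f (E (x, z)) \<and> f (E (x, z)) < f (E (y, z)) \<or> f (E (y, z)) < f (E (x, z)) \<and> f (E (x, z)) < f (E (x, y))"
  defines "\<beta> \<equiv> \<lambda>(x, y, z). f (E (x, y)) < f (E (x, z))"
  shows "weak f (emb e x) \<longleftrightarrow> apart x \<and> (\<forall>p \<in> set (lits x). \<beta> (fst p) = snd p)"
proof -
  obtain t1 t2 t3 t4 where xx: "x = (t1, t2, t3, t4)" by (cases x) auto
  have L: "t1 \<in> Lb bl" "t2 \<in> Lb bl" "t3 \<in> Lb bl" "t4 \<in> Lb bl" and ok: "ok4 w (emb e x)"
    using x by (auto simp: good_def xx)
  have "E t1 \<noteq> E t2 \<and> E t2 \<noteq> E t3 \<and> E t3 \<noteq> E t4" using ok4_neq ok unfolding xx emb.simps by blast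
  then have ne: "t1 \<noteq> t2" "t2 \<noteq> t3" "t3 \<noteq> t4" by auto
  have irr: "\<not> weak2 f t t" for t by (simp add: weak2_def disj_def)
  note W = weak2_lit[where f = f, OF _ _ _ tri, folded \<beta>_def]
  show ?thesis
  proof (cases "apart x")
    case True
    then have "t1 \<noteq> t3" "t2 \<noteq> t4" "t1 \<noteq> t4" by (auto simp: xx)
    then show ?thesis
      using W[OF L(1,2) ne(1)] W[OF L(2,3) ne(2)] W[OF L(3,4) ne(3)] W[OF L(1,3)] W[OF L(2,4)] W[OF L(1,4)] True
      by (simp add: xx ball_Un)
  next
    case False
    then have "t1 = t3 \<or> t2 = t4 \<or> t1 = t4" unfolding xx by simp
    then have "\<not> weak f (emb e x)" using irr[of "E t1"] irr[of "E t2"] by (auto simp: xx)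
    then show ?thesis using False by simp
  qed
qed

lemma count_items:
  assumes x0: "good x0" and run: "run Ts (replicate (length Ts) No) tt r x0"
    and en: "ends (\<lambda>(x, y, z). f (E (x, y)) < f (E (x, z))) Ts tt"
    and tri: "\<And>x y z. x < y \<Longrightarrow> y < z \<Longrightarrow> z < length bl \<Longrightarrow> bl ! x = bl ! y \<Longrightarrow> bl ! y = bl ! z \<Longrightarrow>
      f (E (x, y)) < f (E (x, z)) \<and> f (E (x, z)) < f (E (y, z)) \<or> f (E (y, z)) < f (E (x, z)) \<and> f (E (x, z)) < f (E (x, y))"
    and Ts: "\<And>x y z. x < y \<Longrightarrow> y < z \<Longrightarrow> z < length bl \<Longrightarrow> bl ! x = bl ! y \<Longrightarrow> bl ! y = bl ! z \<Longrightarrow> (x, y, z) \<in> set Ts"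
    and len: "length bl \<le> 8"
  shows "card (labs ` {y \<in> orb w (emb e x0). weak f y}) =
    val (card (fst ` orb w (emb e x0))) (card (prod2 ` orb w (emb e x0))) (card (last4 ` orb w (emb e x0)))"
proof -
  let ?O = "orb w (emb e x0)" and ?e0 = "replicate (length Ts) No"
  define \<beta> where "\<beta> = (\<lambda>(x, y, z). f (E (x, y)) < f (E (x, z)))"
  obtain td sn where b: "bfs 15 r ([(keyof r x0, x0)], [(keyof r x0, x0)]) = (td, sn)" by (metis surj_pair)
  define L where "L = concat (map (square r) sn)"
  have td: "td = []" and ver: "verify Ts ?e0 tt (length sn) L"
    using run by (simp_all add: run_def b L_def)
  note S = orb_search[OF x0 b[unfolded td], folded L_def]
  have gd: "labs x \<subseteq> Lb bl" if "x \<in> set L" for x using S(1)[OF that] by (simp add: good_def)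
  have c1: "card (fst ` ?O) = length (remdups (map fst L))"
  proof -
    have "fst (emb e x) = E (fst x)" for x by (cases x) simp
    then have "fst ` ?O = E ` fst ` set L" unfolding S(2) by (simp add: image_image)
    moreover have "fst ` set L \<subseteq> Lb bl" using gd by force
    ultimately have "card (fst ` ?O) = card (fst ` set L)" using E_inj by (metis card_image inj_on_subset)
    then show ?thesis by (simp add: length_remdups_card_conv)
  qed
  have c3: "card (last4 ` ?O) = length (remdups (map last4 L))"
  proof -
    have "last4 (emb e x) = E (last4 x)" for x by (cases x) simp
    then have "last4 ` ?O = E ` last4 ` set L" unfolding S(2) by (simp add: image_image)
    moreover have "last4 ` set L \<subseteq> Lb bl" using gd by force
    ultimately have "card (last4 ` ?O) = card (last4 ` set L)" using E_inj by (metis card_image inj_on_subset)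
    then show ?thesis by (simp add: length_remdups_card_conv)
  qed
  define its where "its = items Ts ?e0 L []"
  have it: "set its = item Ts ?e0 ` {x \<in> set L. apart x}" "distinct its"
    using items_set[where its = "[]"] by (auto simp: its_def)
  have "length (filter (satc \<beta> Ts) (map snd its)) =
    val (length (remdups (map fst L))) (length sn) (length (remdups (map last4 L)))"
  proof (rule chk_ends)
    show "ends \<beta> Ts tt" using en by (simp add: \<beta>_def)
    show "chk tt (val (length (remdups (map fst L))) (length sn) (length (remdups (map last4 L)))) (map snd its)"
      using ver by (simp add: verify_def its_def)
    show "\<forall>c \<in> set (map snd its). length c = length Ts" using it(1) by (auto simp: item_def length_fold_upd)
  qed
  moreover have "length (filter (satc \<beta> Ts) (map snd its)) = card {i \<in> set its. satc \<beta> Ts (snd i)}"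
    using it(2) by (simp add: filter_map comp_def distinct_length_filter Int_def conj_commute)
  moreover have "{i \<in> set its. satc \<beta> Ts (snd i)} = item Ts ?e0 ` {x \<in> set L. weak f (emb e x)}"
  proof -
    \<comment> \<open>\<open>upd\<close> silently ignores a triple that is not listed, so every
      triple mentioned by a word has to occur in \<open>Ts\<close>.\<close>
    have Tin: "fst p \<in> set Ts" if "x \<in> set L" "p \<in> set (lits x)" "apart x" for x p
    proof -
      obtain t1 t2 t3 t4 where xx: "x = (t1, t2, t3, t4)" by (cases x) auto
      have ok: "ok4 w (emb e x)" using S(1)[OF that(1)] by (simp add: good_def)
      note labsx = gd[OF that(1)]
      have "E t1 \<noteq> E t2 \<and> E t2 \<noteq> E t3 \<and> E t3 \<noteq> E t4" using ok4_neq ok unfolding xx emb.simps by blast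
      moreover have "t1 \<noteq> t3 \<and> t2 \<noteq> t4 \<and> t1 \<noteq> t4" using that(3) by (simp add: xx)
      moreover have "p \<in> set (lit t1 t2) \<or> p \<in> set (lit t2 t3) \<or> p \<in> set (lit t3 t4)
          \<or> p \<in> set (lit t1 t3) \<or> p \<in> set (lit t2 t4) \<or> p \<in> set (lit t1 t4)"
        using that(2) unfolding xx lits.simps set_append by blast
      ultimately have "\<exists>s t. s \<in> labs x \<and> t \<in> labs x \<and> s \<noteq> t \<and> p \<in> set (lit s t)"
        unfolding xx labs.simps by blast
      then obtain s t where s: "s \<in> Lb bl" "t \<in> Lb bl" "s \<noteq> t" "p \<in> set (lit s t)"
        using labsx by blast
      obtain a b c d where st: "s = (a, b)" "t = (c, d)" by (metis surj_pair)
      show ?thesis using s Ts unfolding st by (auto simp: Lb_def split: if_splits)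
    qed
    have "satc \<beta> Ts (snd (item Ts ?e0 x)) \<longleftrightarrow> weak f (emb e x)" if "x \<in> set L" "apart x" for x
      using weak_lits[where f = f, OF S(1)[OF that(1)] tri, folded \<beta>_def] Tin[OF that(1) _ that(2)] that(2)
      by (auto simp: item_def satc_fold_upd satc_No)
    moreover have "apart x" if "x \<in> set L" "weak f (emb e x)" for x
      using weak_lits[where f = f, OF S(1)[OF that(1)] tri] that(2) by blast
    ultimately show ?thesis unfolding it(1) by blast
  qed
  moreover have "card (item Ts ?e0 ` {x \<in> set L. weak f (emb e x)}) = card (labs ` {y \<in> ?O. weak f y})"
  proof -
    let ?W = "{x \<in> set L. weak f (emb e x)}"
    have lw: "labs (emb e x) = E ` labs x" for x by (cases x) simp
    have "{y \<in> ?O. weak f y} = emb e ` ?W" unfolding S(2) by blast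
    then have "labs ` {y \<in> ?O. weak f y} = image E ` labs ` ?W" by (simp add: image_image lw)
    moreover have "inj_on (image E) (labs ` ?W)"
      by (rule inj_on_subset[OF inj_on_image_Pow[OF E_inj]]) (use gd in blast)
    ultimately have "card (labs ` {y \<in> ?O. weak f y}) = card (labs ` ?W)" by (simp add: card_image)
    moreover have "labs ` ?W = (\<lambda>i. set (fst i)) ` item Ts ?e0 ` ?W" by (simp add: image_image item_def set_skey)
    moreover have "inj_on (\<lambda>i. set (fst i)) (item Ts ?e0 ` ?W)"
    proof (rule inj_onI)
      fix i j assume "i \<in> item Ts ?e0 ` ?W" "j \<in> item Ts ?e0 ` ?W" and ij: "set (fst i) = set (fst j)"
      then obtain x y where x: "x \<in> set L" "weak f (emb e x)" "i = item Ts ?e0 x"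
        and y: "y \<in> set L" "weak f (emb e y)" "j = item Ts ?e0 y" by blast
      have l: "labs x = labs y" using ij by (simp add: x y item_def set_skey)
      have ca: "card (labs z) = 4" if "z \<in> set L" "weak f (emb e z)" for z
      proof -
        obtain t1 t2 t3 t4 where zz: "z = (t1, t2, t3, t4)" by (cases z) auto
        have ok: "ok4 w (emb e z)" using S(1)[OF that(1)] by (simp add: good_def)
        have "E t1 \<noteq> E t2 \<and> E t2 \<noteq> E t3 \<and> E t3 \<noteq> E t4" using ok4_neq ok unfolding zz emb.simps by blast
        moreover have "apart z" using weak_lits[where f = f, OF S(1)[OF that(1)] tri] that(2) by blast
        ultimately have "t1 \<noteq> t2" "t2 \<noteq> t3" "t3 \<noteq> t4" "t1 \<noteq> t3" "t2 \<noteq> t4" "t1 \<noteq> t4" by (auto simp: zz)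
        then show ?thesis by (simp add: zz)
      qed
      have sm: "\<forall>t \<in> labs z. fst t < snd t \<and> snd t < 8" if "z \<in> set L" for z
        using gd[OF that] len by (auto simp: Lb_def)
      have sk: "skey x = skey y" by (rule skey_unique) (use sm x y l ca in auto)
      \<comment> \<open>A satisfied demand is determined by its triple through
        \<open>\<beta>\<close>, so equal triples give equal demands and, by
        \<open>fold_upd_cong\<close>, equal signs.\<close>
      have bz: "set (lits z) = (\<lambda>T. (T, \<beta> T)) ` fst ` set (lits z)" if "z \<in> set L" "weak f (emb e z)" for z
        using weak_lits[where f = f, OF S(1)[OF that(1)] tri, folded \<beta>_def] that(2) by (force simp: image_image)
      have "fst ` set (lits x) = fst ` set (lits y)"
        using lits_fst[of x] lits_fst[of y] sm[OF x(1)] sm[OF y(1)] ca[OF x(1,2)] l by simp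
      then have "set (lits x) = set (lits y)"
        using bz[OF x(1,2)] bz[OF y(1,2)] by argo
      then have "fold (upd Ts) (lits x) ?e0 = fold (upd Ts) (lits y) ?e0" by (rule fold_upd_cong)
      then show "i = j" unfolding x(3) y(3) item_def using sk by simp
    qed
    ultimately show ?thesis by (simp add: card_image)
  qed
  ultimately show ?thesis using c1 c3 S(3) by simp
qed

end

section \<open>Reduction to blocks\<close>

fun arrangements :: "nat \<Rightarrow> nat \<Rightarrow> nat list list" where
  "arrangements 0 k = [[]]"
| "arrangements (Suc m) k = concat (map (\<lambda>p. map (\<lambda>a. a # p) (filter (\<lambda>a. a \<notin> set p) [0..<k])) (arrangements m k))"

fun states :: "nat list \<Rightarrow> nat list list" where
  "states [] = [[]]"
| "states (k # sz) = concat (map (\<lambda>p. map (\<lambda>q. p @ q) (states sz)) (arrangements k k))"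

fun blof :: "nat \<Rightarrow> nat list \<Rightarrow> nat list" where
  "blof i [] = []"
| "blof i (k # sz) = replicate k i @ blof (Suc i) sz"

definition block_labs :: "nat list \<Rightarrow> lab list" where
  "block_labs bl = concat (map (\<lambda>i. map (Pair i) (filter (\<lambda>j. bl ! i = bl ! j) [Suc i..<length bl])) [0..<length bl])"

definition triples :: "nat list \<Rightarrow> trip list" where
  "triples bl = concat (map (\<lambda>(i, j). map (\<lambda>k. (i, j, k)) (filter (\<lambda>k. bl ! j = bl ! k) [Suc j..<length bl])) (block_labs bl))"

definition quads :: "nat list \<Rightarrow> (nat \<times> trip) list" where
  "quads bl = concat (map (\<lambda>(j, k, l). map (\<lambda>i. (i, j, k, l)) (filter (\<lambda>i. bl ! i = bl ! j) [0..<j])) (triples bl))"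

text \<open>The orientations of the four triples of \<open>x < y < z < t\<close>, listed lexicographically, change at most
  once; \<open>None\<close> stands for an orientation that is not yet chosen.\<close>

definition bad3 :: "bool option \<Rightarrow> bool option \<Rightarrow> bool option \<Rightarrow> bool" where
  "bad3 x y z \<longleftrightarrow> x \<noteq> None \<and> y \<noteq> None \<and> x = z \<and> y \<noteq> x"

definition bad4 :: "bool option \<Rightarrow> bool option \<Rightarrow> bool option \<Rightarrow> bool option \<Rightarrow> bool" where
  "bad4 p q r s \<longleftrightarrow> bad3 p q r \<or> bad3 q r s \<or> bad3 p q s \<or> bad3 p r s"

fun bad :: "(trip \<times> bool) list \<Rightarrow> nat \<times> trip \<Rightarrow> bool" where
  "bad as (x, y, z, t) = bad4 (map_of as (x, y, z)) (map_of as (x, y, t)) (map_of as (x, z, t)) (map_of as (y, z, t))"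

text \<open>\<open>triples\<close> lists lexicographically, so \<open>(y, z, t)\<close> is the last
  of the four triples of \<open>x < y < z < t\<close> to be assigned. It is the second component of
  the entry in \<open>quads\<close>, and the filter therefore tests each quadruple at the moment
  when all its orientations are known.\<close>

fun mkt :: "(nat \<times> trip) list \<Rightarrow> trip list \<Rightarrow> (trip \<times> bool) list \<Rightarrow> tree" where
  "mkt Q [] as = Leaf"
| "mkt Q (T # Ts) as =
    Node (if list_ex (bad ((T, True) # as)) (filter (\<lambda>q. snd q = T) Q) then Bad else mkt Q Ts ((T, True) # as))
      (if list_ex (bad ((T, False) # as)) (filter (\<lambda>q. snd q = T) Q) then Bad else mkt Q Ts ((T, False) # as))"

text \<open>A word that misses a position is not meant for this list of block sizes: its components
  give a different, smaller list, which is checked separately.\<close>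

definition spans :: "nat \<Rightarrow> lab list \<Rightarrow> bool" where
  "spans m ts \<longleftrightarrow> list_all (\<lambda>i. i \<in> set (map fst ts @ map snd ts)) [0..<m]"

fun run_list :: "trip list \<Rightarrow> sign list \<Rightarrow> tree \<Rightarrow> nat list \<Rightarrow> lab list \<Rightarrow> bool" where
  "run_list Ts e0 tt r [t4, t3, t2, t1] =
    (if spans (length r) [t1, t2, t3, t4] then run Ts e0 tt r (t1, t2, t3, t4) else True)"
| "run_list Ts e0 tt r _ = True"

text \<open>Runs over the admissible words with labels in increasing order, by choosing or skipping
  the head of the sorted list. \<open>r0\<close> is the start state, \<open>r\<close> the state
  after the chosen labels, and \<open>acc\<close> holds these latest first.\<close>

fun chkw :: "trip list \<Rightarrow> sign list \<Rightarrow> tree \<Rightarrow> nat list \<Rightarrow> nat \<Rightarrow> nat list \<Rightarrow> lab list \<Rightarrow> lab list \<Rightarrow> bool" where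
  "chkw Ts e0 tt r0 0 r ls acc = run_list Ts e0 tt r0 acc"
| "chkw Ts e0 tt r0 (Suc d) r [] acc = True"
| "chkw Ts e0 tt r0 (Suc d) r (t # ts) acc =
    ((if r ! fst t < r ! snd t then chkw Ts e0 tt r0 d (swp t r) ts (t # acc) else True)
      \<and> chkw Ts e0 tt r0 (Suc d) r ts acc)"

definition check_states :: "nat list \<Rightarrow> trip list \<Rightarrow> lab list \<Rightarrow> tree \<Rightarrow> nat list list \<Rightarrow> bool" where
  "check_states bl Ts Ls tt rs \<longleftrightarrow> list_all (\<lambda>r. chkw Ts (replicate (length Ts) No) tt r 4 r Ls []) rs"

definition check :: "nat list \<Rightarrow> nat list list \<Rightarrow> bool" where
  "check bl rs \<longleftrightarrow> check_states bl (triples bl) (block_labs bl) (mkt (quads bl) (triples bl) []) rs"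

definition sorted_labs :: "nat list \<Rightarrow> bool" where
  "sorted_labs bl \<longleftrightarrow> sorted_wrt (<) (map code (block_labs bl))"

section \<open>Blocks of values and their relative order\<close>

lemma set_arrangements: "length p = m \<Longrightarrow> distinct p \<Longrightarrow> set p \<subseteq> {..<k} \<Longrightarrow> p \<in> set (arrangements m k)"
proof (induction m arbitrary: p)
  case (Suc m)
  obtain a q where p: "p = a # q" using Suc.prems(1) by (cases p) auto
  have "q \<in> set (arrangements m k)" using Suc.prems p by (intro Suc.IH) auto
  then show ?case using Suc.prems p by auto
qed simp

definition ranks :: "(nat \<Rightarrow> nat) \<Rightarrow> nat list \<Rightarrow> nat list" where
  "ranks w C = map (\<lambda>x. card {y \<in> set C. w y < w x}) C"

lemma rank_less_iff:
  assumes "x \<in> set C" "y \<in> set C"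
  shows "card {z \<in> set C. w z < w x} < card {z \<in> set C. w z < w y} \<longleftrightarrow> w x < (w y :: nat)"
proof -
  have *: "card {z \<in> set C. w z < w x} < card {z \<in> set C. w z < w y}" if "w x < w y" "x \<in> set C" for x y
    using that by (intro psubset_card_mono) auto
  have "card {z \<in> set C. w z < w y} \<le> card {z \<in> set C. w z < w x}" if "\<not> w x < w y"
    using that by (intro card_mono) auto
  then show ?thesis using *[of x y] assms by fastforce
qed

lemma ranks_arrangement:
  assumes "inj w" "distinct C"
  shows "ranks w C \<in> set (arrangements (length C) (length C))"
proof (rule set_arrangements)
  show "length (ranks w C) = length C" by (simp add: ranks_def)
  have "inj_on (\<lambda>x. card {y \<in> set C. w y < w x}) (set C)"
  proof (rule inj_onI)
    fix x y assume xy: "x \<in> set C" "y \<in> set C" "card {z \<in> set C. w z < w x} = card {z \<in> set C. w z < w y}"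
    then have "\<not> w x < w y" "\<not> w y < w x" using rank_less_iff[OF xy(1,2), of w] rank_less_iff[OF xy(2,1), of w] by auto
    then show "x = y" using assms(1) by (metis injD linorder_neqE_nat)
  qed
  then show "distinct (ranks w C)" using assms(2) by (simp add: ranks_def distinct_map)
  show "set (ranks w C) \<subseteq> {..<length C}"
  proof
    fix k assume "k \<in> set (ranks w C)"
    then obtain x where x: "x \<in> set C" "k = card {y \<in> set C. w y < w x}" by (auto simp: ranks_def)
    have "{y \<in> set C. w y < w x} \<subset> set C" using x by auto
    then have "k < card (set C)" unfolding x(2) by (intro psubset_card_mono) auto
    then show "k \<in> {..<length C}" using card_length[of C] by simp
  qed
qed

lemma ranks_states:
  assumes "inj w" "\<forall>C \<in> set Cs. distinct C"
  shows "concat (map (ranks w) Cs) \<in> set (states (map length Cs))"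
  using assms(2) by (induction Cs) (auto intro: ranks_arrangement[OF assms(1)])

lemma blof_ge: "i < length (blof k sz) \<Longrightarrow> k \<le> blof k sz ! i"
proof (induction sz arbitrary: k i)
  case (Cons a sz)
  show ?case
  proof (cases "i < a")
    case True then show ?thesis by (simp add: nth_append)
  next
    case False
    then have "i - a < length (blof (Suc k) sz)" using Cons.prems by simp
    then show ?thesis using Cons.IH[of "i - a" "Suc k"] False by (simp add: nth_append)
  qed
qed simp

lemma length_blof: "length (blof k sz) = sum_list sz"
  by (induction sz arbitrary: k) auto

lemma same_block_cases:
  assumes "i < length (blof k (map length (C # Cs)))" "j < length (blof k (map length (C # Cs)))"
    and "blof k (map length (C # Cs)) ! i = blof k (map length (C # Cs)) ! j"
  obtains "i < length C" "j < length C"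
  | "\<not> i < length C" "\<not> j < length C" "i - length C < length (blof (Suc k) (map length Cs))"
    "j - length C < length (blof (Suc k) (map length Cs))"
    "blof (Suc k) (map length Cs) ! (i - length C) = blof (Suc k) (map length Cs) ! (j - length C)"
proof -
  let ?B = "blof (Suc k) (map length Cs)"
  have l: "i < length C + length ?B" "j < length C + length ?B" using assms by simp_all
  have ge: "m - length C < length ?B \<Longrightarrow> ?B ! (m - length C) \<noteq> k" for m
    using blof_ge[of "m - length C" "Suc k" "map length Cs"] by auto
  consider "i < length C" "j < length C" | "i < length C" "\<not> j < length C" | "\<not> i < length C" "j < length C"
    | "\<not> i < length C" "\<not> j < length C" by blast
  then show thesis
  proof cases
    case 1 then show ?thesis using that by blast
  next
    case 2
    then have "j - length C < length ?B" using l by linarith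
    then show ?thesis using assms(3) 2 ge[of j] by (simp add: nth_append)
  next
    case 3
    then have "i - length C < length ?B" using l by linarith
    then show ?thesis using assms(3) 3 ge[of i] by (simp add: nth_append)
  next
    case 4 then show ?thesis using that(2) assms(3) l by (simp add: nth_append)
  qed
qed

lemma block_nth:
  assumes "i < length (blof k (map length Cs))" "j < length (blof k (map length Cs))"
    and "blof k (map length Cs) ! i = blof k (map length Cs) ! j"
  shows "\<exists>C \<in> set Cs. \<exists>a b. a < length C \<and> b < length C \<and> concat Cs ! i = C ! a \<and> concat Cs ! j = C ! b \<and> (i < j \<longleftrightarrow> a < b)
    \<and> concat (map (ranks w) Cs) ! i = ranks w C ! a \<and> concat (map (ranks w) Cs) ! j = ranks w C ! b"
  using assms
proof (induction Cs arbitrary: k i j)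
  case (Cons C Cs)
  have lr: "length (ranks w C) = length C" by (simp add: ranks_def)
  from Cons.prems show ?case
  proof (cases rule: same_block_cases)
    case 1
    then show ?thesis by (intro bexI[of _ C] exI[of _ i] exI[of _ j]) (simp_all add: nth_append lr)
  next
    case 2
    from Cons.IH[OF 2(3,4,5)] obtain D a b where D: "D \<in> set Cs" "a < length D" "b < length D"
      "concat Cs ! (i - length C) = D ! a" "concat Cs ! (j - length C) = D ! b"
      "i - length C < j - length C \<longleftrightarrow> a < b"
      "concat (map (ranks w) Cs) ! (i - length C) = ranks w D ! a"
      "concat (map (ranks w) Cs) ! (j - length C) = ranks w D ! b" by blast
    have "i < j \<longleftrightarrow> i - length C < j - length C" using 2(1,2) by linarith
    then show ?thesis using D 2(1,2)
      by (intro bexI[of _ D] exI[of _ a] exI[of _ b]) (simp_all add: nth_append lr)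
  qed
qed simp

lemma block_index:
  assumes "C \<in> set Cs" "x \<in> set C" "y \<in> set C"
  shows "\<exists>i j. i < length (blof k (map length Cs)) \<and> j < length (blof k (map length Cs)) \<and> concat Cs ! i = x \<and> concat Cs ! j = y
    \<and> blof k (map length Cs) ! i = blof k (map length Cs) ! j"
  using assms(1)
proof (induction Cs arbitrary: k)
  case (Cons D Cs)
  show ?case
  proof (cases "C = D")
    case True
    obtain a b where ab: "a < length C" "b < length C" "C ! a = x" "C ! b = y"
      using assms(2,3) by (auto simp: in_set_conv_nth)
    then show ?thesis using True by (intro exI[of _ a] exI[of _ b]) (simp add: nth_append)
  next
    case False
    with Cons obtain i j where ij: "i < length (blof (Suc k) (map length Cs))" "j < length (blof (Suc k) (map length Cs))"
      "concat Cs ! i = x" "concat Cs ! j = y" "blof (Suc k) (map length Cs) ! i = blof (Suc k) (map length Cs) ! j"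
      by (metis set_ConsD)
    then show ?thesis by (intro exI[of _ "length D + i"] exI[of _ "length D + j"]) (simp add: nth_append)
  qed
qed simp

lemma length_concat_blof: "length (concat Cs) = length (blof k (map length Cs))"
  by (simp add: length_blof length_concat)

lemma block_search_blocks:
  assumes "inj w" "distinct (concat Cs)" "\<forall>C \<in> set Cs. sorted_wrt (<) C"
  shows "block_search (blof 0 (map length Cs)) (nth (concat Cs)) w (concat (map (ranks w) Cs))"
proof unfold_locales
  let ?bl = "blof 0 (map length Cs)"
  show "inj w" by (rule assms)
  fix i j assume ij: "i < length ?bl" "j < length ?bl"
  show "concat Cs ! i = concat Cs ! j \<Longrightarrow> i = j"
    using assms(2) ij unfolding length_concat_blof[of Cs 0, symmetric] by (simp add: nth_eq_iff_index_eq)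
next
  let ?bl = "blof 0 (map length Cs)"
  fix i j assume ij: "i < j" "j < length ?bl" "?bl ! i = ?bl ! j"
  then have "i < length ?bl" by simp
  from block_nth[OF this ij(2,3), of w] obtain C a b where C: "C \<in> set Cs" "a < length C" "b < length C"
    "concat Cs ! i = C ! a" "concat Cs ! j = C ! b" "i < j \<longleftrightarrow> a < b" by blast
  then show "concat Cs ! i < concat Cs ! j" using assms(3) ij(1) by (auto simp: sorted_wrt_iff_nth_less)
next
  let ?bl = "blof 0 (map length Cs)"
  show "rel ?bl (nth (concat Cs)) (concat (map (ranks w) Cs)) w"
    unfolding rel_def
  proof (intro conjI allI impI)
    show "length (concat (map (ranks w) Cs)) = length ?bl"
      by (simp add: length_blof length_concat comp_def ranks_def)
    fix i j assume ij: "i < length ?bl" "j < length ?bl" "?bl ! i = ?bl ! j"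
    from block_nth[OF ij, of w] obtain C a b where C: "C \<in> set Cs" "a < length C" "b < length C"
      "concat Cs ! i = C ! a" "concat Cs ! j = C ! b" 
      "concat (map (ranks w) Cs) ! i = ranks w C ! a" "concat (map (ranks w) Cs) ! j = ranks w C ! b" by blast
    then show "(w (concat Cs ! i) < w (concat Cs ! j)) = (concat (map (ranks w) Cs) ! i < concat (map (ranks w) Cs) ! j)"
      using rank_less_iff[of "C ! a" C "C ! b" w] by (simp add: ranks_def)
  qed
qed

lemma set_block_labs: "set (block_labs bl) = Lb bl"
  by (force simp: block_labs_def Lb_def image_iff)

lemma set_triples: "set (triples bl) = {(i, j, k). i < j \<and> j < k \<and> k < length bl \<and> bl ! i = bl ! j \<and> bl ! j = bl ! k}"
  by (auto simp: triples_def set_block_labs Lb_def)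

lemma set_quads: "(i, j, k, l) \<in> set (quads bl) \<Longrightarrow>
    i < j \<and> j < k \<and> k < l \<and> l < length bl \<and> bl ! i = bl ! j \<and> bl ! j = bl ! k \<and> bl ! k = bl ! l"
  by (auto simp: quads_def set_triples)

lemma bad3_Some:
  assumes "p = None \<or> p = Some p'" "q = None \<or> q = Some q'" "r = None \<or> r = Some r'" "bad3 p q r"
  shows "bad3 (Some p') (Some q') (Some r')"
  using assms by (auto simp: bad3_def)

lemma ends_mkt:
  assumes "\<And>x y z t. (x, y, z, t) \<in> set Q \<Longrightarrow> \<not> bad4 (Some (\<beta> (x, y, z))) (Some (\<beta> (x, y, t))) (Some (\<beta> (x, z, t))) (Some (\<beta> (y, z, t)))"
    and "\<forall>(T, b) \<in> set as. \<beta> T = b"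
  shows "ends \<beta> Ts (mkt Q Ts as)"
  using assms(2)
proof (induction Ts arbitrary: as)
  case (Cons T Ts)
  have nb: "\<not> bad as' (x, y, z, t)" if "\<forall>(T, b) \<in> set as'. \<beta> T = b" "(x, y, z, t) \<in> set Q" for as' x y z t
  proof -
    have m: "map_of as' T = None \<or> map_of as' T = Some (\<beta> T)" for T
      using that(1) map_of_SomeD[of as' T] by (cases "map_of as' T") auto
    show ?thesis
      using assms(1)[OF that(2)] bad3_Some[OF m m m] unfolding bad.simps bad4_def by blast
  qed
  have nb': "\<not> list_ex (bad as') (filter P Q)" if "\<forall>(T, b) \<in> set as'. \<beta> T = b" for as' P
    using nb[OF that] by (auto simp: list_ex_iff)
  have "\<forall>(S, b) \<in> set ((T, \<beta> T) # as). \<beta> S = b" using Cons.prems by simp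
  from Cons.IH[OF this] nb'[OF this] show ?case by (cases "\<beta> T") simp_all
qed simp

text \<open>If the head \<open>t\<close> of the sorted list is not the first label of
  \<open>ys\<close>, then it does not occur in \<open>ys\<close> at all, so skipping it loses
  nothing. Admissibility enters as \<open>okl\<close> through its recursion equations.\<close>

lemma chkw_sound:
  assumes "chkw Ts e0 tt r0 (length ys) r ls acc" "sorted_wrt (\<lambda>s t. code s < code t) ls"
    "sorted_wrt (\<lambda>s t. code s < code t) ys" "set ys \<subseteq> set ls" "okl r ys"
    and okl: "\<And>r. okl r []" "\<And>r t ts. okl r (t # ts) \<longleftrightarrow> r ! fst t < r ! snd t \<and> okl (swp t r) ts"
  shows "run_list Ts e0 tt r0 (rev ys @ acc)"
  using assms(1-5)
proof (induction ls arbitrary: ys r acc)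
  case Nil
  then show ?case by simp
next
  case (Cons t ts)
  show ?case
  proof (cases ys)
    case Nil
    then show ?thesis using Cons.prems by simp
  next
    case y: (Cons s ss)
    show ?thesis
    proof (cases "s = t")
      case True
      have "chkw Ts e0 tt r0 (length ss) (swp t r) ts (t # acc)"
        using Cons.prems(1,5) y True okl by simp
      moreover have "t \<notin> set ss" using Cons.prems(3) y True by auto
      then have "set ss \<subseteq> set ts" using Cons.prems(4) y by auto
      ultimately show ?thesis
        using Cons.IH[of ss "swp t r" "t # acc"] Cons.prems y True okl by simp
    next
      case False
      have "t \<notin> set ys"
      proof
        assume "t \<in> set ys"
        then have "code s < code t" using y False Cons.prems(3) by auto
        moreover have "s \<in> set ts" using Cons.prems(4) y False by auto
        then have "code t < code s" using Cons.prems(2) by auto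
        ultimately show False by simp
      qed
      then have "set ys \<subseteq> set ts" using Cons.prems(4) by auto
      then show ?thesis using Cons.IH[of ys r acc] Cons.prems y by simp
    qed
  qed
qed

text \<open>Each label merges at most two classes and so raises the sum of \<open>card C - 1\<close> by at most one.\<close>

lemma components:
  assumes "finite V" "\<forall>t \<in> set ts. fst t \<in> V \<and> snd t \<in> V"
  shows "\<exists>P. finite P \<and> pairwise disjnt P \<and> \<Union> P = V \<and> {} \<notin> P \<and> (\<Sum>C\<in>P. card C - 1) \<le> length ts
    \<and> (\<forall>t \<in> set ts. \<exists>C \<in> P. fst t \<in> C \<and> snd t \<in> C)"
  using assms(2)
proof (induction ts)
  case Nil
  show ?case
    by (rule exI[of _ "(\<lambda>v. {v}) ` V"]) (use assms(1) in \<open>auto simp: pairwise_def disjnt_def\<close>)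
next
  case (Cons t ts)
  then obtain P where P: "finite P" "pairwise disjnt P" "\<Union> P = V" "{} \<notin> P" "(\<Sum>C\<in>P. card C - 1) \<le> length ts"
    and cov: "\<forall>t \<in> set ts. \<exists>C \<in> P. fst t \<in> C \<and> snd t \<in> C" by auto
  obtain C D where C: "C \<in> P" "fst t \<in> C" and D: "D \<in> P" "snd t \<in> D" using P(3) Cons.prems by auto
  show ?case
  proof (cases "C = D")
    case True
    then show ?thesis using P cov C D by (intro exI[of _ P]) auto
  next
    case False
    define P' where "P' = insert (C \<union> D) (P - {C, D})"
    have fin: "finite C" "finite D" using P(1,3) C D assms(1) by (meson Union_upper finite_subset)+
    have disj: "C \<inter> D = {}" using P(2) C D False by (auto simp: pairwise_def disjnt_def)
    have nin: "C \<union> D \<notin> P - {C, D}"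
    proof
      assume "C \<union> D \<in> P - {C, D}"
      then have "disjnt (C \<union> D) C" using pairwiseD[OF P(2) _ C(1), of "C \<union> D"] by simp
      then show False using C(2) by (auto simp: disjnt_def)
    qed
    have c: "card (C \<union> D) = card C + card D" using card_Un_disjoint[OF fin disj] .
    have pos: "0 < card C" "0 < card D" using fin C D by (auto simp: card_gt_0_iff)
    have "(\<Sum>X\<in>P. card X - 1) = (card C - 1) + ((card D - 1) + (\<Sum>X\<in>P - {C, D}. card X - 1))"
      using P(1) C(1) D(1) False
      by (simp add: sum.remove[of P C] sum.remove[of "P - {C}" D] Diff_insert2[symmetric] insert_commute)
    moreover have "(\<Sum>X\<in>P'. card X - 1) = (card (C \<union> D) - 1) + (\<Sum>X\<in>P - {C, D}. card X - 1)"
      unfolding P'_def using P(1) nin by (intro sum.insert) auto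
    ultimately have "(\<Sum>X\<in>P'. card X - 1) \<le> length (t # ts)" using P(5) c pos by simp
    moreover have "disjnt (C \<union> D) X \<and> disjnt X (C \<union> D)" if "X \<in> P - {C, D}" for X
      using pairwiseD[OF P(2) C(1), of X] pairwiseD[OF P(2) D(1), of X] that by (auto simp: disjnt_def)
    then have "pairwise disjnt P'"
      unfolding P'_def pairwise_insert using pairwise_subset[OF P(2), of "P - {C, D}"] by blast
    moreover have "\<Union> P' = V" using P(3) C D by (auto simp: P'_def)
    moreover have "{} \<notin> P'" using P(4) C by (auto simp: P'_def)
    moreover have "\<forall>s \<in> set (t # ts). \<exists>X \<in> P'. fst s \<in> X \<and> snd s \<in> X"
    proof
      fix s assume "s \<in> set (t # ts)"
      then consider "s = t" | X where "X \<in> P" "fst s \<in> X" "snd s \<in> X" using cov by auto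
      then show "\<exists>X \<in> P'. fst s \<in> X \<and> snd s \<in> X"
      proof cases
        case 1 then show ?thesis using C D by (auto simp: P'_def)
      next
        case 2 then show ?thesis by (cases "X = C \<or> X = D") (auto simp: P'_def)
      qed
    qed
    moreover have "finite P'" using P(1) by (simp add: P'_def)
    ultimately show ?thesis by blast
  qed
qed

text \<open>Subtracting 1 from each size leaves a partition of a number from 0 to 4; there are 1 + 1
  + 2 + 3 + 5 = 12 of these. Sums below 4 occur when the labels contain cycles or
  repetitions.\<close>

lemma sizes_cases:
  assumes "sorted_wrt (\<ge>) sz" "\<forall>k \<in> set sz. 2 \<le> k" "(\<Sum>k\<leftarrow>sz. k - 1) \<le> (4 :: nat)"
  shows "sz \<in> {[], [2], [3], [4], [5], [2,2], [3,2], [3,3], [4,2], [2,2,2], [3,2,2], [2,2,2,2]}"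
proof -
  have len: "length sz \<le> (\<Sum>k\<leftarrow>sz. k - 1)" using assms(2) by (induction sz) auto
  then have "length sz \<le> 4" using assms(3) by linarith
  then consider "sz = []" | a where "sz = [a]" | a b where "sz = [a, b]" | a b c where "sz = [a, b, c]"
    | a b c d where "sz = [a, b, c, d]"
    by (auto simp: le_Suc_eq numeral_eq_Suc length_Suc_conv)
  then show ?thesis
  proof cases
    case 2
    then have "2 \<le> a" "a - 1 \<le> 4" using assms by simp_all
    then have "a = 2 \<or> a = 3 \<or> a = 4 \<or> a = 5" by arith
    then show ?thesis using 2 by auto
  next
    case 3
    then have "2 \<le> b" "b \<le> a" "a - 1 + (b - 1) \<le> 4" using assms by (simp_all del: diff_Suc_1)
    then have "b = 2 \<and> (a = 2 \<or> a = 3 \<or> a = 4) \<or> b = 3 \<and> a = 3" by arith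
    then show ?thesis using 3 by auto
  next
    case 4
    have "2 \<le> c" "c \<le> b" "b \<le> a" "a - 1 + ((b - 1) + (c - 1)) \<le> 4" using assms(1,2) assms(3)[unfolded 4 list.map sum_list.Cons sum_list.Nil add_0_right] 4 by simp_all
    then have "c = 2 \<and> b = 2 \<and> (a = 2 \<or> a = 3)" by arith
    then show ?thesis using 4 by auto
  next
    case 5
    have "2 \<le> d" "d \<le> c" "c \<le> b" "b \<le> a" using assms(1,2) 5 by simp_all
    moreover have "a - 1 + ((b - 1) + ((c - 1) + (d - 1))) \<le> 4"
      using assms(3)[unfolded 5 list.map sum_list.Cons sum_list.Nil add_0_right] .
    ultimately have "a = 2 \<and> b = 2 \<and> c = 2 \<and> d = 2" by linarith
    then show ?thesis using 5 by simp
  qed simp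
qed

text \<open>Components with one element carry no label and are dropped; the others are listed by
  decreasing size, so that one list of sizes represents all its permutations.\<close>

lemma block_structure:
  assumes "finite V" "\<forall>t \<in> set ts. fst t \<in> V \<and> snd t \<in> V \<and> fst t < (snd t :: nat)" "length ts \<le> 4"
  obtains Cs where "distinct (concat Cs)" "\<forall>C \<in> set Cs. sorted_wrt (<) C" "set (concat Cs) \<subseteq> V"
    "\<forall>t \<in> set ts. \<exists>C \<in> set Cs. fst t \<in> set C \<and> snd t \<in> set C"
    "map length Cs \<in> {[], [2], [3], [4], [5], [2,2], [3,2], [3,3], [4,2], [2,2,2], [3,2,2], [2,2,2,2]}"
proof -
  obtain P where P: "finite P" "pairwise disjnt P" "\<Union> P = V" "(\<Sum>C\<in>P. card C - 1) \<le> length ts"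
    and cov: "\<forall>t \<in> set ts. \<exists>C \<in> P. fst t \<in> C \<and> snd t \<in> C"
    using components[OF assms(1), of ts] assms(2) by blast
  define Q where "Q = {C \<in> P. 2 \<le> card C}"
  have finC: "finite C" if "C \<in> P" for C using that P(3) assms(1) by (meson Union_upper finite_subset)
  obtain xs where xs: "set xs = Q" "distinct xs" using P(1) finite_distinct_list[of Q] by (auto simp: Q_def)
  define Ds where "Ds = rev (sort_key card xs)"
  define Cs where "Cs = map sorted_list_of_set Ds"
  have Ds: "set Ds = Q" "distinct Ds" using xs by (auto simp: Ds_def)
  have setC: "set (sorted_list_of_set C) = C" if "C \<in> Q" for C using finC that by (simp add: Q_def)
  have len: "map length Cs = map card Ds" by (simp add: Cs_def)
  have "sorted_wrt (\<ge>) (map length Cs)"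
    unfolding len Ds_def using sorted_sort_key[of card xs] by (simp add: sorted_wrt_rev rev_map[symmetric])
  moreover have "\<forall>k \<in> set (map length Cs). 2 \<le> k" unfolding len using Ds(1) by (auto simp: Q_def)
  moreover have "(\<Sum>k\<leftarrow>map length Cs. k - 1) \<le> 4"
  proof -
    have "(\<Sum>k\<leftarrow>map length Cs. k - 1) = (\<Sum>C\<in>Q. card C - 1)"
      unfolding len map_map comp_def using sum_list_distinct_conv_sum_set[OF Ds(2)] Ds(1) by simp
    also have "\<dots> \<le> (\<Sum>C\<in>P. card C - 1)" using P(1) by (intro sum_mono2) (auto simp: Q_def)
    finally show ?thesis using P(4) assms(3) by simp
  qed
  ultimately have sizes: "map length Cs \<in> {[], [2], [3], [4], [5], [2,2], [3,2], [3,3], [4,2], [2,2,2], [3,2,2], [2,2,2,2]}"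
    by (rule sizes_cases)
  have srt: "\<forall>C \<in> set Cs. sorted_wrt (<) C" by (auto simp: Cs_def)
  have dist: "distinct (concat Cs)"
  proof (rule distinct_concat)
    have "inj_on sorted_list_of_set Q" using setC by (metis inj_onI)
    then show "distinct Cs" using Ds by (simp add: Cs_def distinct_map)
    show "\<And>ys. ys \<in> set Cs \<Longrightarrow> distinct ys" by (auto simp: Cs_def)
    fix ys zs assume yz: "ys \<in> set Cs" "zs \<in> set Cs" "ys \<noteq> zs"
    then obtain C D where "C \<in> Q" "D \<in> Q" "ys = sorted_list_of_set C" "zs = sorted_list_of_set D"
      using Ds(1) by (auto simp: Cs_def)
    with yz(3) setC P(2) show "set ys \<inter> set zs = {}"
      unfolding pairwise_def disjnt_def Q_def by (metis (no_types, lifting) mem_Collect_eq)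
  qed
  have sub: "set (concat Cs) \<subseteq> V" using setC Ds(1) P(3) by (auto simp: Cs_def Q_def)
  have "\<forall>t \<in> set ts. \<exists>C \<in> set Cs. fst t \<in> set C \<and> snd t \<in> set C"
  proof
    fix t assume t: "t \<in> set ts"
    with cov obtain C where C: "C \<in> P" "fst t \<in> C" "snd t \<in> C" by blast
    have "fst t \<noteq> snd t" using assms(2) t by auto
    then have "card {fst t, snd t} = 2" by simp
    moreover have "card {fst t, snd t} \<le> card C" using C finC by (intro card_mono) auto
    ultimately have "C \<in> Q" using C by (simp add: Q_def)
    then show "\<exists>C \<in> set Cs. fst t \<in> set C \<and> snd t \<in> set C"
      using C setC Ds(1) by (intro bexI[of _ "sorted_list_of_set C"]) (auto simp: Cs_def)
  qed
  then show thesis by (rule that[OF dist srt sub _ sizes])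
qed

section \<open>The finite verification\<close>

lemma check_small:
  "list_all (\<lambda>sz. check (blof 0 sz) (states sz))
    [[], [2], [3], [4], [2,2], [3,2], [3,3], [4,2], [2,2,2], [3,2,2], [2,2,2,2]]"
  by code_simp

text \<open>A single block of five has 120 states and is by far the largest case, so it is cut into
  five evaluations. Small entries in front admit more labels at the start, hence the finer division
  there.\<close>

lemma check_5_01: "check (blof 0 [5]) (filter (\<lambda>r. r ! 0 = 0 \<and> r ! 1 = 1) (states [5]))"
  by code_simp

lemma check_5_02: "check (blof 0 [5]) (filter (\<lambda>r. r ! 0 = 0 \<and> r ! 1 = 2) (states [5]))"
  by code_simp

lemma check_5_03: "check (blof 0 [5]) (filter (\<lambda>r. r ! 0 = 0 \<and> r ! 1 \<noteq> 1 \<and> r ! 1 \<noteq> 2) (states [5]))"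
  by code_simp

lemma check_5_1: "check (blof 0 [5]) (filter (\<lambda>r. r ! 0 = 1) (states [5]))"
  by code_simp

lemma check_5_2: "check (blof 0 [5]) (filter (\<lambda>r. r ! 0 \<noteq> 0 \<and> r ! 0 \<noteq> 1) (states [5]))"
  by code_simp

text \<open>Sorted labels are what \<open>chkw_sound\<close> asks for; the bound 8 makes
  \<open>code\<close> injective on labels of positions.\<close>

lemma sorted_labs_blof:
  "list_all (\<lambda>sz. sorted_labs (blof 0 sz) \<and> length (blof 0 sz) \<le> 8)
    [[], [2], [3], [4], [5], [2,2], [3,2], [3,3], [4,2], [2,2,2], [3,2,2], [2,2,2,2]]"
  by code_simp

lemma check_blocks:
  assumes "sz \<in> {[], [2], [3], [4], [5], [2,2], [3,2], [3,3], [4,2], [2,2,2], [3,2,2], [2,2,2,2]}"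
    and r: "r \<in> set (states sz)"
  shows "chkw (triples (blof 0 sz)) (replicate (length (triples (blof 0 sz))) No)
    (mkt (quads (blof 0 sz)) (triples (blof 0 sz)) []) r 4 r (block_labs (blof 0 sz)) []"
proof -
  have *: "chkw (triples (blof 0 sz)) (replicate (length (triples (blof 0 sz))) No)
      (mkt (quads (blof 0 sz)) (triples (blof 0 sz)) []) r 4 r (block_labs (blof 0 sz)) []"
    if "check (blof 0 sz) rs" "r \<in> set rs" for rs
    using that by (simp add: check_def check_states_def list_all_iff)
  show ?thesis
  proof (cases "sz = [5]")
    case True
    consider "r ! 0 = 0 \<and> r ! 1 = 1" | "r ! 0 = 0 \<and> r ! 1 = 2" | "r ! 0 = 0 \<and> r ! 1 \<noteq> 1 \<and> r ! 1 \<noteq> 2"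
      | "r ! 0 = 1" | "r ! 0 \<noteq> 0 \<and> r ! 0 \<noteq> 1" by blast
    then show ?thesis
      using *[unfolded True, OF check_5_01] *[unfolded True, OF check_5_02] *[unfolded True, OF check_5_03]
        *[unfolded True, OF check_5_1] *[unfolded True, OF check_5_2] r
      unfolding True set_filter mem_Collect_eq by cases blast+
  next
    case False
    then have "sz \<in> set [[], [2], [3], [4], [2,2], [3,2], [3,3], [4,2], [2,2,2], [3,2,2], [2,2,2,2]]"
      using assms(1) by (simp only: list.set insert_iff empty_iff) blast
    then have "check (blof 0 sz) (states sz)" using check_small unfolding list_all_iff by blast
    then show ?thesis using * r by blast
  qed
qed

section \<open>From an arbitrary orbit to a verified one\<close>

lemma orb_endpoints:
  assumes "inj w" "ok4 w x" "y \<in> orb w x"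
  shows "(\<Union>t\<in>labs y. {fst t, snd t}) = (\<Union>t\<in>labs x. {fst t, snd t})"
  using assms(3)
proof (induction rule: orb_induct)
  case (step y i)
  show ?case using wflip_props(4)[OF assms(1) step.hyps(2)] step.IH by simp
qed simp

text \<open>Two changes of orientation would close a cycle of strict inequalities. For example,
  orientations true, false, true of the first three triples give
  \<open>(x,y) < (x,z) < (x,t) < (x,y)\<close> under \<open>f\<close>.\<close>

lemma consistent_quad:
  fixes f :: "lab \<Rightarrow> nat"
  assumes "\<And>i j k. (i, j, k) \<in> {(x, y, z), (x, y, t), (x, z, t), (y, z, t)} \<Longrightarrow>
    f (i, j) < f (i, k) \<and> f (i, k) < f (j, k) \<or> f (j, k) < f (i, k) \<and> f (i, k) < f (i, j)"
  shows "\<not> bad4 (Some (f (x, y) < f (x, z))) (Some (f (x, y) < f (x, t))) (Some (f (x, z) < f (x, t))) (Some (f (y, z) < f (y, t)))"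
proof -
  have "f (x, y) < f (x, z) \<and> f (x, z) < f (y, z) \<or> f (y, z) < f (x, z) \<and> f (x, z) < f (x, y)"
    "f (x, y) < f (x, t) \<and> f (x, t) < f (y, t) \<or> f (y, t) < f (x, t) \<and> f (x, t) < f (x, y)"
    "f (x, z) < f (x, t) \<and> f (x, t) < f (z, t) \<or> f (z, t) < f (x, t) \<and> f (x, t) < f (x, z)"
    "f (y, z) < f (y, t) \<and> f (y, t) < f (z, t) \<or> f (z, t) < f (y, t) \<and> f (y, t) < f (y, z)"
    using assms by blast+
  then show ?thesis unfolding bad4_def bad3_def option.inject option.distinct by linarith
qed

lemma count_orb:
  assumes R: "refl_order n R" and u: "u \<in> Sn n" and X: "labs X \<subseteq> Tn n" "ok4 (inv u) X"
  defines "O' \<equiv> orb (inv u) X"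
  shows "card (labs ` {y \<in> O'. weak (rank n R) y}) = val (card (fst ` O')) (card (prod2 ` O')) (card (last4 ` O'))"
proof -
  let ?w = "inv u" and ?f = "rank n R"
  obtain t1 t2 t3 t4 where Xt: "X = (t1, t2, t3, t4)" by (cases X) auto
  note inj = inj_inv_Sn[OF u]
  define V where "V = (\<Union>t\<in>labs X. {fst t, snd t})"
  have V: "V \<subseteq> {1..n}" using X(1) by (force simp: V_def Tn_def)
  have finV: "finite V" using V finite_subset by blast
  have T: "\<forall>t \<in> set [t1, t2, t3, t4]. fst t \<in> V \<and> snd t \<in> V \<and> fst t < snd t"
    using X(1) by (auto simp: Xt Tn_def V_def)
  obtain Cs where Cs: "distinct (concat Cs)" "\<forall>C \<in> set Cs. sorted_wrt (<) C" "set (concat Cs) \<subseteq> V"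
    and cov: "\<forall>t \<in> set [t1, t2, t3, t4]. \<exists>C \<in> set Cs. fst t \<in> set C \<and> snd t \<in> set C"
    and sz: "map length Cs \<in> {[], [2], [3], [4], [5], [2,2], [3,2], [3,3], [4,2], [2,2,2], [3,2,2], [2,2,2,2]}"
    by (rule block_structure[OF finV T]) auto
  define bl where "bl = blof 0 (map length Cs)"
  define e where "e = nth (concat Cs)"
  define r where "r = concat (map (ranks ?w) Cs)"
  interpret block_search bl e ?w r
    unfolding bl_def e_def r_def by (rule block_search_blocks[OF inj Cs(1,2)])
  have "sorted_labs bl \<and> length bl \<le> 8"
    unfolding bl_def by (rule bspec[OF sorted_labs_blof[unfolded list_all_iff]]) (use sz in \<open>simp only: list.set\<close>)
  then have len: "length bl \<le> 8" and srt: "sorted_labs bl" by auto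
  have e_V: "e i \<in> V" if "i < length bl" for i
  proof -
    have "i < length (concat Cs)" using that by (simp add: bl_def length_concat_blof[of Cs 0])
    then show ?thesis unfolding e_def using Cs(3) nth_mem by blast
  qed
  have rs: "r \<in> set (states (map length Cs))"
    unfolding r_def by (rule ranks_states[OF inj]) (use Cs(2) strict_sorted_iff in blast)
  have pull: "\<exists>s \<in> Lb bl. t = E s" if "t \<in> set [t1, t2, t3, t4]" for t
  proof -
    from cov that obtain C where C: "C \<in> set Cs" "fst t \<in> set C" "snd t \<in> set C" by blast
    from block_index[OF this, of 0] obtain i j where ij: "i < length bl" "j < length bl" "e i = fst t" "e j = snd t" "bl ! i = bl ! j"
      unfolding bl_def e_def by blast
    have "fst t < snd t" using T that by blast
    then have "i < j" using ij e_less_iff by metis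
    then show ?thesis using ij by (intro bexI[of _ "(i, j)"]) (auto simp: elab_def Lb_def)
  qed
  obtain s1 s2 s3 s4 where s: "s1 \<in> Lb bl" "s2 \<in> Lb bl" "s3 \<in> Lb bl" "s4 \<in> Lb bl"
    "t1 = E s1" "t2 = E s2" "t3 = E s3" "t4 = E s4"
    using pull[of t1] pull[of t2] pull[of t3] pull[of t4] by auto
  define x where "x = (s1, s2, s3, s4)"
  have xX: "X = emb e x" by (simp add: Xt x_def s)
  have gx: "good x" using s X(2) unfolding xX good_def by (simp add: x_def)
  \<comment> \<open>The lexicographic order on positions, pulled back to labels in
    \<open>[n]\<close>. It need not agree with the lexicographic order on \<open>[n]\<close>, as
    \<open>e\<close> may interleave blocks, but the verified start words are increasing in
    positions.\<close>
  define g where "g = (\<lambda>t. code (inv_into (Lb bl) E t))"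
  have gE: "g (E s) = code s" if "s \<in> Lb bl" for s using inv_into_f_f[OF E_inj that] by (simp add: g_def)
  have codeL: "inj_on code (Lb bl)" using code_inj by (rule inj_on_subset) (use len in \<open>auto simp: Lb_def\<close>)
  have "inj_on g (E ` Lb bl)" using codeL gE by (auto simp: inj_on_def)
  moreover have "labs y \<subseteq> E ` Lb bl" if y: "y \<in> orb ?w X" for y
  proof -
    obtain z where "good z" "y = emb e z" using orb_good[OF gx] y xX by blast
    then show ?thesis by (cases z) (auto simp: good_def)
  qed
  moreover have "g (a, b) < g (a, c) \<and> g (a, c) < g (b, c)"
    if st: "s \<in> E ` Lb bl" "t \<in> E ` Lb bl" and abc: "a < b" "b < c" "{a, b, c} = {fst s, snd s} \<union> {fst t, snd t}" for s t a b c
  proof -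
    obtain i j k l where ij: "i < j" "j < length bl" "bl ! i = bl ! j" "s = (e i, e j)"
      and kl: "k < l" "l < length bl" "bl ! k = bl ! l" "t = (e k, e l)"
      using st by (auto simp: Lb_def elab_def)
    have S: "{a, b, c} = {e i, e j, e k, e l}" using abc(3) ij(4) kl(4) by auto
    \<comment> \<open>Labels from different blocks have four distinct end points, while
      \<open>a\<close>, \<open>b\<close>, \<open>c\<close> are only three.\<close>
    have same: "bl ! i = bl ! k"
    proof (rule ccontr)
      assume "bl ! i \<noteq> bl ! k"
      then have "card {e i, e j, e k, e l} = 4" using ij kl by (auto simp: card_insert_if e_eq_iff)
      then show False using abc(1,2) S[symmetric] by (simp add: card_insert_if split: if_splits)
    qed
    have em: "\<exists>m < length bl. bl ! m = bl ! i \<and> e m = z" if "z \<in> {a, b, c}" for z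
    proof -
      have il: "i < length bl" "k < length bl" using ij kl by auto
      have "z = e i \<or> z = e j \<or> z = e k \<or> z = e l" using that unfolding S by simp
      then show ?thesis using il ij(2,3) kl(2,3) same by metis
    qed
    from em[of a] em[of b] em[of c] obtain a' b' c' where m: "a' < length bl" "b' < length bl" "c' < length bl"
      "bl ! a' = bl ! i" "bl ! b' = bl ! i" "bl ! c' = bl ! i" "e a' = a" "e b' = b" "e c' = c" by blast
    have lt: "a' < b'" "b' < c'" using abc m e_less_iff by metis+
    have L: "(a', b') \<in> Lb bl" "(a', c') \<in> Lb bl" "(b', c') \<in> Lb bl" using m lt by (auto simp: Lb_def)
    show ?thesis using gE[OF L(1)] gE[OF L(2)] gE[OF L(3)] m lt len by (simp add: elab_def)
  qed
  ultimately obtain Z where Z: "Z \<in> orb ?w X" "inc g Z" by (rule orb_increasing[OF inj X(2)])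
  obtain z where z: "good z" "Z = emb e z" using orb_good[OF gx] Z(1) xX by blast
  have orbZ: "orb ?w (emb e z) = O'" unfolding O'_def using orb_eq[OF inj X(2) Z(1)] z(2) by simp
  obtain z1 z2 z3 z4 where zz: "z = (z1, z2, z3, z4)" by (cases z) auto
  have zL: "z1 \<in> Lb bl" "z2 \<in> Lb bl" "z3 \<in> Lb bl" "z4 \<in> Lb bl" using z(1) by (auto simp: good_def zz)
  have zinc: "code z1 < code z2" "code z2 < code z3" "code z3 < code z4"
    using Z(2) by (simp_all add: z zz gE zL)
  \<comment> \<open>Admissibility of a list of labels read on rank lists. Primitive recursion on the
    list needs the state as a last argument, which is why the arguments are exchanged in the
    instantiation below.\<close>
  define okl where "okl = rec_list (\<lambda>r. True) (\<lambda>t ts H r. r ! fst t < r ! snd t \<and> H (swp t r))"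
  have "run_list (triples bl) (replicate (length (triples bl)) No) (mkt (quads bl) (triples bl) []) r (rev [z1, z2, z3, z4] @ [])"
  proof (rule chkw_sound[where okl = "\<lambda>r ts. okl ts r"])
    show "chkw (triples bl) (replicate (length (triples bl)) No) (mkt (quads bl) (triples bl) []) r
        (length [z1, z2, z3, z4]) r (block_labs bl) []"
      using check_blocks[OF sz rs, folded bl_def] by (simp add: numeral_eq_Suc)
    show "sorted_wrt (\<lambda>s t. code s < code t) (block_labs bl)" using srt by (simp add: sorted_labs_def sorted_wrt_map)
    show "sorted_wrt (\<lambda>s t. code s < code t) [z1, z2, z3, z4]" using zinc by auto
    show "set [z1, z2, z3, z4] \<subseteq> set (block_labs bl)" using zL by (simp add: set_block_labs)
    have rl: "k ! fst t < k ! snd t" if "rel bl e k w'" "t \<in> Lb bl" "ok1 w' (E t)" for k w' t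
      using that by (cases t) (auto simp: rel_def ok1_def elab_def Lb_def)
    note r1 = rel_swp[OF r_rel zL(1)] note r2 = rel_swp[OF r1 zL(2)] note r3 = rel_swp[OF r2 zL(3)]
    have "ok4 ?w (emb e z)" using z(1) by (simp add: good_def)
    then show "okl [z1, z2, z3, z4] r"
      using rl[OF r_rel zL(1)] rl[OF r1 zL(2)] rl[OF r2 zL(3)] rl[OF r3 zL(4)]
      by (simp add: okl_def zz)
  qed (simp_all add: okl_def)
  moreover have "spans (length r) [z1, z2, z3, z4]"
    unfolding spans_def list_all_iff
  proof
    fix i assume "i \<in> set [0..<length r]"
    then have i: "i < length bl" using r_rel by (simp add: rel_def)
    \<comment> \<open>Every position is an end point of a label of \<open>X\<close>, and flips
      preserve the set of end points, so the increasing representative \<open>Z\<close> meets every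
      position too.\<close>
    have "e i \<in> (\<Union>t\<in>labs Z. {fst t, snd t})" using e_V[OF i] orb_endpoints[OF inj X(2) Z(1)] by (simp add: V_def)
    then have "e i \<in> (\<Union>t\<in>{z1, z2, z3, z4}. {e (fst t), e (snd t)})"
      unfolding z(2) zz by (simp add: elab_def)
    then obtain t where t: "t \<in> {z1, z2, z3, z4}" "e i = e (fst t) \<or> e i = e (snd t)" by blast
    then have "t \<in> Lb bl" using zL by blast
    then have "fst t < length bl" "snd t < length bl" by (auto simp: Lb_def)
    then have "i = fst t \<or> i = snd t" using t(2) i e_eq_iff by blast
    then show "i \<in> set (map fst [z1, z2, z3, z4] @ map snd [z1, z2, z3, z4])" using t(1) by auto
  qed
  ultimately have run: "run (triples bl) (replicate (length (triples bl)) No) (mkt (quads bl) (triples bl) []) r z"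
    by (simp add: zz)
  have e_range: "e i \<in> {1..n}" if "i < length bl" for i using e_V[OF that] V by blast
  have tri: "?f (E (i, j)) < ?f (E (i, k)) \<and> ?f (E (i, k)) < ?f (E (j, k)) \<or> ?f (E (j, k)) < ?f (E (i, k)) \<and> ?f (E (i, k)) < ?f (E (i, j))"
    if "i < j" "j < k" "k < length bl" "bl ! i = bl ! j" "bl ! j = bl ! k" for i j k
    using rank_triple[OF R, of "e i" "e j" "e k"] e_mono[of i j] e_mono[of j k] e_range[of i] e_range[of k] that
    by (simp add: elab_def)
  have en: "ends (\<lambda>(x, y, z). ?f (E (x, y)) < ?f (E (x, z))) (triples bl) (mkt (quads bl) (triples bl) [])"
  proof (rule ends_mkt)
    fix x y z t assume q: "(x, y, z, t) \<in> set (quads bl)"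
    note q' = set_quads[OF q]
    show "\<not> bad4 (Some ((\<lambda>(x, y, z). ?f (E (x, y)) < ?f (E (x, z))) (x, y, z)))
        (Some ((\<lambda>(x, y, z). ?f (E (x, y)) < ?f (E (x, z))) (x, y, t)))
        (Some ((\<lambda>(x, y, z). ?f (E (x, y)) < ?f (E (x, z))) (x, z, t)))
        (Some ((\<lambda>(x, y, z). ?f (E (x, y)) < ?f (E (x, z))) (y, z, t)))"
      unfolding prod.case
    proof (rule consistent_quad[where f = "\<lambda>s. ?f (E s)"])
      fix i j k assume "(i, j, k) \<in> {(x, y, z), (x, y, t), (x, z, t), (y, z, t)}"
      then have "i < j \<and> j < k \<and> k < length bl \<and> bl ! i = bl ! j \<and> bl ! j = bl ! k" using q' by auto
      then show "?f (E (i, j)) < ?f (E (i, k)) \<and> ?f (E (i, k)) < ?f (E (j, k))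
          \<or> ?f (E (j, k)) < ?f (E (i, k)) \<and> ?f (E (i, k)) < ?f (E (i, j))"
        using tri[of i j k] by blast
    qed
  qed simp
  show ?thesis
    using count_items[OF z(1) run en tri _ len] unfolding orbZ by (simp add: set_triples)
qed

theorem theorem7p10:
  fixes n :: nat and u v :: "nat \<Rightarrow> nat" and F :: "(nat \<Rightarrow> nat) list set"
    and R :: "(nat \<times> nat) rel"
  assumes "F \<in> flipclasses n 4 u v"
    and "refl_order n R"
  shows "cF n R F =
    (if tvec 4 F \<in> {[1,5,10,5,1], [1,8,14,8,1]} then 3
     else if tvec 4 F ! 1 + tvec 4 F ! 3 \<ge> 12 \<and> tvec 4 F \<noteq> [1,8,14,8,1] then 2
     else 1)"
proof -
  from assms(1) obtain X where u: "u \<in> Sn n" and X: "labs X \<subseteq> Tn n" "ok4 (inv u) X"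
    and F: "F = pathof u ` orb (inv u) X" by (rule flipclass_word)
  have "cF n R F = val (card (fst ` orb (inv u) X)) (card (prod2 ` orb (inv u) X)) (card (last4 ` orb (inv u) X))"
    unfolding F cF_orb[OF assms(2) u X] by (rule count_orb[OF assms(2) u X])
  then show ?thesis unfolding F tvec_orb[OF u X] by (auto simp: val_def)
qed

end
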